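(* For each $n\in\omega$, every consistent extension $T$ of $\mathsf{KP}$ in the language $\{\in\}$ of set theory that is axiomatized by a set of $\Sigma_n^{\mathrm{Levy}}$-sentences is incomplete, i.e., there is a sentence $\psi$ such that $T$ proves neither $\psi$ nor $\neg\psi$.
   Context: $\Sigma_n^{\mathrm{Levy}}$ is the Levy hierarchy of set-theoretic formulae: $\Sigma_0^{\mathrm{Levy}}=\Pi_0^{\mathrm{Levy}}$ are the formulae all of whose quantifiers are bounded (of the form $\exists x\in y$, $\forall x\in y$), and $\Sigma_{n+1}^{\mathrm{Levy}}$ formulae are of the form $\exists \vec{x}\,\varphi$ with $\varphi\in\Pi_n^{\mathrm{Levy}}$ ($\Pi_{n+1}^{\mathrm{Levy}}$ dually). $\mathsf{KP}$ here denotes Kripke–Platek set theory (extensionality, pairing, union, $\Delta_0$-separation, $\Delta_0$-collection) with the scheme of foundation limited to $\Pi_1^{\mathrm{Levy}}$-formulae (equivalently, $\in$-induction for $\Sigma_1^{\mathrm{Levy}}$-formulae); it does not include the axiom of infinity and is finitely axiomatizable. *)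

theory Defs
  imports Main
begin

text \<open>
  First-order formulas with equality in the language with the single binary relation symbol
  of membership. Variables are de Bruijn indices: inside \<open>Forall \<phi>\<close> the index \<open>0\<close> is the
  bound variable and \<open>Suc i\<close> denotes what \<open>i\<close> denotes outside.
\<close>

datatype fm =
    Falsum
  | Equal nat nat
  | Mem nat nat
  | Imp fm fm
  | Forall fm

abbreviation Neg :: "fm \<Rightarrow> fm" where
  "Neg \<phi> \<equiv> Imp \<phi> Falsum"

abbreviation And :: "fm \<Rightarrow> fm \<Rightarrow> fm" where
  "And \<phi> \<psi> \<equiv> Neg (Imp \<phi> (Neg \<psi>))"

abbreviation Or :: "fm \<Rightarrow> fm \<Rightarrow> fm" where
  "Or \<phi> \<psi> \<equiv> Imp (Neg \<phi>) \<psi>"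

abbreviation Iff :: "fm \<Rightarrow> fm \<Rightarrow> fm" where
  "Iff \<phi> \<psi> \<equiv> And (Imp \<phi> \<psi>) (Imp \<psi> \<phi>)"

abbreviation Exists :: "fm \<Rightarrow> fm" where
  "Exists \<phi> \<equiv> Neg (Forall (Neg \<phi>))"

text \<open>
  Bounded quantifiers. The index \<open>y\<close> of the bounding variable is read outside the quantifier;
  the shift to \<open>Suc y\<close> ensures that it differs from the quantified variable.
\<close>

abbreviation BForall :: "nat \<Rightarrow> fm \<Rightarrow> fm" where
  "BForall y \<phi> \<equiv> Forall (Imp (Mem 0 (Suc y)) \<phi>)"

abbreviation BExists :: "nat \<Rightarrow> fm \<Rightarrow> fm" where
  "BExists y \<phi> \<equiv> Exists (And (Mem 0 (Suc y)) \<phi>)"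

primrec fv :: "fm \<Rightarrow> nat set" where
  "fv Falsum = {}"
| "fv (Equal i j) = {i, j}"
| "fv (Mem i j) = {i, j}"
| "fv (Imp \<phi> \<psi>) = fv \<phi> \<union> fv \<psi>"
| "fv (Forall \<phi>) = {i. Suc i \<in> fv \<phi>}"

definition sentence :: "fm \<Rightarrow> bool" where
  "sentence \<phi> \<longleftrightarrow> fv \<phi> = {}"

definition universal_closure :: "fm \<Rightarrow> fm" where
  "universal_closure \<phi> = (Forall ^^ (LEAST k. fv \<phi> \<subseteq> {..<k})) \<phi>"

text \<open>Capture-avoiding replacement of each free variable \<open>i\<close> by the variable \<open>f i\<close>.\<close>

primrec rename :: "(nat \<Rightarrow> nat) \<Rightarrow> fm \<Rightarrow> fm" where
  "rename f Falsum = Falsum"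
| "rename f (Equal i j) = Equal (f i) (f j)"
| "rename f (Mem i j) = Mem (f i) (f j)"
| "rename f (Imp \<phi> \<psi>) = Imp (rename f \<phi>) (rename f \<psi>)"
| "rename f (Forall \<phi>) = Forall (rename (case_nat 0 (\<lambda>i. Suc (f i))) \<phi>)"

text \<open>
  \<open>inst x \<phi>\<close> is the body \<open>\<phi>\<close> of a quantifier with the variable \<open>x\<close> put for the bound variable.
  \<open>fresh k \<phi>\<close> is \<open>\<phi>\<close> read in a context with one additional variable, inserted at position \<open>k\<close>;
  that variable is not free in \<open>fresh k \<phi>\<close>.
\<close>

definition inst :: "nat \<Rightarrow> fm \<Rightarrow> fm" where
  "inst x \<phi> = rename (case_nat x (\<lambda>i. i)) \<phi>"

definition fresh :: "nat \<Rightarrow> fm \<Rightarrow> fm" where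
  "fresh k \<phi> = rename (\<lambda>i. if i < k then i else Suc i) \<phi>"

text \<open>
  A Hilbert calculus in the style of Enderton for classical first-order logic with equality:
  the logical axioms are closed under generalization, and modus ponens is the only rule.
\<close>

inductive_set logical_axioms :: "fm set" where
  K: "Imp \<phi> (Imp \<psi> \<phi>) \<in> logical_axioms"
| S: "Imp (Imp \<phi> (Imp \<psi> \<chi>)) (Imp (Imp \<phi> \<psi>) (Imp \<phi> \<chi>)) \<in> logical_axioms"
| Double_Neg: "Imp (Neg (Neg \<phi>)) \<phi> \<in> logical_axioms"
| Forall_Inst: "Imp (Forall \<phi>) (inst x \<phi>) \<in> logical_axioms"
| Forall_Imp: "Imp (Forall (Imp \<phi> \<psi>)) (Imp (Forall \<phi>) (Forall \<psi>)) \<in> logical_axioms"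
| Forall_Vacuous: "Imp \<phi> (Forall (fresh 0 \<phi>)) \<in> logical_axioms"
| Equal_Refl: "Equal x x \<in> logical_axioms"
| Equal_Subst: "Imp (Equal x y) (Imp (inst x \<phi>) (inst y \<phi>)) \<in> logical_axioms"
| Generalization: "\<phi> \<in> logical_axioms \<Longrightarrow> Forall \<phi> \<in> logical_axioms"

inductive proves :: "fm set \<Rightarrow> fm \<Rightarrow> bool" (infix "\<turnstile>" 50) for T :: "fm set" where
  Axiom: "\<phi> \<in> T \<Longrightarrow> T \<turnstile> \<phi>"
| Logical: "\<phi> \<in> logical_axioms \<Longrightarrow> T \<turnstile> \<phi>"
| Modus_Ponens: "T \<turnstile> Imp \<phi> \<psi> \<Longrightarrow> T \<turnstile> \<phi> \<Longrightarrow> T \<turnstile> \<psi>"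

definition consistent :: "fm set \<Rightarrow> bool" where
  "consistent T \<longleftrightarrow> \<not> T \<turnstile> Falsum"

definition extends :: "fm set \<Rightarrow> fm set \<Rightarrow> bool" where
  "extends T S \<longleftrightarrow> (\<forall>\<phi>\<in>S. T \<turnstile> \<phi>)"

definition axiomatized_by :: "fm set \<Rightarrow> fm set \<Rightarrow> bool" where
  "axiomatized_by T A \<longleftrightarrow> (\<forall>\<phi>. sentence \<phi> \<longrightarrow> (T \<turnstile> \<phi> \<longleftrightarrow> A \<turnstile> \<phi>))"

definition incomplete :: "fm set \<Rightarrow> bool" where
  "incomplete T \<longleftrightarrow> (\<exists>\<psi>. sentence \<psi> \<and> \<not> T \<turnstile> \<psi> \<and> \<not> T \<turnstile> Neg \<psi>)"

inductive_set Delta0 :: "fm set" where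
  "Falsum \<in> Delta0"
| "Equal i j \<in> Delta0"
| "Mem i j \<in> Delta0"
| "\<phi> \<in> Delta0 \<Longrightarrow> \<psi> \<in> Delta0 \<Longrightarrow> Imp \<phi> \<psi> \<in> Delta0"
| "\<phi> \<in> Delta0 \<Longrightarrow> BForall y \<phi> \<in> Delta0"
| "\<phi> \<in> Delta0 \<Longrightarrow> BExists y \<phi> \<in> Delta0"

text \<open>Blocks of quantifiers may be empty, so the hierarchy is cumulative.\<close>

fun Levy_Sigma :: "nat \<Rightarrow> fm set" and Levy_Pi :: "nat \<Rightarrow> fm set" where
  "Levy_Sigma 0 = Delta0"
| "Levy_Pi 0 = Delta0"
| "Levy_Sigma (Suc n) = {(Exists ^^ k) \<phi> | k \<phi>. \<phi> \<in> Levy_Pi n}"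
| "Levy_Pi (Suc n) = {(Forall ^^ k) \<phi> | k \<phi>. \<phi> \<in> Levy_Sigma n}"

definition extensionality_ax :: fm where
  "extensionality_ax =
    Forall (Forall (Imp (Forall (Iff (Mem 0 2) (Mem 0 1))) (Equal 1 0)))"

definition pairing_ax :: fm where
  "pairing_ax =
    Forall (Forall (Exists (Forall (Iff (Mem 0 1) (Or (Equal 0 3) (Equal 0 2))))))"

definition union_ax :: fm where
  "union_ax = Forall (Exists (Forall (Iff (Mem 0 1) (BExists 2 (Mem 1 0)))))"

text \<open>
  In the schemes below all further free variables of \<open>\<phi>\<close> are parameters.

  For separation, \<open>\<phi>\<close> has \<open>0 = x\<close> and \<open>1 = a\<close>; the instance says that there is \<open>b\<close> such that
  \<open>x \<in> b \<longleftrightarrow> x \<in> a \<and> \<phi>\<close> for all \<open>x\<close>.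

  For collection, \<open>\<phi>\<close> has \<open>0 = y\<close>, \<open>1 = x\<close> and \<open>2 = a\<close>; the instance says that if
  \<open>\<forall>x\<in>a. \<exists>y. \<phi>\<close>, then there is \<open>b\<close> such that \<open>\<forall>x\<in>a. \<exists>y\<in>b. \<phi>\<close>.

  For foundation, \<open>\<phi>\<close> has \<open>0 = x\<close>; the instance says that if some \<open>x\<close> satisfies \<open>\<phi>\<close>, then there is
  one none of whose elements satisfies \<open>\<phi>\<close>.
\<close>

definition separation :: "fm \<Rightarrow> fm" where
  "separation \<phi> =
    universal_closure (Exists (Forall (Iff (Mem 0 1) (And (Mem 0 2) (fresh 1 \<phi>)))))"

definition collection :: "fm \<Rightarrow> fm" where
  "collection \<phi> =
    universal_closure (Imp (BForall 0 (Exists \<phi>)) (Exists (BForall 1 (BExists 1 (fresh 2 \<phi>)))))"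

definition foundation :: "fm \<Rightarrow> fm" where
  "foundation \<phi> =
    universal_closure (Imp (Exists \<phi>) (Exists (And \<phi> (BForall 0 (Neg (fresh 1 \<phi>))))))"

text \<open>
  Kripke--Platek set theory without infinity, with foundation only for \<open>\<Pi>\<^sub>1\<close>-formulas.
\<close>

definition KP :: "fm set" where
  "KP = {extensionality_ax, pairing_ax, union_ax}
    \<union> separation ` Delta0
    \<union> collection ` Delta0
    \<union> foundation ` Levy_Pi 1"

end

theory Submission
  imports Defs "HOL-Library.Countable_Set"
    "HOL-Library.Diagonal_Subsequence"
begin

text \<open>
  Suppose \<open>T\<close> is complete and let \<open>M\<close> be a model of \<open>T\<close>. Truth in \<open>M\<close> is defined inside \<open>M\<close> for
  all standard formulas, contradicting Tarski's theorem. Since \<open>T\<close> is axiomatized by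
  \<open>\<Sigma>\<^sub>n\<close>-sentences, a formula false in \<open>M\<close> is refuted by the \<open>\<Sigma>\<^sub>n\<close>-sentences true in \<open>M\<close>, and for
  the latter \<open>M\<close> has a partial truth definition. By compactness the refutation already shows at some
  finite stage \<open>V k\<close> of the cumulative hierarchy, as the absence in \<open>M\<close> of a finite Hintikka set.
  Stages of \<open>M\<close> may be nonstandard, so the refutations of a formula and of its negation are compared
  in the manner of Rosser: the earlier one is standard and hence correct. No induction inside \<open>M\<close> is
  needed, as every recursion is over standard formulas.
\<close>

section \<open>Satisfaction and soundness\<close>

text \<open>The set \<open>A\<close> is arbitrary and need not be definable in \<open>M\<close>.
  What enters the truth definition is therefore the set of all Sigma_n-truths of \<open>M\<close>,
  which covers \<open>A\<close> and is definable through \<open>Ver n\<close>. These truths carry a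
  parameter: the diagonal formula is evaluated at its own code, which takes the place of a
  substitution function on codes. A standard set \<open>a\<close> is defined by a Delta0-formula
  \<delta> (\<open>D0_eq_std\<close>), so a statement \<theta> about \<open>a\<close> amounts to the
  sentence that all x with \<delta> satisfy \<theta>. Completeness of \<open>T\<close> turns its
  truth into provability from \<open>A\<close>; hence the Sigma_n-type of \<open>a\<close> fixes
  every truth about \<open>a\<close>. This is \<open>determined n\<close>, the only form in which
  \<open>T\<close> enters the argument inside a model. The codings are shaped by the fact that
  \<open>M\<close> may be ill-founded and may fail to recognize its standard sets. Predicates such
  as \<open>Ver\<close>, \<open>Stage\<close> and \<open>Mod\<close> speak about all sets of
  \<open>M\<close>, and they are shown to be right at standard arguments only, by induction outside
  \<open>M\<close>.\<close>

primrec sat :: "('a \<Rightarrow> 'a \<Rightarrow> bool) \<Rightarrow> ('a \<Rightarrow> 'a \<Rightarrow> bool) \<Rightarrow> (nat \<Rightarrow> 'a) \<Rightarrow> fm \<Rightarrow> bool" where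
  "sat E Q e Falsum = False"
| "sat E Q e (Equal i j) = Q (e i) (e j)"
| "sat E Q e (Mem i j) = E (e i) (e j)"
| "sat E Q e (Imp \<phi> \<psi>) = (sat E Q e \<phi> \<longrightarrow> sat E Q e \<psi>)"
| "sat E Q e (Forall \<phi>) = (\<forall>x. sat E Q (case_nat x e) \<phi>)"

text \<open>Reflexivity and simultaneous replacement already yield symmetry and transitivity of
  \<open>Q\<close>. Equality is first interpreted by such a \<open>Q\<close>, because a term model
  on the natural numbers may identify distinct variables.\<close>

definition congruence :: "('a \<Rightarrow> 'a \<Rightarrow> bool) \<Rightarrow> ('a \<Rightarrow> 'a \<Rightarrow> bool) \<Rightarrow> bool" where
  "congruence E Q \<longleftrightarrow> (\<forall>x. Q x x) \<and>
    (\<forall>x y u v. Q x u \<longrightarrow> Q y v \<longrightarrow> (Q x y \<longrightarrow> Q u v) \<and> (E x y \<longrightarrow> E u v))"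

lemma congruence_eq: "congruence E (=)"
  by (auto simp: congruence_def)

lemma sat_cong_fv:
  "(\<And>i. i \<in> fv \<phi> \<Longrightarrow> e i = e' i) \<Longrightarrow> sat E Q e \<phi> = sat E Q e' \<phi>"
proof (induction \<phi> arbitrary: e e')
  case (Forall \<phi>)
  have "sat E Q (case_nat x e) \<phi> = sat E Q (case_nat x e') \<phi>" for x
    using Forall.prems by (intro Forall.IH) (auto split: nat.splits)
  then show ?case by simp
next
  case (Imp \<phi> \<psi>)
  have "sat E Q e \<phi> = sat E Q e' \<phi>" "sat E Q e \<psi> = sat E Q e' \<psi>"
    using Imp.prems by (auto intro!: Imp.IH simp del: sat.simps)
  then show ?case by simp
qed auto

lemma sat_rename: "sat E Q e (rename f \<phi>) = sat E Q (\<lambda>i. e (f i)) \<phi>"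
proof (induction \<phi> arbitrary: e f)
  case (Forall \<phi>)
  have "(\<lambda>i. case_nat x e (case_nat 0 (\<lambda>i. Suc (f i)) i)) = case_nat x (\<lambda>i. e (f i))" for x
    by (auto split: nat.splits)
  then show ?case by (simp add: Forall.IH)
qed auto

lemma sat_inst: "sat E Q e (inst x \<phi>) = sat E Q (case_nat (e x) e) \<phi>"
  unfolding inst_def sat_rename by (rule arg_cong[where f = "\<lambda>e. sat E Q e \<phi>"]) (auto split: nat.splits)

lemma sat_fresh0: "sat E Q (case_nat x e) (fresh 0 \<phi>) = sat E Q e \<phi>"
  unfolding fresh_def sat_rename by simp

lemma congruenceD:
  assumes "congruence E Q"
  shows "Q x x" "Q x y \<Longrightarrow> Q y x"
    "Q x u \<Longrightarrow> Q y v \<Longrightarrow> Q x y = Q u v" "Q x u \<Longrightarrow> Q y v \<Longrightarrow> E x y = E u v"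
proof -
  show r: "Q x x" for x using assms unfolding congruence_def by blast
  have c: "Q x u \<Longrightarrow> Q y v \<Longrightarrow> (Q x y \<longrightarrow> Q u v) \<and> (E x y \<longrightarrow> E u v)" for x y u v
    using assms unfolding congruence_def by blast
  show s: "Q x y \<Longrightarrow> Q y x" for x y using c[of x y x x] r[of x] by blast
  show "Q x y = Q u v" if "Q x u" "Q y v"
    using c[OF that] c[OF s[OF that(1)] s[OF that(2)]] by blast
  show "E x y = E u v" if "Q x u" "Q y v"
    using c[OF that] c[OF s[OF that(1)] s[OF that(2)]] by blast
qed

lemma sat_congruence:
  assumes "congruence E Q"
  shows "(\<And>i. Q (e i) (e' i)) \<Longrightarrow> sat E Q e \<phi> = sat E Q e' \<phi>"
proof (induction \<phi> arbitrary: e e')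
  case (Equal i j)
  then show ?case using congruenceD(3)[OF assms] by simp
next
  case (Mem i j)
  then show ?case using congruenceD(4)[OF assms] by simp
next
  case (Imp \<phi> \<psi>)
  have "sat E Q e \<phi> = sat E Q e' \<phi>" "sat E Q e \<psi> = sat E Q e' \<psi>"
    by (rule Imp.IH, rule Imp.prems)+
  then show ?case by simp
next
  case (Forall \<phi>)
  have "sat E Q (case_nat x e) \<phi> = sat E Q (case_nat x e') \<phi>" for x
    using Forall.prems congruenceD(1)[OF assms] by (intro Forall.IH) (auto split: nat.splits)
  then show ?case by simp
qed simp

lemma logical_axioms_sound:
  assumes "congruence E Q" and "\<phi> \<in> logical_axioms"
  shows "sat E Q e \<phi>"
  using assms(2)
proof (induction arbitrary: e)
  case (Equal_Subst x y \<phi>)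
  have "sat E Q (case_nat (e x) e) \<phi> = sat E Q (case_nat (e y) e) \<phi>" if "Q (e x) (e y)"
  proof (rule sat_congruence[OF assms(1)])
    show "Q (case_nat (e x) e i) (case_nat (e y) e i)" for i
      using that congruenceD(1)[OF assms(1)] by (cases i) simp_all
  qed
  then show ?case by (simp add: sat_inst)
next
  case (Equal_Refl x)
  show ?case using congruenceD(1)[OF assms(1)] by simp
next
  case (Forall_Inst \<phi> x)
  show ?case by (simp add: sat_inst)
next
  case (Forall_Vacuous \<phi>)
  show ?case by (simp add: sat_fresh0)
next
  case (Generalization \<phi>)
  show ?case unfolding sat.simps using Generalization.IH by blast
qed simp_all

text \<open>Derivations pass through open formulas, so the members of \<open>T\<close> have to hold
  under every assignment.\<close>

lemma soundness:
  assumes "congruence E Q" and "T \<turnstile> \<phi>" and "\<And>\<psi> e. \<psi> \<in> T \<Longrightarrow> sat E Q e \<psi>"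
  shows "sat E Q e \<phi>"
  using assms(2)
proof (induction arbitrary: e)
  case (Modus_Ponens \<phi> \<psi>)
  then show ?case by simp
qed (simp_all add: assms(3) logical_axioms_sound[OF assms(1)])

lemma sat_sentence:
  "sentence \<phi> \<Longrightarrow> sat E Q e \<phi> = sat E Q e' \<phi>"
  by (rule sat_cong_fv) (simp add: sentence_def)

lemma finite_fv: "finite (fv \<phi>)"
proof (induction \<phi>)
  case (Forall \<phi>)
  then have "finite (Suc -` fv \<phi>)" by (simp add: finite_vimageI)
  then show ?case by (simp add: vimage_def)
qed auto

lemma sat_Forall_pow: 
  assumes "sat E Q e ((Forall ^^ k) \<phi>)" and "\<And>i. e' (i + k) = e i"
  shows "sat E Q e' \<phi>"
  using assms
proof (induction k arbitrary: e)
  case 0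
  then have "e' = e" by auto
  then show ?case using 0 by simp
next
  case (Suc k)
  then have "sat E Q (case_nat (e' k) e) ((Forall ^^ k) \<phi>)" by simp
  moreover have "e' (i + k) = case_nat (e' k) e i" for i
    using Suc.prems(2)[of "i - 1"] by (cases i) auto
  ultimately show ?case by (rule Suc.IH)
qed

lemma sat_universal_closure:
  assumes "sat E Q e (universal_closure \<phi>)"
  shows "sat E Q e' \<phi>"
proof -
  let ?k = "LEAST k. fv \<phi> \<subseteq> {..<k}"
  obtain m where "\<forall>x\<in>fv \<phi>. x < m" using finite_fv[of \<phi>] finite_nat_set_iff_bounded by blast
  then have "fv \<phi> \<subseteq> {..<m}" by auto
  then have k: "fv \<phi> \<subseteq> {..<?k}" by (rule LeastI)
  let ?e = "\<lambda>i. if i < ?k then e' i else e (i - ?k)"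
  have "sat E Q ?e \<phi>"
    by (rule sat_Forall_pow[OF assms[unfolded universal_closure_def]]) auto
  also have "sat E Q ?e \<phi> = sat E Q e' \<phi>" using k by (intro sat_cong_fv) auto
  finally show ?thesis .
qed

section \<open>The Henkin construction\<close>

lemma proves_mono: "T \<turnstile> \<phi> \<Longrightarrow> T \<subseteq> S \<Longrightarrow> S \<turnstile> \<phi>"
  by (induction rule: proves.induct) (auto intro: proves.intros)

lemma proves_finite:
  assumes "T \<turnstile> \<phi>"
  obtains F where "finite F" "F \<subseteq> T" "F \<turnstile> \<phi>"
proof -
  from assms have "\<exists>F. finite F \<and> F \<subseteq> T \<and> F \<turnstile> \<phi>"
  proof induction
    case (Axiom \<phi>)
    then show ?case by (intro exI[of _ "{\<phi>}"]) (auto intro: proves.Axiom)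
  next
    case (Logical \<phi>)
    then show ?case by (auto intro: proves.Logical)
  next
    case (Modus_Ponens \<phi> \<psi>)
    then obtain F G where "finite F" "F \<subseteq> T" "F \<turnstile> Imp \<phi> \<psi>" "finite G" "G \<subseteq> T" "G \<turnstile> \<phi>" by blast
    then show ?case
      by (intro exI[of _ "F \<union> G"]) (auto intro: proves.Modus_Ponens proves_mono)
  qed
  with that show ?thesis by blast
qed

lemma proves_Imp_refl: "T \<turnstile> Imp \<phi> \<phi>"
  by (rule proves.Modus_Ponens[OF proves.Modus_Ponens[OF
          proves.Logical[OF logical_axioms.S] proves.Logical[OF logical_axioms.K]]
        proves.Logical[OF logical_axioms.K[of _ \<phi>]]])

lemma proves_weaken: "T \<turnstile> \<phi> \<Longrightarrow> T \<turnstile> Imp \<psi> \<phi>"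
  by (rule proves.Modus_Ponens[OF proves.Logical[OF logical_axioms.K]])

lemma deduction: "insert \<psi> T \<turnstile> \<phi> \<Longrightarrow> T \<turnstile> Imp \<psi> \<phi>"
proof (induction rule: proves.induct)
  case (Axiom \<phi>)
  then show ?case using proves_Imp_refl proves_weaken proves.Axiom by blast
next
  case (Logical \<phi>)
  then show ?case by (intro proves_weaken proves.Logical)
next
  case (Modus_Ponens \<phi> \<chi>)
  show ?case
    by (rule proves.Modus_Ponens[OF proves.Modus_Ponens[OF proves.Logical[OF logical_axioms.S]
            Modus_Ponens.IH(1)] Modus_Ponens.IH(2)])
qed

section \<open>Renaming of variables and generalization in the calculus\<close>

lemma rename_cong_fv: "(\<And>i. i \<in> fv \<phi> \<Longrightarrow> f i = g i) \<Longrightarrow> rename f \<phi> = rename g \<phi>"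
proof (induction \<phi> arbitrary: f g)
  case (Forall \<phi>)
  have "rename (case_nat 0 (\<lambda>i. Suc (f i))) \<phi> = rename (case_nat 0 (\<lambda>i. Suc (g i))) \<phi>"
    using Forall.prems by (intro Forall.IH) (auto split: nat.splits)
  then show ?case by simp
next
  case (Imp \<phi> \<psi>)
  have "rename f \<phi> = rename g \<phi>" "rename f \<psi> = rename g \<psi>"
    using Imp.prems by (auto intro!: Imp.IH simp del: rename.simps)
  then show ?case by simp
qed auto

lemma rename_rename: "rename f (rename g \<phi>) = rename (\<lambda>i. f (g i)) \<phi>"
proof (induction \<phi> arbitrary: f g)
  case (Forall \<phi>)
  have "(\<lambda>i. case_nat 0 (\<lambda>i. Suc (f i)) (case_nat 0 (\<lambda>i. Suc (g i)) i))
      = case_nat 0 (\<lambda>i. Suc (f (g i)))"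
    by (auto split: nat.splits)
  then show ?case by (simp add: Forall.IH)
qed auto

lemma rename_id: "rename (\<lambda>i. i) \<phi> = \<phi>"
proof (induction \<phi>)
  case (Forall \<phi>)
  have "case_nat 0 (\<lambda>i. Suc i) = (\<lambda>i. i)" by (auto split: nat.splits)
  then show ?case using Forall by simp
qed auto

lemma fv_rename: "fv (rename f \<phi>) = f ` fv \<phi>"
proof (induction \<phi> arbitrary: f)
  case (Forall \<phi>)
  have "fv (rename f (Forall \<phi>)) = {i. Suc i \<in> case_nat 0 (\<lambda>i. Suc (f i)) ` fv \<phi>}"
    by (simp add: Forall.IH)
  also have "\<dots> = f ` {i. Suc i \<in> fv \<phi>}"
  proof (intro set_eqI iffI)
    fix k assume "k \<in> {i. Suc i \<in> case_nat 0 (\<lambda>i. Suc (f i)) ` fv \<phi>}"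
    then obtain j where "j \<in> fv \<phi>" "Suc k = case_nat 0 (\<lambda>i. Suc (f i)) j" by auto
    then show "k \<in> f ` {i. Suc i \<in> fv \<phi>}" by (cases j) auto
  qed force
  finally show ?case by simp
qed auto

lemma rename_inst:
  "rename f (inst x \<phi>) = inst (f x) (rename (case_nat 0 (\<lambda>i. Suc (f i))) \<phi>)"
  unfolding inst_def rename_rename
  by (rule arg_cong[where f = "\<lambda>g. rename g \<phi>"]) (auto split: nat.splits)

lemma rename_fresh0: "rename (case_nat 0 (\<lambda>i. Suc (f i))) (fresh 0 \<phi>) = fresh 0 (rename f \<phi>)"
  unfolding fresh_def rename_rename by simp

lemma logical_axioms_rename: "\<phi> \<in> logical_axioms \<Longrightarrow> rename f \<phi> \<in> logical_axioms"
proof (induction arbitrary: f rule: logical_axioms.induct)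
qed (auto intro: logical_axioms.intros simp: rename_inst rename_fresh0)

lemma proves_rename: "T \<turnstile> \<phi> \<Longrightarrow> rename f ` T \<turnstile> rename f \<phi>"
proof (induction rule: proves.induct)
  case (Modus_Ponens \<phi> \<psi>)
  then show ?case using proves.Modus_Ponens by simp
qed (auto intro: proves.Axiom proves.Logical logical_axioms_rename)

text \<open>Generalization is not a rule of the calculus. It is pushed to the leaves of the
  derivation: logical axioms are closed under it, and a hypothesis enters shifted, so that
  \<open>Forall_Vacuous\<close> applies.\<close>

lemma generalization: "fresh 0 ` T \<turnstile> \<phi> \<Longrightarrow> T \<turnstile> Forall \<phi>"
proof (induction rule: proves.induct)
  case (Axiom \<phi>)
  then show ?case
    by (auto intro: proves.Modus_Ponens[OF proves.Logical[OF logical_axioms.Forall_Vacuous]]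
        proves.Axiom)
next
  case (Logical \<phi>)
  then show ?case by (intro proves.Logical logical_axioms.Generalization)
next
  case (Modus_Ponens \<phi> \<psi>)
  show ?case
    by (rule proves.Modus_Ponens[OF proves.Modus_Ponens[OF proves.Logical[OF
              logical_axioms.Forall_Imp] Modus_Ponens.IH(1)] Modus_Ponens.IH(2)])
qed

lemma generalization_variable:
  assumes "T \<turnstile> inst x \<phi>" and "\<And>\<psi>. \<psi> \<in> T \<Longrightarrow> x \<notin> fv \<psi>" and "x \<notin> fv (Forall \<phi>)"
  shows "T \<turnstile> Forall \<phi>"
proof (rule generalization)
  \<comment> \<open>This map moves \<open>x\<close> to the position of the quantified variable and
    shifts the rest up. It undoes \<open>inst x\<close>, and on formulas without \<open>x\<close> it
    agrees with \<open>fresh 0\<close>.\<close>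
  let ?f = "\<lambda>i. if i = x then 0 else Suc i"
  have "rename ?f (inst x \<phi>) = rename (\<lambda>i. i) \<phi>"
    unfolding inst_def rename_rename
    using assms(3) by (intro rename_cong_fv) (auto split: nat.splits)
  moreover have "rename ?f ` T = fresh 0 ` T"
    unfolding fresh_def using assms(2) by (intro image_cong) (auto intro!: rename_cong_fv)
  ultimately show "fresh 0 ` T \<turnstile> \<phi>"
    using proves_rename[OF assms(1), of ?f] by (simp add: rename_id)
qed

lemma inconsistent_insert: "\<not> consistent (insert \<phi> T) \<Longrightarrow> T \<turnstile> Neg \<phi>"
  unfolding consistent_def by (rule deduction) simp

lemma inconsistent_insert_Neg: "\<not> consistent (insert (Neg \<phi>) T) \<Longrightarrow> T \<turnstile> \<phi>"
  by (rule proves.Modus_Ponens[OF proves.Logical[OF logical_axioms.Double_Neg]])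
    (rule inconsistent_insert)

instance fm :: countable
  by countable_datatype

definition henkin_step :: "fm set \<Rightarrow> fm \<Rightarrow> fm set" where
  "henkin_step H \<phi> =
    (if consistent (insert \<phi> H)
     then insert \<phi> H \<union>
       {Neg (inst x \<psi>) | x \<psi>. \<phi> = Neg (Forall \<psi>) \<and> x = (SOME x. \<forall>\<chi>\<in>insert \<phi> H. x \<notin> fv \<chi>)}
     else H)"

primrec henkin :: "fm set \<Rightarrow> nat \<Rightarrow> fm set" where
  "henkin T 0 = T"
| "henkin T (Suc n) = henkin_step (henkin T n) (from_nat n)"

lemma henkin_mono: "m \<le> n \<Longrightarrow> henkin T m \<subseteq> henkin T n"
  by (rule lift_Suc_mono_le) (auto simp: henkin_step_def)

lemma henkin_step_finite:
  assumes "finite F" "H = T \<union> F"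
  shows "\<exists>F'. finite F' \<and> henkin_step H \<phi> = T \<union> F'"
proof -
  define x where "x = (SOME x. \<forall>\<chi>\<in>insert \<phi> H. x \<notin> fv \<chi>)"
  define W where "W = {Neg (inst y \<psi>) | y \<psi>. \<phi> = Neg (Forall \<psi>) \<and> y = x}"
  have "finite W"
  proof (cases "\<exists>\<psi>. \<phi> = Neg (Forall \<psi>)")
    case True
    then show ?thesis by (auto simp: W_def)
  next
    case False
    then have "W = {}" by (auto simp: W_def)
    then show ?thesis by simp
  qed
  show ?thesis
  proof (cases "consistent (insert \<phi> H)")
    case True
    then have "henkin_step H \<phi> = T \<union> (insert \<phi> F \<union> W)"
      unfolding henkin_step_def W_def x_def using assms(2) by auto
    then show ?thesis using assms(1) \<open>finite W\<close> by (intro exI[of _ "insert \<phi> F \<union> W"]) simp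
  next
    case False
    then show ?thesis using assms by (intro exI[of _ F]) (simp add: henkin_step_def)
  qed
qed

lemma henkin_finite: "\<exists>F. finite F \<and> henkin T n = T \<union> F"
proof (induction n)
  case (Suc n)
  then show ?case using henkin_step_finite by auto
qed (auto intro: exI[of _ "{}"])

lemma fresh_variable:
  assumes "\<forall>\<phi>\<in>T. sentence \<phi>" "finite F"
  shows "\<exists>x. \<forall>\<chi>\<in>T \<union> F. x \<notin> fv \<chi>"
proof -
  have "finite (\<Union> (fv ` F))" using assms(2) finite_fv by auto
  then obtain x where "x \<notin> \<Union> (fv ` F)" using ex_new_if_finite infinite_UNIV_nat by blast
  then show ?thesis using assms(1) by (auto simp: sentence_def)
qed

lemma henkin_consistent:
  assumes "\<forall>\<phi>\<in>T. sentence \<phi>" "consistent T"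
  shows "consistent (henkin T n)"
proof (induction n)
  case (Suc n)
  let ?H = "henkin T n" and ?\<phi> = "from_nat n :: fm"
  show ?case
  proof (cases "consistent (insert ?\<phi> ?H)")
    case True
    obtain F where F: "finite F" "?H = T \<union> F" using henkin_finite by blast
    define x where "x = (SOME x. \<forall>\<chi>\<in>insert ?\<phi> ?H. x \<notin> fv \<chi>)"
    have "\<exists>x. \<forall>\<chi>\<in>insert ?\<phi> ?H. x \<notin> fv \<chi>"
      using fresh_variable[OF assms(1), of "insert ?\<phi> F"] F by auto
    then have x: "\<forall>\<chi>\<in>insert ?\<phi> ?H. x \<notin> fv \<chi>" unfolding x_def by (rule someI_ex)
    show ?thesis
    proof (cases "\<exists>\<psi>. ?\<phi> = Neg (Forall \<psi>)")
      case False
      then have "henkin T (Suc n) = insert ?\<phi> ?H" using True by (auto simp: henkin_step_def)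
      then show ?thesis using True by simp
    next
      case w: True
      then obtain \<psi> where \<psi>: "?\<phi> = Neg (Forall \<psi>)" by blast
      have eq: "henkin T (Suc n) = insert (Neg (inst x \<psi>)) (insert ?\<phi> ?H)"
        using True \<psi> by (auto simp: henkin_step_def x_def)
      have "consistent (insert (Neg (inst x \<psi>)) (insert ?\<phi> ?H))"
      proof (rule ccontr)
        assume "\<not> ?thesis"
        then have "insert ?\<phi> ?H \<turnstile> inst x \<psi>" by (rule inconsistent_insert_Neg)
        then have "insert ?\<phi> ?H \<turnstile> Forall \<psi>"
          using x \<psi> by (intro generalization_variable) auto
        moreover have "insert ?\<phi> ?H \<turnstile> Neg (Forall \<psi>)" using \<psi> by (auto intro: proves.Axiom)
        ultimately show False using True proves.Modus_Ponens consistent_def by blast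
      qed
      then show ?thesis using eq by simp
    qed
  next
    case False
    then show ?thesis using Suc by (simp add: henkin_step_def)
  qed
qed (simp add: assms)

theorem model_existence:
  assumes "\<forall>\<phi>\<in>T. sentence \<phi>" "consistent T"
  obtains E Q :: "nat \<Rightarrow> nat \<Rightarrow> bool"
  where "congruence E Q" "\<And>\<phi> e. \<phi> \<in> T \<Longrightarrow> sat E Q e \<phi>"
proof -
  define H where "H = (\<Union>n. henkin T n)"
  have sub: "henkin T n \<subseteq> H" for n by (auto simp: H_def)
  have fin: "\<exists>n. F \<subseteq> henkin T n" if "finite F" "F \<subseteq> H" for F
    using that
  proof (induction F)
    case (insert \<phi> F)
    then obtain m n where "F \<subseteq> henkin T n" "\<phi> \<in> henkin T m" by (auto simp: H_def)
    then show ?case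
      using henkin_mono[of n "max m n" T] henkin_mono[of m "max m n" T]
      by (intro exI[of _ "max m n"]) auto
  qed auto
  have con: "\<not> H \<turnstile> Falsum"
  proof
    assume "H \<turnstile> Falsum"
    then obtain F where "finite F" "F \<subseteq> H" "F \<turnstile> Falsum" by (rule proves_finite)
    moreover obtain n where "F \<subseteq> henkin T n" using fin \<open>finite F\<close> \<open>F \<subseteq> H\<close> by blast
    ultimately have "henkin T n \<turnstile> Falsum" using proves_mono[of F Falsum] by blast
    then show False using henkin_consistent[OF assms, of n] by (simp add: consistent_def)
  qed
  have max: "\<phi> \<in> H \<or> H \<turnstile> Neg \<phi>" for \<phi>
  proof -
    obtain n where n: "from_nat n = \<phi>" by (rule that[OF from_nat_to_nat])
    show ?thesis
    proof (cases "consistent (insert \<phi> (henkin T n))")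
      case True
      then have "\<phi> \<in> henkin T (Suc n)" by (simp add: henkin_step_def n)
      then show ?thesis using sub[of "Suc n"] by blast
    next
      case False
      then have "henkin T n \<turnstile> Neg \<phi>" by (rule inconsistent_insert)
      then show ?thesis using proves_mono[OF _ sub] by blast
    qed
  qed
  have closed: "\<phi> \<in> H" if "H \<turnstile> \<phi>" for \<phi>
    using max[of \<phi>] proves.Modus_Ponens[OF _ that] con by blast
  have Neg_iff: "Neg \<phi> \<in> H \<longleftrightarrow> \<phi> \<notin> H" for \<phi>
    using max[of \<phi>] closed[of "Neg \<phi>"] con
      proves.Modus_Ponens[OF proves.Axiom[of "Neg \<phi>" H] proves.Axiom[of \<phi> H]] by blast
  have Imp_iff: "Imp \<phi> \<psi> \<in> H \<longleftrightarrow> (\<phi> \<in> H \<longrightarrow> \<psi> \<in> H)" for \<phi> \<psi>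
  proof
    show "Imp \<phi> \<psi> \<in> H \<Longrightarrow> \<phi> \<in> H \<longrightarrow> \<psi> \<in> H"
      using closed[OF proves.Modus_Ponens[OF proves.Axiom[of "Imp \<phi> \<psi>" H] proves.Axiom[of \<phi> H]]]
      by blast
    assume a: "\<phi> \<in> H \<longrightarrow> \<psi> \<in> H"
    show "Imp \<phi> \<psi> \<in> H"
    proof (cases "\<psi> \<in> H")
      case True
      then show ?thesis by (rule closed[OF proves_weaken[OF proves.Axiom]])
    next
      case False
      with a have "Neg \<phi> \<in> H" using Neg_iff by blast
      then have "insert \<phi> H \<turnstile> Falsum"
        by (intro proves.Modus_Ponens[OF proves.Axiom[of "Neg \<phi>"] proves.Axiom]) auto
      then have "insert (Neg \<psi>) (insert \<phi> H) \<turnstile> Falsum" by (rule proves_mono) auto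
      then have "insert \<phi> H \<turnstile> \<psi>" by (intro inconsistent_insert_Neg) (simp add: consistent_def)
      then show ?thesis by (rule closed[OF deduction])
    qed
  qed
  have witness: "\<exists>x. inst x \<psi> \<notin> H" if "Forall \<psi> \<notin> H" for \<psi>
  proof -
    obtain n where n: "from_nat n = Neg (Forall \<psi>)" by (rule that[OF from_nat_to_nat])
    have "Neg (Forall \<psi>) \<in> H" using that Neg_iff by blast
    then have "insert (Neg (Forall \<psi>)) (henkin T n) \<subseteq> H" using sub[of n] by blast
    then have "consistent (insert (Neg (Forall \<psi>)) (henkin T n))"
      using con proves_mono[of _ Falsum H] unfolding consistent_def by blast
    then have "\<exists>x. Neg (inst x \<psi>) \<in> henkin T (Suc n)" by (auto simp: henkin_step_def n)
    then have "\<exists>x. Neg (inst x \<psi>) \<in> H" using sub[of "Suc n"] by blast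
    then show ?thesis using Neg_iff by blast
  qed
  define E where "E i j = (Mem i j \<in> H)" for i j
  define Q where "Q i j = (Equal i j \<in> H)" for i j
  \<comment> \<open>The elements of the model are the variables themselves, so an assignment is
    literally a renaming.\<close>
  have truth: "sat E Q f \<phi> = (rename f \<phi> \<in> H)" for f \<phi>
  proof (induction \<phi> arbitrary: f)
    case Falsum
    then show ?case using con proves.Axiom[of Falsum H] by auto
  next
    case (Forall \<phi>)
    have r: "rename (case_nat x f) \<phi> = inst x (rename (case_nat 0 (\<lambda>i. Suc (f i))) \<phi>)" for x
      unfolding inst_def rename_rename
      by (rule arg_cong[where f = "\<lambda>g. rename g \<phi>"]) (auto split: nat.splits)
    show ?case
    proof
      assume "sat E Q f (Forall \<phi>)"
      then have "inst x (rename (case_nat 0 (\<lambda>i. Suc (f i))) \<phi>) \<in> H" for x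
        by (simp add: Forall.IH[symmetric] r[symmetric])
      then show "rename f (Forall \<phi>) \<in> H" using witness by auto
    next
      assume "rename f (Forall \<phi>) \<in> H"
      then have "inst x (rename (case_nat 0 (\<lambda>i. Suc (f i))) \<phi>) \<in> H" for x
        using closed[OF proves.Modus_Ponens[OF proves.Logical[OF logical_axioms.Forall_Inst]
              proves.Axiom]] by simp
      then show "sat E Q f (Forall \<phi>)" by (simp add: Forall.IH r)
    qed
  qed (auto simp: E_def Q_def Imp_iff)
  have subst: "inst y \<phi> \<in> H" if "Equal x y \<in> H" "inst x \<phi> \<in> H" for x y \<phi>
    by (rule closed, rule proves.Modus_Ponens[OF proves.Modus_Ponens[OF proves.Logical[OF
              logical_axioms.Equal_Subst] proves.Axiom[OF that(1)]] proves.Axiom[OF that(2)]])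
  have Q1: "Q x x" for x
    unfolding Q_def by (rule closed[OF proves.Logical[OF logical_axioms.Equal_Refl]])
  have l: "Q x u \<Longrightarrow> Q x y \<Longrightarrow> Q u y" "Q x u \<Longrightarrow> E x y \<Longrightarrow> E u y" for x u y
    using subst[of x u "Equal 0 (Suc y)"] subst[of x u "Mem 0 (Suc y)"]
    by (auto simp: inst_def Q_def E_def)
  have r: "Q y v \<Longrightarrow> Q x y \<Longrightarrow> Q x v" "Q y v \<Longrightarrow> E x y \<Longrightarrow> E x v" for x v y
    using subst[of y v "Equal (Suc x) 0"] subst[of y v "Mem (Suc x) 0"]
    by (auto simp: inst_def Q_def E_def)
  have "congruence E Q" unfolding congruence_def using Q1 l r by blast
  moreover have "sat E Q e \<phi>" if "\<phi> \<in> T" for \<phi> e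
  proof -
    have "sat E Q e \<phi> = sat E Q (\<lambda>i. i) \<phi>" using assms(1) that by (intro sat_sentence) auto
    also have "\<dots> = (\<phi> \<in> H)" unfolding truth rename_id ..
    also have "\<phi> \<in> H" using that sub[of 0] by auto
    finally show ?thesis by simp
  qed
  ultimately show ?thesis by (rule that)
qed

section \<open>Models of Kripke--Platek set theory\<close>

lemma sat_fresh: "sat E Q e (fresh k \<phi>) = sat E Q (\<lambda>i. e (if i < k then i else Suc i)) \<phi>"
  by (simp add: fresh_def sat_rename)

lemma sat_separation:
  assumes "sat E Q e' (separation \<phi>)"
  shows "\<exists>b. \<forall>x. E x b \<longleftrightarrow> E x a \<and> sat E Q (case_nat x (case_nat a e)) \<phi>"
proof -
  have *: "(\<lambda>i. case_nat x (case_nat b (case_nat a e)) (if i < 1 then i else Suc i))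
      = case_nat x (case_nat a e)" for x b
    by (auto split: nat.splits)
  have "sat E Q (case_nat a e) (Exists (Forall (Iff (Mem 0 1) (And (Mem 0 2) (fresh 1 \<phi>)))))"
    using assms unfolding separation_def by (rule sat_universal_closure)
  then show ?thesis
    by (simp only: sat.simps sat_fresh *) (simp add: numeral_2_eq_2, blast?)
qed

lemma sat_collection:
  assumes "sat E Q e' (collection \<phi>)"
    and "\<And>x. E x a \<Longrightarrow> \<exists>y. sat E Q (case_nat y (case_nat x (case_nat a e))) \<phi>"
  shows "\<exists>b. \<forall>x. E x a \<longrightarrow> (\<exists>y. E y b \<and> sat E Q (case_nat y (case_nat x (case_nat a e))) \<phi>)"
proof -
  have *: "(\<lambda>i. case_nat y (case_nat x (case_nat b (case_nat a e))) (if i < 2 then i else Suc i))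
      = case_nat y (case_nat x (case_nat a e))" for x y b
    by (auto simp: numeral_2_eq_2 less_Suc_eq split: nat.splits)
  have "sat E Q (case_nat a e) (Imp (BForall 0 (Exists \<phi>))
      (Exists (BForall 1 (BExists 1 (fresh 2 \<phi>)))))"
    using assms(1) unfolding collection_def by (rule sat_universal_closure)
  then show ?thesis
    using assms(2) by (simp only: sat.simps sat_fresh *) (simp add: numeral_2_eq_2, blast?)
qed

text \<open>With true equality, extensionality allows sets of the model to be named by
  \<open>THE\<close>. The schemes are stated semantically, with \<open>e\<close> supplying the
  parameters.\<close>

locale kp =
  fixes E :: "'m \<Rightarrow> 'm \<Rightarrow> bool"
  assumes ext: "(\<And>z. E z x \<longleftrightarrow> E z y) \<Longrightarrow> x = y"
    and pair: "\<exists>c. \<forall>z. E z c \<longleftrightarrow> z = a \<or> z = b"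
    and union: "\<exists>b. \<forall>z. E z b \<longleftrightarrow> (\<exists>y. E y a \<and> E z y)"
    and sep: "\<phi> \<in> Delta0 \<Longrightarrow>
      \<exists>b. \<forall>x. E x b \<longleftrightarrow> E x a \<and> sat E (=) (case_nat x (case_nat a e)) \<phi>"
    and coll: "\<phi> \<in> Delta0 \<Longrightarrow>
      (\<And>x. E x a \<Longrightarrow> \<exists>y. sat E (=) (case_nat y (case_nat x (case_nat a e))) \<phi>) \<Longrightarrow>
      \<exists>b. \<forall>x. E x a \<longrightarrow> (\<exists>y. E y b \<and> sat E (=) (case_nat y (case_nat x (case_nat a e))) \<phi>)"

lemma kp_if_sat_KP:
  assumes "\<And>\<phi> e. \<phi> \<in> KP \<Longrightarrow> sat E (=) e \<phi>"
  shows "kp E"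
proof
  fix x y assume "\<And>z. E z x \<longleftrightarrow> E z y"
  moreover have "sat E (=) (\<lambda>_. x) extensionality_ax" using assms by (simp add: KP_def)
  ultimately show "x = y" by (simp add: extensionality_ax_def numeral_2_eq_2, blast?)
next
  fix a b
  have "sat E (=) (\<lambda>_. a) pairing_ax" using assms by (simp add: KP_def)
  then have "\<forall>x y. \<exists>c. \<forall>z. E z c \<longleftrightarrow> (z = x \<or> z = y)"
    by (simp add: pairing_ax_def numeral_2_eq_2 numeral_3_eq_3, blast?)
  then show "\<exists>c. \<forall>z. E z c \<longleftrightarrow> z = a \<or> z = b" by blast
next
  fix a
  have "sat E (=) (\<lambda>_. a) union_ax" using assms by (simp add: KP_def)
  then have "\<forall>x. \<exists>b. \<forall>z. E z b \<longleftrightarrow> (\<exists>y. E y x \<and> E z y)"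
    by (simp add: union_ax_def numeral_2_eq_2 numeral_3_eq_3, blast?)
  then show "\<exists>b. \<forall>z. E z b \<longleftrightarrow> (\<exists>y. E y a \<and> E z y)" by blast
next
  fix \<phi> a e assume "\<phi> \<in> Delta0"
  then have "sat E (=) e (separation \<phi>)" using assms by (simp add: KP_def)
  then show "\<exists>b. \<forall>x. E x b \<longleftrightarrow> E x a \<and> sat E (=) (case_nat x (case_nat a e)) \<phi>"
    by (rule sat_separation)
next
  fix \<phi> a e assume "\<phi> \<in> Delta0"
  then have c: "sat E (=) e (collection \<phi>)" using assms by (simp add: KP_def)
  assume "\<And>x. E x a \<Longrightarrow> \<exists>y. sat E (=) (case_nat y (case_nat x (case_nat a e))) \<phi>"
  with c show "\<exists>b. \<forall>x. E x a \<longrightarrow>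
      (\<exists>y. E y b \<and> sat E (=) (case_nat y (case_nat x (case_nat a e))) \<phi>)"
    by (rule sat_collection)
qed

text \<open>Adjunction collects \<open>F\<close> inside one set \<open>w\<close>. Its Russell set,
  the members of \<open>w\<close> that are not members of themselves, lies outside \<open>w\<close>
  and hence in none of the classes of \<open>F\<close>.\<close>

lemma infinitely_many_classes:
  assumes "congruence E Q" and KP: "\<And>\<phi> e. \<phi> \<in> KP \<Longrightarrow> sat E Q e \<phi>" and "finite F"
  shows "\<exists>y. \<forall>x\<in>F. \<not> Q x y"
proof -
  note Q = congruenceD[OF assms(1)]
  have adj: "\<exists>w. (\<forall>y. E y u \<longrightarrow> E y w) \<and> E x w" for u x
  proof -
    have "sat E Q (\<lambda>_. x) pairing_ax" using KP by (simp add: KP_def)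
    then have "\<forall>x y. \<exists>c. \<forall>z. E z c \<longleftrightarrow> (Q z x \<or> Q z y)"
      by (simp add: pairing_ax_def numeral_2_eq_2 numeral_3_eq_3, blast?)
    note prs = this
    obtain p where p: "\<forall>z. E z p \<longleftrightarrow> (Q z x \<or> Q z x)" using prs[rule_format, of x x] by blast
    obtain q where q: "\<forall>z. E z q \<longleftrightarrow> (Q z u \<or> Q z p)" using prs[rule_format, of u p] by blast
    have "sat E Q (\<lambda>_. x) union_ax" using KP by (simp add: KP_def)
    then have "\<forall>x. \<exists>b. \<forall>z. E z b \<longleftrightarrow> (\<exists>y. E y x \<and> E z y)"
      by (simp add: union_ax_def numeral_2_eq_2 numeral_3_eq_3, blast?)
    then obtain w where w: "\<forall>z. E z w \<longleftrightarrow> (\<exists>y. E y q \<and> E z y)"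
      by (blast dest: spec[of _ q])
    have "E u q" "E p q" "E x p" using p q Q(1)[of u] Q(1)[of p] Q(1)[of x] by blast+
    then show ?thesis using w by blast
  qed
  have "\<exists>w. \<forall>x\<in>F. E x w" using assms(3)
  proof (induction F)
    case (insert x F)
    then obtain u where "\<forall>y\<in>F. E y u" by blast
    then show ?case using adj[of u x] by blast
  qed auto
  then obtain w where w: "\<forall>x\<in>F. E x w" by blast
  have "Imp (Mem 0 0) Falsum \<in> Delta0" by (intro Delta0.intros)
  then have "sat E Q (\<lambda>_. w) (separation (Neg (Mem 0 0)))" using KP by (simp add: KP_def)
  from sat_separation[OF this, of w "\<lambda>_. w"]
  obtain b where b: "\<forall>x. E x b \<longleftrightarrow> E x w \<and> \<not> E x x" by auto
  then have "\<not> E b w" by blast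
  then have "\<not> Q x b" if "x \<in> F" for x
    using w that Q(4)[of x b w w] Q(1)[of w] by blast
  then show ?thesis by blast
qed

text \<open>
  A quotient cannot be formed inside a proof, but the infinitely many classes can be enumerated
  by natural numbers.
\<close>

lemma true_equality_model:
  fixes E Q :: "nat \<Rightarrow> nat \<Rightarrow> bool"
  assumes "congruence E Q" and inf: "\<And>F. finite F \<Longrightarrow> \<exists>y. \<forall>x\<in>F. \<not> Q x y"
  obtains E' :: "nat \<Rightarrow> nat \<Rightarrow> bool" where "\<And>\<phi> e. (\<And>e. sat E Q e \<phi>) \<Longrightarrow> sat E' (=) e \<phi>"
proof -
  note Q = congruenceD[OF assms(1)]
  define rep where "rep i = (LEAST j. Q i j)" for i
  have rep: "Q i (rep i)" for i unfolding rep_def by (rule LeastI[of _ i]) (rule Q(1))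
  have rep_eq: "rep i = rep j" if "Q i j" for i j
  proof -
    have "Q i k = Q j k" for k by (rule Q(3)[OF that Q(1)])
    then show ?thesis by (simp add: rep_def)
  qed
  have infR: "infinite (range rep)"
  proof
    assume "finite (range rep)"
    from inf[OF this] obtain y where "\<not> Q (rep y) y" by blast
    then show False using rep[of y] Q(2) by blast
  qed
  define h where "h = enumerate (range rep)"
  have bij: "bij_betw h UNIV (range rep)" unfolding h_def by (rule bij_enumerate[OF infR])
  have inj: "h i = h j \<longleftrightarrow> i = j" for i j using bij by (auto simp: bij_betw_def inj_def)
  have hrep: "\<exists>i. h i = rep y" for y using bij by (metis bij_betw_imp_surj_on rangeE rangeI)
  have hQ: "Q (h i) (h j) \<longleftrightarrow> i = j" for i j
  proof
    assume q: "Q (h i) (h j)"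
    obtain a b where ab: "h i = rep a" "h j = rep b" using bij by (metis bij_betwE rangeE UNIV_I)
    have "rep a = rep (rep a)" "rep b = rep (rep b)" using rep rep_eq by blast+
    then have "h i = h j" using rep_eq[OF q] ab by simp
    then show "i = j" using inj by simp
  qed (simp add: Q(1))
  define E' where "E' i j = E (h i) (h j)" for i j
  have sat: "sat E' (=) e \<phi> = sat E Q (\<lambda>i. h (e i)) \<phi>" for e \<phi>
  proof (induction \<phi> arbitrary: e)
    case (Forall \<phi>)
    have c: "(\<lambda>i. h (case_nat x e i)) = case_nat (h x) (\<lambda>i. h (e i))" for x
      by (auto split: nat.splits)
    have "sat E Q (case_nat y (\<lambda>i. h (e i))) \<phi>" 
      if a: "\<forall>x. sat E Q (case_nat (h x) (\<lambda>i. h (e i))) \<phi>" for y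
    proof -
      obtain x where "h x = rep y" using hrep by blast
      then have "sat E Q (case_nat (rep y) (\<lambda>i. h (e i))) \<phi>" using a by metis
      moreover have "Q (case_nat y (\<lambda>i. h (e i)) i) (case_nat (rep y) (\<lambda>i. h (e i)) i)" for i
        using rep Q(1) by (cases i) auto
      ultimately show ?thesis using sat_congruence[OF assms(1)] by blast
    qed
    then show ?case by (simp add: Forall.IH c) blast
  qed (auto simp: E'_def hQ)
  then show ?thesis by (intro that[of E']) (simp add: sat)
qed

section \<open>Finite sets and definability\<close>

context kp
begin

definition elems :: "'m \<Rightarrow> 'm set" where
  "elems x = {z. E z x}"

lemma in_elems [simp]: "z \<in> elems x \<longleftrightarrow> E z x"
  by (simp add: elems_def)

lemma ext_iff: "x = y \<longleftrightarrow> (\<forall>z. E z x \<longleftrightarrow> E z y)"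
  using ext[of x y] by blast

lemma elems_inj: "elems x = elems y \<longleftrightarrow> x = y"
  unfolding ext_iff[of x y] by (auto simp: elems_def)

definition emp :: 'm where
  "emp = (THE b. \<forall>x. \<not> E x b)"

lemma not_E_emp [simp]: "\<not> E x emp"
proof -
  obtain b where b: "\<forall>x. \<not> E x b"
    using sep[of Falsum undefined undefined] Delta0.intros(1) by auto
  then have "emp = b" unfolding emp_def by (intro the_equality) (simp_all add: ext_iff)
  with b show ?thesis by simp
qed

lemma elems_emp [simp]: "elems emp = {}"
  by auto

definition adj :: "'m \<Rightarrow> 'm \<Rightarrow> 'm" where
  "adj x y = (THE w. \<forall>z. E z w \<longleftrightarrow> E z x \<or> z = y)"

lemma E_adj [simp]: "E z (adj x y) \<longleftrightarrow> E z x \<or> z = y"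
proof -
  obtain p where p: "\<forall>z. E z p \<longleftrightarrow> z = y" using pair[of y y] by blast
  obtain q where q: "\<forall>z. E z q \<longleftrightarrow> z = x \<or> z = p" using pair[of x p] by blast
  obtain w where w: "\<forall>z. E z w \<longleftrightarrow> (\<exists>v. E v q \<and> E z v)" using union[of q] by blast
  have w': "\<forall>z. E z w \<longleftrightarrow> E z x \<or> z = y"
    by (auto simp: w[rule_format] q[rule_format] p[rule_format])
  then have "adj x y = w" unfolding adj_def by (intro the_equality) (simp_all add: ext_iff)
  with w' show ?thesis by simp
qed

lemma elems_adj [simp]: "elems (adj x y) = insert y (elems x)"
  by auto

definition dbl :: "'m \<Rightarrow> 'm \<Rightarrow> 'm" where
  "dbl a b = adj (adj emp a) b"

lemma E_dbl [simp]: "E z (dbl a b) \<longleftrightarrow> z = a \<or> z = b"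
  by (simp add: dbl_def)

lemma dbl_eq: "dbl a b = dbl c d \<longleftrightarrow> {a, b} = {c, d}"
proof -
  have "elems (dbl a b) = {a, b}" for a b by auto
  then show ?thesis using elems_inj[of "dbl a b" "dbl c d"] by simp
qed

definition pr :: "'m \<Rightarrow> 'm \<Rightarrow> 'm" where
  "pr a b = dbl (dbl a a) (dbl a b)"

lemma pr_inject [simp]: "pr a b = pr c d \<longleftrightarrow> a = c \<and> b = d"
  unfolding pr_def dbl_eq by (auto simp: dbl_eq doubleton_eq_iff)

lemma E_pr: "E z (pr a b) \<longleftrightarrow> z = dbl a a \<or> z = dbl a b"
  by (simp add: pr_def)

lemma pr_neq_emp [simp]: "pr a b \<noteq> emp" "emp \<noteq> pr a b"
proof -
  have "E (dbl a a) (pr a b)" by (simp add: E_pr)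
  then show "pr a b \<noteq> emp" by force
  then show "emp \<noteq> pr a b" by simp
qed

lemma finite_set_exists: "finite S \<Longrightarrow> \<exists>b. elems b = S"
proof (induction S rule: finite_induct)
  case empty
  then show ?case by (intro exI[of _ emp]) simp
next
  case (insert x S)
  then obtain b where "elems b = S" by blast
  then show ?case by (intro exI[of _ "adj b x"]) simp
qed

text \<open>Since only finite sets are needed, the power set axiom can be dispensed with.\<close>

lemma finite_powerset_exists:
  assumes "finite (elems x)"
  shows "\<exists>p. finite (elems p) \<and> (\<forall>z. E z p \<longleftrightarrow> elems z \<subseteq> elems x)"
proof -
  let ?P = "{z. elems z \<subseteq> elems x}"
  have "inj_on elems ?P" by (simp add: inj_on_def elems_inj)
  moreover have "finite (elems ` ?P)"
    by (rule finite_subset[of _ "Pow (elems x)"]) (use assms in auto)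
  ultimately have "finite ?P" by (rule finite_imageD[rotated])
  moreover from this obtain p where p: "elems p = ?P" using finite_set_exists by blast
  moreover have "E z p \<longleftrightarrow> elems z \<subseteq> elems x" for z
    unfolding in_elems[symmetric, of z p] p by simp
  ultimately show ?thesis by (intro exI[of _ p]) simp
qed

section \<open>Finite levels of the cumulative hierarchy and standard sets\<close>

primrec V :: "nat \<Rightarrow> 'm" where
  "V 0 = emp"
| "V (Suc k) = (THE p. \<forall>z. E z p \<longleftrightarrow> elems z \<subseteq> elems (V k))"

declare V.simps(2) [simp del]

lemma V_props: "finite (elems (V k)) \<and> (\<forall>z. E z (V (Suc k)) \<longleftrightarrow> elems z \<subseteq> elems (V k))"
proof -
  have step: "\<forall>z. E z (V (Suc k)) \<longleftrightarrow> elems z \<subseteq> elems (V k)" "finite (elems (V (Suc k)))"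
    if fin: "finite (elems (V k))" for k
  proof -
    obtain p where p: "finite (elems p)" "\<forall>z. E z p \<longleftrightarrow> elems z \<subseteq> elems (V k)"
      using finite_powerset_exists[OF fin] by blast
    then have "V (Suc k) = p" unfolding V.simps(2)
      by (intro the_equality) (simp_all add: ext_iff[of _ p])
    with p show "\<forall>z. E z (V (Suc k)) \<longleftrightarrow> elems z \<subseteq> elems (V k)" "finite (elems (V (Suc k)))"
      by simp_all
  qed
  have "finite (elems (V k))" by (induction k) (simp, rule step(2))
  with step show ?thesis by blast
qed

lemma finite_V: "finite (elems (V k))"
  using V_props by blast

lemma E_V_Suc: "E z (V (Suc k)) \<longleftrightarrow> (\<forall>w. E w z \<longrightarrow> E w (V k))"
  using V_props[of k] by auto

lemma V_transitive: "E z (V k) \<Longrightarrow> E w z \<Longrightarrow> E w (V k)"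
proof (induction k arbitrary: z w)
  case (Suc k)
  then have "E w (V k)" by (simp add: E_V_Suc)
  then show ?case using Suc.IH by (auto simp: E_V_Suc)
qed simp

lemma V_mono: "i \<le> j \<Longrightarrow> E z (V i) \<Longrightarrow> E z (V j)"
proof (induction j)
  case (Suc j)
  have "E z (V (Suc j))" if "E z (V j)" using V_transitive[OF that] by (simp add: E_V_Suc)
  then show ?case using Suc by (cases "i = Suc j") auto
qed simp

text \<open>As \<open>E\<close> may be ill-founded, irreflexivity is obtained by induction on the
  outer index: if \<open>V (Suc k)\<close> were its own element, its element \<open>V k\<close>
  would lie in \<open>V k\<close>. It makes the levels pairwise distinct, so that they can serve as
  tags, signs and variable names.\<close>

lemma V_not_mem_self: "\<not> E (V k) (V k)"
proof (induction k)
  case (Suc k)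
  have "E (V k) (V (Suc k))" by (simp add: E_V_Suc)
  then show ?case using Suc by (auto simp: E_V_Suc)
qed simp

lemma V_mem: "i < j \<Longrightarrow> E (V i) (V j)"
  by (rule V_mono[of "Suc i"]) (auto simp: E_V_Suc)

lemma V_inject [simp]: "V i = V j \<longleftrightarrow> i = j"
proof
  assume "V i = V j"
  then show "i = j"
    using V_mem[of i j] V_mem[of j i] V_not_mem_self[of i] 
    by (cases i j rule: linorder_cases) auto
qed simp

text \<open>The standard sets are the copy of the hereditarily finite sets in the model. All codes
  of actual formulas are among them.\<close>

definition std :: "'m \<Rightarrow> bool" where
  "std x \<longleftrightarrow> (\<exists>k. E x (V k))"

definition rk :: "'m \<Rightarrow> nat" where
  "rk x = (LEAST k. E x (V k))"

lemma std_mem: "std x \<Longrightarrow> E y x \<Longrightarrow> std y"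
  using V_transitive by (auto simp: std_def)

lemma rk_less: 
  assumes "std x" "E y x"
  shows "rk y < rk x"
proof -
  have x: "E x (V (rk x))" using assms(1) unfolding std_def rk_def by (rule LeastI_ex)
  then obtain m where m: "rk x = Suc m" by (cases "rk x") auto
  then have "E y (V m)" using x assms(2) by (simp add: E_V_Suc)
  then have "rk y \<le> m" unfolding rk_def by (rule Least_le)
  then show ?thesis using m by simp
qed

lemma finite_elems_std: "std x \<Longrightarrow> finite (elems x)"
  unfolding std_def by (meson V_transitive finite_V in_elems rev_finite_subset subsetI)

lemma finite_std_bound: "finite S \<Longrightarrow> (\<And>x. x \<in> S \<Longrightarrow> std x) \<Longrightarrow> \<exists>k. \<forall>x\<in>S. E x (V k)"
proof (induction S rule: finite_induct)
  case (insert x S)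
  obtain i where "E x (V i)" using insert.prems[of x] by (auto simp: std_def)
  moreover obtain j where "\<forall>y\<in>S. E y (V j)" using insert.IH insert.prems by blast
  ultimately have "\<forall>y\<in>insert x S. E y (V (max i j))"
    using V_mono[of i "max i j"] V_mono[of j "max i j"] by auto
  then show ?case by blast
qed simp

lemma std_if_finite:
  assumes "finite (elems x)" "\<And>y. E y x \<Longrightarrow> std y"
  shows "std x"
proof -
  obtain k where "\<forall>y\<in>elems x. E y (V k)" using finite_std_bound[of "elems x"] assms by auto
  then have "E x (V (Suc k))" by (simp add: E_V_Suc)
  then show ?thesis by (auto simp: std_def)
qed

lemma std_emp [simp]: "std emp"
  by (rule std_if_finite) auto

lemma std_V [simp]: "std (V k)"
  using V_mem[of k "Suc k"] by (auto simp: std_def)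

lemma std_adj [simp]: "std x \<Longrightarrow> std y \<Longrightarrow> std (adj x y)"
  by (rule std_if_finite) (auto simp: finite_elems_std intro: std_mem)

lemma std_dbl [simp]: "std (dbl a b) \<longleftrightarrow> std a \<and> std b"
  by (auto simp: dbl_def intro: std_mem[of "adj (adj emp a) b"])

lemma std_pr [simp]: "std (pr a b) \<longleftrightarrow> std a \<and> std b"
  by (auto simp: pr_def)

lemma rk_pr:
  assumes "std a" "std b"
  shows "rk a < rk (pr a b)" "rk b < rk (pr a b)"
proof -
  have "rk a < rk (dbl a b)" "rk b < rk (dbl a b)" using assms by (auto intro!: rk_less)
  moreover have "rk (dbl a b) < rk (pr a b)" using assms by (intro rk_less) (auto simp: E_pr)
  ultimately show "rk a < rk (pr a b)" "rk b < rk (pr a b)" by simp_all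
qed

end

section \<open>Delta0-definable and definable predicates of the model\<close>

lemma Delta0_rename: "\<phi> \<in> Delta0 \<Longrightarrow> rename f \<phi> \<in> Delta0"
  by (induction arbitrary: f rule: Delta0.induct) (auto intro: Delta0.intros)

context kp
begin

text \<open>Predicates on assignments stand in for formulas with de Bruijn variables. The closure
  properties thereby become introduction rules, and definability of a concrete predicate follows
  from its syntactic shape.\<close>

definition D0 :: "((nat \<Rightarrow> 'm) \<Rightarrow> bool) \<Rightarrow> bool" where
  "D0 P \<longleftrightarrow> (\<exists>\<phi>\<in>Delta0. \<forall>e. sat E (=) e \<phi> = P e)"

definition Def :: "((nat \<Rightarrow> 'm) \<Rightarrow> bool) \<Rightarrow> bool" where
  "Def P \<longleftrightarrow> (\<exists>\<phi>. \<forall>e. sat E (=) e \<phi> = P e)"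

lemma D0_I: "\<phi> \<in> Delta0 \<Longrightarrow> (\<And>e. sat E (=) e \<phi> = P e) \<Longrightarrow> D0 P"
  unfolding D0_def by blast

lemma D0_shift: "D0 P \<Longrightarrow> D0 (\<lambda>e. P (\<lambda>i. e (f i)))"
proof -
  assume "D0 P"
  then obtain \<phi> where "\<phi> \<in> Delta0" "\<And>e. sat E (=) e \<phi> = P e" unfolding D0_def by blast
  then show ?thesis by (intro D0_I[of "rename f \<phi>"] Delta0_rename) (simp_all add: sat_rename)
qed

lemma D0_False: "D0 (\<lambda>e. False)"
  by (rule D0_I[of Falsum]) (auto intro: Delta0.intros)

lemma D0_eq_var: "D0 (\<lambda>e. e i = e j)"
  by (rule D0_I[of "Equal i j"]) (auto intro: Delta0.intros)

lemma D0_mem_var: "D0 (\<lambda>e. E (e i) (e j))"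
  by (rule D0_I[of "Mem i j"]) (auto intro: Delta0.intros)

lemma D0_imp: "D0 P \<Longrightarrow> D0 Q \<Longrightarrow> D0 (\<lambda>e. P e \<longrightarrow> Q e)"
proof -
  assume "D0 P" "D0 Q"
  then obtain \<phi> \<psi> where "\<phi> \<in> Delta0" "\<And>e. sat E (=) e \<phi> = P e"
    and "\<psi> \<in> Delta0" "\<And>e. sat E (=) e \<psi> = Q e"
    unfolding D0_def by blast
  then show ?thesis by (intro D0_I[of "Imp \<phi> \<psi>"] Delta0.intros) simp_all
qed

lemma D0_not: "D0 P \<Longrightarrow> D0 (\<lambda>e. \<not> P e)"
  using D0_imp[OF _ D0_False, of P] by simp

lemma D0_or: "D0 P \<Longrightarrow> D0 Q \<Longrightarrow> D0 (\<lambda>e. P e \<or> Q e)"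
  using D0_imp[OF D0_not, of P Q] by (simp add: imp_conv_disj)

lemma D0_and: "D0 P \<Longrightarrow> D0 Q \<Longrightarrow> D0 (\<lambda>e. P e \<and> Q e)"
  using D0_not[OF D0_or[OF D0_not D0_not], of P Q] by simp

lemma D0_ball:
  assumes "D0 (\<lambda>e. P (e 0) (\<lambda>i. e (Suc i)))"
  shows "D0 (\<lambda>e. \<forall>x. E x (e j) \<longrightarrow> P x e)"
proof -
  obtain \<phi> where "\<phi> \<in> Delta0" "\<forall>e. sat E (=) e \<phi> = P (e 0) (\<lambda>i. e (Suc i))"
    using assms unfolding D0_def by blast
  then show ?thesis by (intro D0_I[of "BForall j \<phi>"]) (auto intro: Delta0.intros)
qed

lemma D0_bex:
  assumes "D0 (\<lambda>e. P (e 0) (\<lambda>i. e (Suc i)))"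
  shows "D0 (\<lambda>e. \<exists>x. E x (e j) \<and> P x e)"
  using D0_not[OF D0_ball[of "\<lambda>x e. \<not> P x e" j, OF D0_not[OF assms]]] by simp

lemma D0_finite_bex:
  "finite S \<Longrightarrow> (\<And>b. b \<in> S \<Longrightarrow> D0 (P b)) \<Longrightarrow> D0 (\<lambda>e. \<exists>b\<in>S. P b e)"
  by (induction S rule: finite_induct) (auto intro: D0_False D0_or)

lemma D0_finite_ball:
  "finite S \<Longrightarrow> (\<And>b. b \<in> S \<Longrightarrow> D0 (P b)) \<Longrightarrow> D0 (\<lambda>e. \<forall>b\<in>S. P b e)"
  using D0_not[OF D0_finite_bex, of S "\<lambda>b e. \<not> P b e"] by (auto intro: D0_not)

text \<open>Recursion on rank: x equals \<open>a\<close> if every element of x is one of the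
  finitely many elements of \<open>a\<close> and each of these occurs in x. Standard constants can
  thus be written without parameters, which later carries \<open>a\<close> over to other
  models.\<close>

lemma D0_eq_std: "std a \<Longrightarrow> D0 (\<lambda>e. e i = a)"
proof (induction "rk a" arbitrary: a i rule: less_induct)
  case less
  have IH: "D0 (\<lambda>e. e i = b)" if "b \<in> elems a" for b i
    using that by (intro less.hyps rk_less[OF less.prems] std_mem[OF less.prems]) simp_all
  have fin: "finite (elems a)" using less.prems by (rule finite_elems_std)
  have eq: "x = a \<longleftrightarrow> (\<forall>y. E y x \<longrightarrow> (\<exists>b\<in>elems a. y = b)) \<and> (\<forall>b\<in>elems a. E b x)" for x
    unfolding ext_iff[of x a] in_elems Ball_def Bex_def by blast
  have "D0 (\<lambda>e. \<forall>y. E y (e i) \<longrightarrow> (\<exists>b\<in>elems a. y = b))"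
    by (rule D0_ball, rule D0_finite_bex[OF fin], rule IH)
  moreover have "D0 (\<lambda>e. E b (e i))" if "b \<in> elems a" for b
    using D0_bex[of "\<lambda>x _. x = b" i, OF IH[OF that]] by simp
  ultimately show ?case
    unfolding eq by (intro D0_and D0_finite_ball[OF fin])
qed

text \<open>The language has no function symbols, so a term is represented by its graph.
  Substitution then introduces a quantifier, which must be bounded to stay within Delta0.\<close>

definition D0t :: "((nat \<Rightarrow> 'm) \<Rightarrow> 'm) \<Rightarrow> bool" where
  "D0t t \<longleftrightarrow> D0 (\<lambda>e. e 0 = t (\<lambda>i. e (Suc i)))"

lemma D0t_shift:
  assumes "D0t t"
  shows "D0 (\<lambda>e. e j = t (\<lambda>i. e (f i)))"
  using D0_shift[OF assms[unfolded D0t_def], of "case_nat j f"] by simp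

lemma D0_eq: "D0t t \<Longrightarrow> D0 (\<lambda>e. e j = t e)"
  using D0t_shift[of t j "\<lambda>i. i"] by simp

lemma D0_mem: "D0t t \<Longrightarrow> D0 (\<lambda>e. E (t e) (e j))"
proof -
  assume "D0t t"
  then have "D0 (\<lambda>e. \<exists>x. E x (e j) \<and> x = t e)" by (intro D0_bex) (simp add: D0t_def)
  moreover have "(\<lambda>e. \<exists>x. E x (e j) \<and> x = t e) = (\<lambda>e. E (t e) (e j))" by auto
  ultimately show ?thesis by simp
qed

lemma D0t_var: "D0t (\<lambda>e. e i)"
  unfolding D0t_def by (rule D0_eq_var)

lemma D0t_std: "std a \<Longrightarrow> D0t (\<lambda>e. a)"
  unfolding D0t_def by (rule D0_eq_std)

lemma eq_dbl_iff: "x = dbl a b \<longleftrightarrow> (\<forall>z. E z x \<longrightarrow> z = a \<or> z = b) \<and> E a x \<and> E b x"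
  unfolding ext_iff[of x] E_dbl by auto

lemma D0t_dbl_var: "D0t (\<lambda>e. dbl (e j) (e k))"
  unfolding D0t_def eq_dbl_iff by (intro D0_and D0_ball D0_or D0_eq_var D0_mem_var)

lemma D0_pr_var: "D0 (\<lambda>e. e i = pr (e j) (e k))"
  unfolding pr_def eq_dbl_iff[of _ "dbl x y" for x y]
  by (intro D0_and D0_ball D0_or D0_eq D0_mem D0t_dbl_var)

text \<open>The components of a pair lie two membership steps below it, so the quantifiers over the
  values of \<open>s\<close> and \<open>t\<close> can be bounded starting from the pair.\<close>

lemma D0t_pr:
  assumes "D0t s" "D0t t"
  shows "D0t (\<lambda>e. pr (s e) (t e))"
proof -
  have eq: "(\<exists>q. E q x \<and> (\<exists>y. E y q \<and> (\<exists>r. E r x \<and> (\<exists>z. E z r \<and>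
      (y = a \<and> z = b \<and> x = pr y z))))) \<longleftrightarrow> x = pr a b" for x a b
  proof
    assume x: "x = pr a b"
    have "E (dbl a a) x" "E a (dbl a a)" "E (dbl a b) x" "E b (dbl a b)"
      by (simp_all add: x E_pr)
    then show "\<exists>q. E q x \<and> (\<exists>y. E y q \<and> (\<exists>r. E r x \<and> (\<exists>z. E z r \<and>
      (y = a \<and> z = b \<and> x = pr y z))))" using x by blast
  qed blast
  have "D0 (\<lambda>e. \<exists>q. E q (e 0) \<and> (\<exists>y. E y q \<and> (\<exists>r. E r (e 0) \<and> (\<exists>z. E z r \<and>
      (y = s (\<lambda>i. e (Suc i)) \<and> z = t (\<lambda>i. e (Suc i)) \<and> e 0 = pr y z)))))"
    by (intro D0_bex D0_and D0_pr_var D0t_shift[OF assms(1)] D0t_shift[OF assms(2)])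
  then show ?thesis unfolding D0t_def by (simp only: eq)
qed

lemma D0t_adj:
  assumes "D0t t"
  shows "D0t (\<lambda>e. adj (e j) (t e))"
proof -
  have eq: "x = adj u a \<longleftrightarrow> (\<exists>p. E p x \<and> p = a \<and> (\<forall>q. E q u \<longrightarrow> E q x) \<and>
      (\<forall>q. E q x \<longrightarrow> E q u \<or> q = p))" for x u a
    unfolding ext_iff[of x] by auto
  have "D0 (\<lambda>e. \<exists>p. E p (e 0) \<and> (p = t (\<lambda>i. e (Suc i)) \<and> (\<forall>q. E q (e (Suc j)) \<longrightarrow> E q (e 0)) \<and>
      (\<forall>q. E q (e 0) \<longrightarrow> E q (e (Suc j)) \<or> q = p)))"
    by (intro D0_bex D0_ball D0_and D0_or D0_mem_var D0_eq_var D0t_shift[OF assms])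
  then show ?thesis unfolding D0t_def by (simp only: eq)
qed

lemmas D0_intros = D0_ball D0_bex D0_and D0_or D0_not D0_imp D0_False D0_eq D0_mem
  D0t_var D0t_pr D0t_adj D0t_std std_V std_emp

lemma D0_separation:
  assumes "D0 P"
  shows "\<exists>b. \<forall>x. E x b \<longleftrightarrow> E x a \<and> P (case_nat x (case_nat a e))"
proof -
  obtain \<phi> where \<phi>: "\<phi> \<in> Delta0" "\<And>e. sat E (=) e \<phi> = P e"
    using assms unfolding D0_def by blast
  show ?thesis using sep[OF \<phi>(1), of a e] unfolding \<phi>(2) .
qed

lemma D0_collection:
  assumes "D0 P" and "\<And>x. E x a \<Longrightarrow> \<exists>y. P (case_nat y (case_nat x (case_nat a e)))"
  shows "\<exists>b. \<forall>x. E x a \<longrightarrow> (\<exists>y. E y b \<and> P (case_nat y (case_nat x (case_nat a e))))"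
proof -
  obtain \<phi> where \<phi>: "\<phi> \<in> Delta0" "\<And>e. sat E (=) e \<phi> = P e"
    using assms(1) unfolding D0_def by blast
  show ?thesis using coll[OF \<phi>(1), of a e] assms(2) unfolding \<phi>(2) by blast
qed

lemma Def_I: "(\<And>e. sat E (=) e \<phi> = P e) \<Longrightarrow> Def P"
  unfolding Def_def by blast

lemma Def_D0: "D0 P \<Longrightarrow> Def P"
  unfolding Def_def D0_def by blast

lemma Def_shift: "Def P \<Longrightarrow> Def (\<lambda>e. P (\<lambda>i. e (f i)))"
proof -
  assume "Def P"
  then obtain \<phi> where "\<And>e. sat E (=) e \<phi> = P e" unfolding Def_def by blast
  then show ?thesis by (intro Def_I[of "rename f \<phi>"]) (simp add: sat_rename)
qed

lemma Def_imp: "Def P \<Longrightarrow> Def Q \<Longrightarrow> Def (\<lambda>e. P e \<longrightarrow> Q e)"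
proof -
  assume "Def P" "Def Q"
  then obtain \<phi> \<psi> where "\<And>e. sat E (=) e \<phi> = P e" "\<And>e. sat E (=) e \<psi> = Q e"
    unfolding Def_def by blast
  then show ?thesis by (intro Def_I[of "Imp \<phi> \<psi>"]) simp
qed

lemma Def_not: "Def P \<Longrightarrow> Def (\<lambda>e. \<not> P e)"
  using Def_imp[OF _ Def_D0[OF D0_False], of P] by simp

lemma Def_or: "Def P \<Longrightarrow> Def Q \<Longrightarrow> Def (\<lambda>e. P e \<or> Q e)"
  using Def_imp[OF Def_not, of P Q] by (simp add: imp_conv_disj)

lemma Def_and: "Def P \<Longrightarrow> Def Q \<Longrightarrow> Def (\<lambda>e. P e \<and> Q e)"
  using Def_not[OF Def_or[OF Def_not Def_not], of P Q] by simp

lemma Def_iff: "Def P \<Longrightarrow> Def Q \<Longrightarrow> Def (\<lambda>e. P e \<longleftrightarrow> Q e)"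
  using Def_and[OF Def_imp Def_imp, of P Q Q P] by (simp add: iff_conv_conj_imp)

lemma Def_all:
  assumes "Def (\<lambda>e. P (e 0) (\<lambda>i. e (Suc i)))"
  shows "Def (\<lambda>e. \<forall>x. P x e)"
proof -
  obtain \<phi> where "\<forall>e. sat E (=) e \<phi> = P (e 0) (\<lambda>i. e (Suc i))"
    using assms unfolding Def_def by blast
  then show ?thesis by (intro Def_I[of "Forall \<phi>"]) simp
qed

lemma Def_ex:
  assumes "Def (\<lambda>e. P (e 0) (\<lambda>i. e (Suc i)))"
  shows "Def (\<lambda>e. \<exists>x. P x e)"
  using Def_not[OF Def_all[of "\<lambda>x e. \<not> P x e", OF Def_not[OF assms]]] by simp

definition Deft :: "((nat \<Rightarrow> 'm) \<Rightarrow> 'm) \<Rightarrow> bool" where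
  "Deft t \<longleftrightarrow> Def (\<lambda>e. e 0 = t (\<lambda>i. e (Suc i)))"

lemma Deft_shift:
  assumes "Deft t"
  shows "Def (\<lambda>e. e j = t (\<lambda>i. e (f i)))"
  using Def_shift[OF assms[unfolded Deft_def], of "case_nat j f"] by simp

text \<open>Unlike for Delta0, the value of the term may be quantified without a bound, so every
  definable term can be substituted.\<close>

lemma Def_subst1:
  assumes "Def (\<lambda>e. R (e 0))" "Deft s"
  shows "Def (\<lambda>e. R (s e))"
proof -
  have "Def (\<lambda>e. \<exists>x. x = s e \<and> R x)"
    by (intro Def_ex Def_and Deft_shift[OF assms(2)] Def_shift[OF assms(1), of "\<lambda>_. 0"])
  then show ?thesis by simp
qed

lemma Def_subst2:
  assumes "Def (\<lambda>e. R (e 0) (e 1))" "Deft s" "Deft t"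
  shows "Def (\<lambda>e. R (s e) (t e))"
proof -
  have "Def (\<lambda>e. \<exists>x. x = s e \<and> (\<exists>y. y = t e \<and> R x y))"
    by (intro Def_ex Def_and Deft_shift[OF assms(2)] Deft_shift[OF assms(3)]
        Def_shift[OF assms(1), of "case_nat 1 (\<lambda>_. 0)", simplified])
  then show ?thesis by simp
qed

lemma Def_subst3:
  assumes "Def (\<lambda>e. R (e 0) (e 1) (e 2))" "Deft s" "Deft t" "Deft u"
  shows "Def (\<lambda>e. R (s e) (t e) (u e))"
proof -
  \<comment> \<open>Below three quantifiers the values of \<open>s\<close>, \<open>t\<close>,
    \<open>u\<close> have the indices 2, 1, 0, whence the reversal of indices.\<close>
  have R: "Def (\<lambda>e. R (e (Suc (Suc 0))) (e (Suc 0)) (e 0))"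
    using Def_shift[OF assms(1), of "\<lambda>i. Suc (Suc 0) - i"] by (simp add: numeral_2_eq_2)
  have "Def (\<lambda>e. \<exists>x. x = s e \<and> (\<exists>y. y = t e \<and> (\<exists>z. z = u e \<and> R x y z)))"
    by (intro Def_ex Def_and Deft_shift[OF assms(2)] Deft_shift[OF assms(3)] Deft_shift[OF assms(4)] R)
  then show ?thesis by simp
qed

lemma Def_eq: "Deft s \<Longrightarrow> Deft t \<Longrightarrow> Def (\<lambda>e. s e = t e)"
  by (rule Def_subst2[where R = "(=)", OF Def_D0[OF D0_eq_var]])

lemma Def_mem: "Deft s \<Longrightarrow> Deft t \<Longrightarrow> Def (\<lambda>e. E (s e) (t e))"
  by (rule Def_subst2[where R = E, OF Def_D0[OF D0_mem_var]])

lemma Deft_var: "Deft (\<lambda>e. e i)"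
  unfolding Deft_def by (rule Def_D0[OF D0_eq_var])

lemma Deft_std: "std a \<Longrightarrow> Deft (\<lambda>e. a)"
  unfolding Deft_def by (rule Def_D0[OF D0_eq_std])

lemma Deft_shift_term: "Deft t \<Longrightarrow> Deft (\<lambda>e. t (\<lambda>i. e (f i)))"
  unfolding Deft_def[of "\<lambda>e. t (\<lambda>i. e (f i))"] by (rule Deft_shift)

lemma Deft_pr:
  assumes "Deft s" "Deft t"
  shows "Deft (\<lambda>e. pr (s e) (t e))"
  unfolding Deft_def
  by (rule Def_subst3[of "\<lambda>x y z. x = pr y z", OF Def_D0[OF D0_pr_var]])
    (rule Deft_var Deft_shift_term[OF assms(1)] Deft_shift_term[OF assms(2)])+

lemma Deft_adj:
  assumes "Deft s" "Deft t"
  shows "Deft (\<lambda>e. adj (s e) (t e))"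
  unfolding Deft_def
  by (rule Def_subst3[of "\<lambda>x y z. x = adj y z", OF Def_D0[OF D0_eq[OF D0t_adj[OF D0t_var]]]])
    (rule Deft_var Deft_shift_term[OF assms(1)] Deft_shift_term[OF assms(2)])+

lemmas Def_intros = Def_all Def_ex Def_and Def_or Def_not Def_imp Def_iff Def_eq Def_mem
  Deft_var Deft_pr Deft_adj Deft_std std_V std_emp

end

section \<open>Codes of formulas\<close>

context kp
begin

declare One_nat_def [simp del]

text \<open>
  Formulas are coded by elements of the model, with \<open>emp\<close> for falsity; in \<open>tr\<close>, every set that is
  not of one of the four shapes counts as falsity, so \<open>tr\<close> is meaningful for all standard sets.
  The de Bruijn index \<open>i\<close> at quantifier depth \<open>d\<close> is coded by its level, the name \<open>V (d - Suc i)\<close>,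
  which makes extending an environment a mere adjunction. A closure is a pair of a code and an
  environment.
\<close>

abbreviation fE :: "'m \<Rightarrow> 'm \<Rightarrow> 'm" where "fE x y \<equiv> pr (V 1) (pr x y)"
abbreviation fM :: "'m \<Rightarrow> 'm \<Rightarrow> 'm" where "fM x y \<equiv> pr (V 2) (pr x y)"
abbreviation fI :: "'m \<Rightarrow> 'm \<Rightarrow> 'm" where "fI a b \<equiv> pr (V 3) (pr a b)"
abbreviation fA :: "'m \<Rightarrow> 'm \<Rightarrow> 'm" where "fA x a \<equiv> pr (V 4) (pr x a)"

definition tr :: "'m \<Rightarrow> ('m \<Rightarrow> 'm) \<Rightarrow> bool" where
  "tr = wfrec (measure rk) (\<lambda>T f \<sigma>.
     (\<exists>x y. f = fE x y \<and> \<sigma> x = \<sigma> y) \<or> (\<exists>x y. f = fM x y \<and> E (\<sigma> x) (\<sigma> y)) \<or>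
     (\<exists>a b. f = fI a b \<and> (T a \<sigma> \<longrightarrow> T b \<sigma>)) \<or>
     (\<exists>x a. f = fA x a \<and> (\<forall>z. T a (\<sigma>(x := z)))))"

lemma rk_code:
  assumes "std (pr k (pr a b))"
  shows "rk a < rk (pr k (pr a b))" "rk b < rk (pr k (pr a b))"
  using assms rk_pr[of a b] rk_pr[of k "pr a b"] by simp_all

text \<open>The components of a standard code have smaller rank than the code, so the cut-off
  introduced by \<open>wfrec\<close> has no effect.\<close>

lemma tr_unfold:
  assumes "std f"
  shows "tr f \<sigma> \<longleftrightarrow> 
     (\<exists>x y. f = fE x y \<and> \<sigma> x = \<sigma> y) \<or> (\<exists>x y. f = fM x y \<and> E (\<sigma> x) (\<sigma> y)) \<or>
     (\<exists>a b. f = fI a b \<and> (tr a \<sigma> \<longrightarrow> tr b \<sigma>)) \<or>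
     (\<exists>x a. f = fA x a \<and> (\<forall>z. tr a (\<sigma>(x := z))))"
proof -
  have c: "cut tr (measure rk) f a = tr a \<and> cut tr (measure rk) f b = tr b" if "f = pr k (pr a b)" for k a b
    using that rk_code[of k a b] assms by (simp add: cut_apply)
  have "tr f \<sigma> \<longleftrightarrow> 
     (\<exists>x y. f = fE x y \<and> \<sigma> x = \<sigma> y) \<or> (\<exists>x y. f = fM x y \<and> E (\<sigma> x) (\<sigma> y)) \<or>
     (\<exists>a b. f = fI a b \<and> (cut tr (measure rk) f a \<sigma> \<longrightarrow> cut tr (measure rk) f b \<sigma>)) \<or>
     (\<exists>x a. f = fA x a \<and> (\<forall>z. cut tr (measure rk) f a (\<sigma>(x := z))))"
    by (subst tr_def, subst wfrec[OF wf_measure], fold tr_def) (rule refl)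
  also have "(\<exists>a b. f = fI a b \<and> (cut tr (measure rk) f a \<sigma> \<longrightarrow> cut tr (measure rk) f b \<sigma>))
      \<longleftrightarrow> (\<exists>a b. f = fI a b \<and> (tr a \<sigma> \<longrightarrow> tr b \<sigma>))"
    by (intro arg_cong[where f = Ex] HOL.ext conj_cong refl) (drule c, simp)
  also have "(\<exists>x a. f = fA x a \<and> (\<forall>z. cut tr (measure rk) f a (\<sigma>(x := z))))
      \<longleftrightarrow> (\<exists>x a. f = fA x a \<and> (\<forall>z. tr a (\<sigma>(x := z))))"
    by (intro arg_cong[where f = Ex] HOL.ext conj_cong refl) (drule c, simp)
  finally show ?thesis .
qed

lemma tr_simps:
  "\<not> tr emp \<sigma>"
  "std (fE x y) \<Longrightarrow> tr (fE x y) \<sigma> \<longleftrightarrow> \<sigma> x = \<sigma> y"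
  "std (fM x y) \<Longrightarrow> tr (fM x y) \<sigma> \<longleftrightarrow> E (\<sigma> x) (\<sigma> y)"
  "std (fI a b) \<Longrightarrow> tr (fI a b) \<sigma> \<longleftrightarrow> (tr a \<sigma> \<longrightarrow> tr b \<sigma>)"
  "std (fA x a) \<Longrightarrow> tr (fA x a) \<sigma> \<longleftrightarrow> (\<forall>z. tr a (\<sigma>(x := z)))"
  by (simp_all add: tr_unfold[of emp] tr_unfold[of "pr k p" for k p])

primrec cd :: "fm \<Rightarrow> nat \<Rightarrow> 'm" where
  "cd Falsum d = emp"
| "cd (Equal i j) d = fE (V (d - Suc i)) (V (d - Suc j))"
| "cd (Mem i j) d = fM (V (d - Suc i)) (V (d - Suc j))"
| "cd (Imp \<phi> \<psi>) d = fI (cd \<phi> d) (cd \<psi> d)"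
| "cd (Forall \<phi>) d = fA (V d) (cd \<phi> (Suc d))"

lemma std_cd [simp]: "std (cd \<phi> d)"
  by (induction \<phi> arbitrary: d) simp_all

lemma tr_cd:
  "fv \<phi> \<subseteq> {..<d} \<Longrightarrow> tr (cd \<phi> d) \<sigma> = sat E (=) (\<lambda>i. \<sigma> (V (d - Suc i))) \<phi>"
proof (induction \<phi> arbitrary: d \<sigma>)
  case (Forall \<phi>)
  have fv: "fv \<phi> \<subseteq> {..<Suc d}"
  proof
    fix i assume "i \<in> fv \<phi>"
    then show "i \<in> {..<Suc d}" using Forall.prems by (cases i) auto
  qed
  have "sat E (=) (\<lambda>i. (\<sigma>(V d := z)) (V (Suc d - Suc i))) \<phi>
      = sat E (=) (case_nat z (\<lambda>i. \<sigma> (V (d - Suc i)))) \<phi>" for z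
  proof (rule sat_cong_fv)
    fix i assume "i \<in> fv \<phi>"
    then have "i < Suc d" using fv by auto
    then show "(\<sigma>(V d := z)) (V (Suc d - Suc i)) = case_nat z (\<lambda>i. \<sigma> (V (d - Suc i))) i"
      by (cases i) auto
  qed
  then have "tr (cd \<phi> (Suc d)) (\<sigma>(V d := z)) = sat E (=) (case_nat z (\<lambda>i. \<sigma> (V (d - Suc i)))) \<phi>" for z
    unfolding Forall.IH[OF fv] .
  then show ?case by (simp add: tr_simps)
qed (simp_all add: tr_simps)

primrec env :: "nat \<Rightarrow> (nat \<Rightarrow> 'm) \<Rightarrow> 'm" where
  "env 0 e = emp"
| "env (Suc d) e = adj (env d (\<lambda>i. e (Suc i))) (pr (V d) (e 0))"

lemma E_env: "E p (env d e) \<longleftrightarrow> (\<exists>i<d. p = pr (V (d - Suc i)) (e i))"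
proof (induction d arbitrary: e)
  case (Suc d)
  have "(\<exists>i<Suc d. p = pr (V (Suc d - Suc i)) (e i)) \<longleftrightarrow>
      (\<exists>i<d. p = pr (V (d - Suc i)) (e (Suc i))) \<or> p = pr (V d) (e 0)"
    by (auto simp: less_Suc_eq_0_disj)
  then show ?case by (simp add: Suc.IH)
qed simp

lemma lookup_env: 
  assumes "i < d"
  shows "E (pr (V (d - Suc i)) x) (env d e) \<longleftrightarrow> x = e i"
proof
  assume "E (pr (V (d - Suc i)) x) (env d e)"
  then obtain j where "j < d" "d - Suc i = d - Suc j" "x = e j" by (auto simp: E_env)
  moreover from this assms have "i = j" by simp
  ultimately show "x = e i" by simp
qed (use assms in \<open>auto simp: E_env\<close>)

text \<open>Not defined: \<open>e\<close> gives the name \<open>x\<close> no value. It is required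
  before a pair for \<open>x\<close> is adjoined, so that the extension contradicts no earlier
  value.\<close>

definition nd :: "'m \<Rightarrow> 'm \<Rightarrow> bool" where
  "nd x e \<longleftrightarrow> (\<forall>w. \<not> E (pr x w) e)"

text \<open>The value w is an element of \<open>dbl x w\<close>, which is an element of the pair.
  The bounded form is what keeps \<open>Just\<close> within Delta0.\<close>

lemma nd_bounded: "nd x e \<longleftrightarrow>
  (\<forall>p. E p e \<longrightarrow> (\<forall>q. E q p \<longrightarrow> (\<forall>w. E w q \<longrightarrow> \<not> (p = pr x w))))"
proof -
  have "\<exists>q. E q p \<and> E w q" if "p = pr x w" for p w
    using that by (intro exI[of _ "dbl x w"]) (simp add: E_pr)
  then show ?thesis unfolding nd_def by blast
qed

lemma nd_env: "nd (V d) (env d e)"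
  by (auto simp: nd_def E_env)

lemma std_env: "(\<And>i. i < d \<Longrightarrow> std (e i)) \<Longrightarrow> std (env d e)"
  by (induction d arbitrary: e) auto

text \<open>Agreement on the recorded values only: the assignment is free at other names, and
  \<open>e\<close> may be any set of the model rather than a value of \<open>env\<close>.\<close>

definition compat :: "('m \<Rightarrow> 'm) \<Rightarrow> 'm \<Rightarrow> bool" where
  "compat \<sigma> e \<longleftrightarrow> (\<forall>x w. E (pr x w) e \<longrightarrow> \<sigma> x = w)"

lemma compat_adj: "compat \<sigma> e \<Longrightarrow> nd x e \<Longrightarrow> compat (\<sigma>(x := z)) (adj e (pr x z))"
  unfolding compat_def nd_def by auto

text \<open>
  Truth of bounded formulas is witnessed by a set \<open>s\<close> of signed closures (sign \<open>V 1\<close> for true,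
  \<open>V 2\<close> for false) in which every member is justified by other members. Such sets are closed
  under unions, which is what makes them exist for every standard formula.
  The set \<open>t\<close> merely bounds the quantifiers.
\<close>

definition jF :: "'m \<Rightarrow> 'm \<Rightarrow> bool" where
  "jF c t \<longleftrightarrow> (\<exists>e. E e t \<and> c = pr (V 2) (pr emp e))"

definition jA :: "'m \<Rightarrow> 'm \<Rightarrow> bool" where
  "jA c t \<longleftrightarrow> (\<exists>x. E x t \<and> (\<exists>y. E y t \<and> (\<exists>e. E e t \<and> (\<exists>w. E w t \<and> (\<exists>z. E z t \<and>
     (E (pr x w) e \<and> E (pr y z) e \<and>
      (c = pr (V 1) (pr (fE x y) e) \<and> w = z \<or> c = pr (V 2) (pr (fE x y) e) \<and> \<not> (w = z) \<or>
       c = pr (V 1) (pr (fM x y) e) \<and> E w z \<or> c = pr (V 2) (pr (fM x y) e) \<and> \<not> E w z)))))))"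

definition jI :: "'m \<Rightarrow> 'm \<Rightarrow> 'm \<Rightarrow> bool" where
  "jI c s t \<longleftrightarrow> (\<exists>a. E a t \<and> (\<exists>b. E b t \<and> (\<exists>e. E e t \<and>
     (c = pr (V 1) (pr (fI a b) e) \<and> (E (pr (V 2) (pr a e)) s \<or> E (pr (V 1) (pr b e)) s) \<or>
      c = pr (V 2) (pr (fI a b) e) \<and> E (pr (V 1) (pr a e)) s \<and> E (pr (V 2) (pr b e)) s))))"

definition jQ :: "'m \<Rightarrow> 'm \<Rightarrow> 'm \<Rightarrow> bool" where
  "jQ c s t \<longleftrightarrow> (\<exists>x. E x t \<and> (\<exists>y. E y t \<and> (\<exists>b. E b t \<and> (\<exists>e. E e t \<and> (\<exists>w. E w t \<and>
     (nd x e \<and> E (pr y w) e \<and>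
      (c = pr (V 1) (pr (fA x (fI (fM x y) b)) e) \<and>
         (\<forall>z. E z w \<longrightarrow> E (pr (V 1) (pr b (adj e (pr x z)))) s) \<or>
       c = pr (V 2) (pr (fA x (fI (fM x y) b)) e) \<and>
         (\<exists>z. E z w \<and> E (pr (V 2) (pr b (adj e (pr x z)))) s))))))))"

definition just :: "'m \<Rightarrow> 'm \<Rightarrow> 'm \<Rightarrow> bool" where
  "just c s t \<longleftrightarrow> jF c t \<or> jA c t \<or> jI c s t \<or> jQ c s t"

definition Just :: "'m \<Rightarrow> 'm \<Rightarrow> bool" where
  "Just s t \<longleftrightarrow> (\<forall>c. E c s \<longrightarrow> just c s t)"

text \<open>The bound \<open>t\<close> pays off here: only for Delta0-predicates is collection at
  hand, and \<open>Just_collect\<close> applies it to \<open>Just\<close>.\<close>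

lemma D0_Just: "D0 (\<lambda>e. Just (e i) (e j))"
  unfolding Just_def just_def jF_def jA_def jI_def jQ_def nd_bounded
  by (intro D0_intros)

definition sub :: "'m \<Rightarrow> 'm \<Rightarrow> bool" where
  "sub x y \<longleftrightarrow> (\<forall>z. E z x \<longrightarrow> E z y)"

text \<open>Falsity is recorded by a sign of its own and not by absence, so \<open>s\<close> occurs
  only positively in the clauses; \<open>t\<close> occurs only as a bound of existential
  quantifiers.\<close>

lemma just_mono:
  assumes "just c s t" "sub s s'" "sub t t'"
  shows "just c s' t'"
proof -
  have s: "E z s \<longrightarrow> E z s'" and t: "E z t \<longrightarrow> E z t'" for z
    using assms by (auto simp: sub_def)
  have "jF c t \<longrightarrow> jF c t'" "jA c t \<longrightarrow> jA c t'" "jI c s t \<longrightarrow> jI c s' t'" "jQ c s t \<longrightarrow> jQ c s' t'"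
    unfolding jF_def jA_def jI_def jQ_def
    by (rule imp_refl s t | rule ex_mono conj_mono disj_mono all_mono imp_mono)+
  then show ?thesis using assms(1) unfolding just_def by blast
qed

lemma sub_refl [simp]: "sub x x"
  by (simp add: sub_def)

lemma sub_adj [simp]: "sub x (adj x y)"
  by (simp add: sub_def)

lemma union_exists: "\<exists>u. \<forall>z. E z u \<longleftrightarrow> E z a \<or> E z b"
proof -
  obtain u where "\<forall>z. E z u \<longleftrightarrow> (\<exists>y. E y (dbl a b) \<and> E z y)" using union by blast
  then show ?thesis by (intro exI[of _ u]) auto
qed

lemma Just_union:
  assumes "Just s t" "Just s' t'"
  obtains u v where "Just u v" "sub s u" "sub s' u"
proof -
  obtain u where u: "\<forall>z. E z u \<longleftrightarrow> E z s \<or> E z s'" using union_exists by blast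
  obtain v where v: "\<forall>z. E z v \<longleftrightarrow> E z t \<or> E z t'" using union_exists by blast
  have s: "sub s u" "sub s' u" "sub t v" "sub t' v" using u v by (auto simp: sub_def)
  have "Just u v" unfolding Just_def
  proof (intro allI impI)
    fix c assume "E c u"
    then consider "E c s" | "E c s'" using u by blast
    then show "just c u v"
    proof cases
      case 1
      then show ?thesis using just_mono s assms(1) unfolding Just_def by blast
    next
      case 2
      then show ?thesis using just_mono s assms(2) unfolding Just_def by blast
    qed
  qed
  then show ?thesis using that s by blast
qed

lemma Just_adj:
  assumes "Just s t" "just c s t'" "sub t t'"
  shows "Just (adj s c) t'"
  unfolding Just_def
proof (intro allI impI)
  fix c' assume "E c' (adj s c)"
  then consider "E c' s" | "c' = c" by auto
  then show "just c' (adj s c) t'"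
  proof cases
    case 1
    then show ?thesis using assms(1) just_mono[OF _ sub_adj assms(3)] unfolding Just_def by blast
  next
    case 2
    then show ?thesis using just_mono[OF assms(2) sub_adj sub_refl] by simp
  qed
qed

text \<open>The set \<open>w\<close> may be infinite, so the justifications of its instances cannot
  be united one by one. Collection gathers them in a set, and a union of justified sets is
  justified.\<close>

lemma Just_collect:
  assumes "\<And>z. E z w \<Longrightarrow> \<exists>s t. Just s t \<and> E (pr g (pr b (adj e (pr x z)))) s"
  obtains s t where "Just s t" "\<And>z. E z w \<Longrightarrow> E (pr g (pr b (adj e (pr x z)))) s"
proof -
  \<comment> \<open>In \<open>P\<close> the indices 0 to 6 denote \<open>t\<close>,
    \<open>z\<close>, \<open>w\<close>, \<open>g\<close>, \<open>b\<close>, \<open>e\<close> and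
    \<open>x\<close>.\<close>
  let ?e = "case_nat g (case_nat b (case_nat e (\<lambda>_. x)))"
  define P where "P = (\<lambda>e. \<exists>s. E s (e 0) \<and> (Just s (e 0) \<and>
      E (pr (e (Suc (Suc (Suc 0)))) (pr (e (Suc (Suc (Suc (Suc 0))))) (adj (e (Suc (Suc (Suc (Suc (Suc 0))))))
        (pr (e (Suc (Suc (Suc (Suc (Suc (Suc 0))))))) (e (Suc 0)))))) s))"
  have D0: "D0 P" unfolding P_def by (intro D0_intros D0_Just)
  have P: "P (case_nat t (case_nat z (case_nat w ?e))) \<longleftrightarrow>
      (\<exists>s. E s t \<and> Just s t \<and> E (pr g (pr b (adj e (pr x z)))) s)" for t z
    by (simp add: P_def)
  have "\<exists>t. P (case_nat t (case_nat z (case_nat w ?e)))" if "E z w" for z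
  proof -
    obtain s t where st: "Just s t" "E (pr g (pr b (adj e (pr x z)))) s" using assms \<open>E z w\<close> by blast
    \<comment> \<open>Collection handles a single existential variable, so \<open>s\<close> is
      stored inside its own bound.\<close>
    then have "Just s (adj t s)" using just_mono[OF _ sub_refl sub_adj] unfolding Just_def by blast
    then show ?thesis using st unfolding P by (intro exI[of _ "adj t s"] exI[of _ s]) simp
  qed
  from D0_collection[OF D0 this] obtain B
    where B: "\<forall>z. E z w \<longrightarrow> (\<exists>t. E t B \<and> P (case_nat t (case_nat z (case_nat w ?e))))" by blast
  obtain T where T: "\<forall>z. E z T \<longleftrightarrow> (\<exists>t. E t B \<and> E z t)" using union by blast
  \<comment> \<open>The collected bounds also contain sets that are not justified. Separation
    removes them before the union is formed.\<close>
  have "D0 (\<lambda>e. \<exists>t. E t (e (Suc (Suc 0))) \<and> (E (e 0) t \<and> Just (e 0) t))" by (intro D0_intros D0_Just)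
  from D0_separation[OF this, of T "\<lambda>_. B"]
  obtain S' where S': "\<forall>s. E s S' \<longleftrightarrow> E s T \<and> (\<exists>t. E t B \<and> E s t \<and> Just s t)"
    by auto
  obtain S where S: "\<forall>z. E z S \<longleftrightarrow> (\<exists>s. E s S' \<and> E z s)" using union by blast
  have "Just S T" unfolding Just_def
  proof (intro allI impI)
    fix c assume "E c S"
    then obtain s t where s: "E s S'" "E c s" "E t B" "Just s t" using S S' by blast
    then have "just c s t" by (simp add: Just_def)
    moreover have "sub s S" "sub t T" using s S T unfolding sub_def by blast+
    ultimately show "just c S T" by (rule just_mono)
  qed
  moreover have "E (pr g (pr b (adj e (pr x z)))) S" if "E z w" for z
  proof -
    obtain t s where "E t B" "E s t" "Just s t" "E (pr g (pr b (adj e (pr x z)))) s"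
      using B \<open>E z w\<close> unfolding P by blast
    then show ?thesis using S S' T by blast
  qed
  ultimately show ?thesis by (rule that)
qed

end

section \<open>Truth of bounded formulas\<close>

lemma fv_Forall_bound: "fv (Forall \<phi>) \<subseteq> {..<d} \<longleftrightarrow> fv \<phi> \<subseteq> {..<Suc d}"
proof -
  have "i < Suc d" if "fv (Forall \<phi>) \<subseteq> {..<d}" "i \<in> fv \<phi>" for i
    using that by (cases i) auto
  then show ?thesis by auto
qed

text \<open>
  Up to semantic equivalence, \<open>Bnd\<close> are the bounded formulas, \<open>U n\<close> are the \<open>\<Pi>\<^sub>n\<close>-formulas
  and the negations of formulas in \<open>U n\<close> are the \<open>\<Sigma>\<^sub>n\<close>-formulas.
\<close>

inductive_set Bnd :: "fm set" where
  "Falsum \<in> Bnd"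
| "Equal i j \<in> Bnd"
| "Mem i j \<in> Bnd"
| "\<phi> \<in> Bnd \<Longrightarrow> \<psi> \<in> Bnd \<Longrightarrow> Imp \<phi> \<psi> \<in> Bnd"
| "\<phi> \<in> Bnd \<Longrightarrow> BForall y \<phi> \<in> Bnd"

primrec U :: "nat \<Rightarrow> fm set" where
  "U 0 = Bnd"
| "U (Suc j) = {(Forall ^^ k) (Neg \<psi>) | k \<psi>. \<psi> \<in> U j}"

lemma Delta0_Bnd:
  "\<phi> \<in> Delta0 \<Longrightarrow> \<exists>\<chi>\<in>Bnd. fv \<chi> \<subseteq> fv \<phi> \<and> (\<forall>E Q (e :: nat \<Rightarrow> 'a). sat E Q e \<chi> = sat E Q e \<phi>)"
proof (induction rule: Delta0.induct)
  case 1
  then show ?case by (intro bexI[of _ Falsum] Bnd.intros) simp_all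
next
  case (2 i j)
  then show ?case by (intro bexI[of _ "Equal i j"] Bnd.intros) simp_all
next
  case (3 i j)
  then show ?case by (intro bexI[of _ "Mem i j"] Bnd.intros) simp_all
next
  case (4 \<phi> \<psi>)
  then obtain \<chi> \<chi>' where "\<chi> \<in> Bnd" "fv \<chi> \<subseteq> fv \<phi>" "\<forall>E Q (e :: nat \<Rightarrow> 'a). sat E Q e \<chi> = sat E Q e \<phi>"
    and "\<chi>' \<in> Bnd" "fv \<chi>' \<subseteq> fv \<psi>" "\<forall>E Q (e :: nat \<Rightarrow> 'a). sat E Q e \<chi>' = sat E Q e \<psi>"
    by blast
  then show ?case by (intro bexI[of _ "Imp \<chi> \<chi>'"] Bnd.intros) auto
next
  case (5 \<phi> y)
  then obtain \<chi> where "\<chi> \<in> Bnd" "fv \<chi> \<subseteq> fv \<phi>" "\<forall>E Q (e :: nat \<Rightarrow> 'a). sat E Q e \<chi> = sat E Q e \<phi>"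
    by blast
  then show ?case by (intro bexI[of _ "BForall y \<chi>"] Bnd.intros) auto
next
  case (6 \<phi> y)
  then obtain \<chi> where "\<chi> \<in> Bnd" "fv \<chi> \<subseteq> fv \<phi>" "\<forall>E Q (e :: nat \<Rightarrow> 'a). sat E Q e \<chi> = sat E Q e \<phi>"
    by blast
  then show ?case by (intro bexI[of _ "Neg (BForall y (Neg \<chi>))"] Bnd.intros) auto
qed

lemma fv_Forall_pow: "fv ((Forall ^^ k) \<phi>) = {i. i + k \<in> fv \<phi>}"
  by (induction k) auto

lemma fv_Exists_pow: "fv ((Exists ^^ k) \<phi>) = {i. i + k \<in> fv \<phi>}"
  by (induction k) auto

lemma sat_Exists_pow:
  assumes "\<And>e. sat E Q e \<chi> = sat E Q e \<phi>"
  shows "sat E Q e ((Forall ^^ k) (Neg \<chi>)) = (\<not> sat E Q e ((Exists ^^ k) \<phi>))"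
  by (induction k arbitrary: e) (simp_all add: assms)

lemma sat_Forall_pow_cong:
  assumes "\<And>e. sat E Q e \<chi> = sat E Q e \<phi>"
  shows "sat E Q e ((Forall ^^ k) \<chi>) = sat E Q e ((Forall ^^ k) \<phi>)"
  by (induction k arbitrary: e) (simp_all add: assms)

text \<open>The two hierarchies refer to each other, so both halves are proved together;
  representing Sigma by negation lets the single sequence \<open>U\<close> serve both.\<close>

lemma Levy_U:
  "(\<phi> \<in> Levy_Sigma n \<longrightarrow>
      (\<exists>\<chi>\<in>U n. fv \<chi> \<subseteq> fv \<phi> \<and> (\<forall>E Q (e :: nat \<Rightarrow> 'a). sat E Q e \<chi> = (\<not> sat E Q e \<phi>)))) \<and>
   (\<phi> \<in> Levy_Pi n \<longrightarrow>
      (\<exists>\<chi>\<in>U n. fv \<chi> \<subseteq> fv \<phi> \<and> (\<forall>E Q (e :: nat \<Rightarrow> 'a). sat E Q e \<chi> = sat E Q e \<phi>)))"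
proof (induction n arbitrary: \<phi>)
  case 0
  show ?case
  proof (intro conjI impI)
    assume "\<phi> \<in> Levy_Sigma 0"
    then obtain \<chi> where "\<chi> \<in> Bnd" "fv \<chi> \<subseteq> fv \<phi>" "\<forall>E Q (e :: nat \<Rightarrow> 'a). sat E Q e \<chi> = sat E Q e \<phi>"
      using Delta0_Bnd[of \<phi>] by auto
    then show "\<exists>\<chi>\<in>U 0. fv \<chi> \<subseteq> fv \<phi> \<and> (\<forall>E Q (e :: nat \<Rightarrow> 'a). sat E Q e \<chi> = (\<not> sat E Q e \<phi>))"
      by (intro bexI[of _ "Neg \<chi>"]) (auto intro: Bnd.intros)
  next
    assume "\<phi> \<in> Levy_Pi 0"
    then show "\<exists>\<chi>\<in>U 0. fv \<chi> \<subseteq> fv \<phi> \<and> (\<forall>E Q (e :: nat \<Rightarrow> 'a). sat E Q e \<chi> = sat E Q e \<phi>)"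
      using Delta0_Bnd[of \<phi>] by auto
  qed
next
  case (Suc n)
  show ?case
  proof (intro conjI impI)
    assume "\<phi> \<in> Levy_Sigma (Suc n)"
    then obtain k \<psi> where \<psi>: "\<phi> = (Exists ^^ k) \<psi>" "\<psi> \<in> Levy_Pi n" by auto
    with Suc obtain \<chi> where \<chi>: "\<chi> \<in> U n" "fv \<chi> \<subseteq> fv \<psi>"
      "\<And>E Q (e :: nat \<Rightarrow> 'a). sat E Q e \<chi> = sat E Q e \<psi>" by blast
    show "\<exists>\<chi>\<in>U (Suc n). fv \<chi> \<subseteq> fv \<phi> \<and> (\<forall>E Q (e :: nat \<Rightarrow> 'a). sat E Q e \<chi> = (\<not> sat E Q e \<phi>))"
    proof (intro bexI conjI allI)
      show "(Forall ^^ k) (Neg \<chi>) \<in> U (Suc n)" using \<chi>(1) by auto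
      show "fv ((Forall ^^ k) (Neg \<chi>)) \<subseteq> fv \<phi>" using \<chi>(2) by (auto simp: fv_Forall_pow fv_Exists_pow \<psi>(1))
      show "sat E Q e ((Forall ^^ k) (Neg \<chi>)) = (\<not> sat E Q e \<phi>)" for E Q and e :: "nat \<Rightarrow> 'a"
        unfolding \<psi>(1) by (rule sat_Exists_pow) (rule \<chi>(3))
    qed
  next
    assume "\<phi> \<in> Levy_Pi (Suc n)"
    then obtain k \<psi> where \<psi>: "\<phi> = (Forall ^^ k) \<psi>" "\<psi> \<in> Levy_Sigma n" by auto
    with Suc obtain \<chi> where \<chi>: "\<chi> \<in> U n" "fv \<chi> \<subseteq> fv \<psi>"
      "\<And>E Q (e :: nat \<Rightarrow> 'a). sat E Q e \<chi> = (\<not> sat E Q e \<psi>)" by blast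
    show "\<exists>\<chi>\<in>U (Suc n). fv \<chi> \<subseteq> fv \<phi> \<and> (\<forall>E Q (e :: nat \<Rightarrow> 'a). sat E Q e \<chi> = sat E Q e \<phi>)"
    proof (intro bexI conjI allI)
      show "(Forall ^^ k) (Neg \<chi>) \<in> U (Suc n)" using \<chi>(1) by auto
      show "fv ((Forall ^^ k) (Neg \<chi>)) \<subseteq> fv \<phi>" using \<chi>(2) by (auto simp: fv_Forall_pow \<psi>(1))
      show "sat E Q e ((Forall ^^ k) (Neg \<chi>)) = sat E Q e \<phi>" for E Q and e :: "nat \<Rightarrow> 'a"
        unfolding \<psi>(1) by (rule sat_Forall_pow_cong) (simp add: \<chi>(3))
    qed
  qed
qed

lemma Delta0_Levy: "Delta0 \<subseteq> Levy_Sigma n \<and> Delta0 \<subseteq> Levy_Pi n"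
proof (induction n)
  case (Suc n)
  show ?case
  proof (intro conjI subsetI)
    fix \<phi> assume "\<phi> \<in> Delta0"
    then have "\<phi> \<in> Levy_Sigma n" "\<phi> \<in> Levy_Pi n" using Suc by auto
    then show "\<phi> \<in> Levy_Sigma (Suc n)" "\<phi> \<in> Levy_Pi (Suc n)"
      by (auto intro!: exI[of _ "0::nat"] exI[of _ \<phi>])
  qed
qed simp

context kp
begin

lemma finite_extend:
  assumes "finite S"
  shows "\<exists>t'. sub t t' \<and> (\<forall>x\<in>S. E x t')"
  using assms
proof (induction S rule: finite_induct)
  case (insert x S)
  then obtain u where "sub t u" "\<forall>y\<in>S. E y u" by blast
  then show ?case by (intro exI[of _ "adj u x"]) (auto simp: sub_def)
qed (intro exI[of _ t], simp)

abbreviation sgn :: "bool \<Rightarrow> 'm" where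
  "sgn b \<equiv> if b then V 1 else V 2"

lemma std_sgn: "std (sgn b)"
  by simp

lemma Just_emp: "Just emp t"
  by (simp add: Just_def)

lemma Just_Falsum:
  obtains s t where "Just s t" "E (pr (sgn False) (pr emp e)) s"
proof -
  have "just (pr (V 2) (pr emp e)) emp (adj emp e)" by (simp add: just_def jF_def)
  then have "Just (adj emp (pr (V 2) (pr emp e))) (adj emp e)"
    by (rule Just_adj[OF Just_emp _ sub_refl])
  then show ?thesis by (rule that) simp
qed

lemma Just_atom:
  assumes "E (pr x w) e" "E (pr y z) e"
  shows "\<exists>s t. Just s t \<and> E (pr (sgn (w = z)) (pr (fE x y) e)) s"
    and "\<exists>s t. Just s t \<and> E (pr (sgn (E w z)) (pr (fM x y) e)) s"
proof -
  obtain t where t: "E x t" "E y t" "E e t" "E w t" "E z t"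
    using finite_extend[of "{x, y, e, w, z}" emp] by auto
  have *: "\<exists>s t. Just s t \<and> E c s" if "jA c t" for c
  proof -
    have "just c emp t" using that by (simp add: just_def)
    then have "Just (adj emp c) t" by (rule Just_adj[OF Just_emp _ sub_refl])
    then show ?thesis by (intro exI[of _ "adj emp c"] exI[of _ t]) simp
  qed
  have "jA (pr (sgn (w = z)) (pr (fE x y) e)) t"
    unfolding jA_def
    by (rule exI[of _ x], rule conjI[OF t(1)], rule exI[of _ y], rule conjI[OF t(2)], rule exI[of _ e], rule conjI[OF t(3)], rule exI[of _ w], rule conjI[OF t(4)], rule exI[of _ z], rule conjI[OF t(5)],
        simp add: assms)
  then show "\<exists>s t. Just s t \<and> E (pr (sgn (w = z)) (pr (fE x y) e)) s" by (rule *)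
  have "jA (pr (sgn (E w z)) (pr (fM x y) e)) t"
    unfolding jA_def
    by (rule exI[of _ x], rule conjI[OF t(1)], rule exI[of _ y], rule conjI[OF t(2)], rule exI[of _ e], rule conjI[OF t(3)], rule exI[of _ w], rule conjI[OF t(4)], rule exI[of _ z], rule conjI[OF t(5)],
        simp add: assms)
  then show "\<exists>s t. Just s t \<and> E (pr (sgn (E w z)) (pr (fM x y) e)) s" by (rule *)
qed

lemma Just_Imp:
  assumes "Just s t" "E (pr (sgn p) (pr a e)) s" "E (pr (sgn q) (pr b e)) s"
  shows "\<exists>s t. Just s t \<and> E (pr (sgn (p \<longrightarrow> q)) (pr (fI a b) e)) s"
proof -
  obtain t' where t: "sub t t'" "E a t'" "E b t'" "E e t'"
    using finite_extend[of "{a, b, e}" t] by auto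
  let ?c = "pr (sgn (p \<longrightarrow> q)) (pr (fI a b) e)"
  have "jI ?c s t'"
    unfolding jI_def
    by (insert assms(2,3), rule exI[of _ a], rule conjI[OF t(2)], rule exI[of _ b], rule conjI[OF t(3)], rule exI[of _ e], rule conjI[OF t(4)],
        cases p; cases q; simp)
  then have "Just (adj s ?c) t'" by (intro Just_adj[OF assms(1) _ t(1)]) (simp add: just_def)
  then show ?thesis by (intro exI[of _ "adj s ?c"] exI[of _ t']) simp
qed

lemma Just_BForall:
  assumes "Just s t" "nd x e" "E (pr y w) e"
    and "p \<Longrightarrow> \<forall>z. E z w \<longrightarrow> E (pr (V 1) (pr b (adj e (pr x z)))) s"
    and "\<not> p \<Longrightarrow> \<exists>z. E z w \<and> E (pr (V 2) (pr b (adj e (pr x z)))) s"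
  shows "\<exists>s t. Just s t \<and> E (pr (sgn p) (pr (fA x (fI (fM x y) b)) e)) s"
proof -
  obtain t' where t: "sub t t'" "E x t'" "E y t'" "E b t'" "E e t'" "E w t'"
    using finite_extend[of "{x, y, b, e, w}" t] by auto
  let ?c = "pr (sgn p) (pr (fA x (fI (fM x y) b)) e)"
  have "jQ ?c s t'"
    unfolding jQ_def
    by (insert assms(2-), rule exI[of _ x], rule conjI[OF t(2)], rule exI[of _ y], rule conjI[OF t(3)], rule exI[of _ b], rule conjI[OF t(4)], rule exI[of _ e], rule conjI[OF t(5)], rule exI[of _ w], rule conjI[OF t(6)],
        cases p; simp)
  then have "Just (adj s ?c) t'" by (intro Just_adj[OF assms(1) _ t(1)]) (simp add: just_def)
  then show ?thesis by (intro exI[of _ "adj s ?c"] exI[of _ t']) simp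
qed

text \<open>A true bounded quantifier requires all its instances to be justified in one set, by
  \<open>Just_collect\<close>; a false one requires a single counterexample.\<close>

lemma Just_complete:
  "\<phi> \<in> Bnd \<Longrightarrow> fv \<phi> \<subseteq> {..<d} \<Longrightarrow>
    \<exists>s t. Just s t \<and> E (pr (sgn (sat E (=) e \<phi>)) (pr (cd \<phi> d) (env d e))) s"
proof (induction arbitrary: d e rule: Bnd.induct)
  case 1
  show ?case using Just_Falsum[of "env d e"] by simp blast
next
  case (2 i j)
  then have "i < d" "j < d" by auto
  then show ?case
    using Just_atom(1)[of "V (d - Suc i)" "e i" "env d e" "V (d - Suc j)" "e j"]
    by (simp only: lookup_env cd.simps sat.simps)
next
  case (3 i j)
  then have "i < d" "j < d" by auto
  then show ?case
    using Just_atom(2)[of "V (d - Suc i)" "e i" "env d e" "V (d - Suc j)" "e j"]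
    by (simp only: lookup_env cd.simps sat.simps)
next
  case (4 \<phi> \<psi>)
  then obtain s t s' t' where s: "Just s t" "E (pr (sgn (sat E (=) e \<phi>)) (pr (cd \<phi> d) (env d e))) s"
    and s': "Just s' t'" "E (pr (sgn (sat E (=) e \<psi>)) (pr (cd \<psi> d) (env d e))) s'"
    by (metis Un_subset_iff fv.simps(4))
  obtain u v where u: "Just u v" "sub s u" "sub s' u" using Just_union[OF s(1) s'(1)] by blast
  then have "E (pr (sgn (sat E (=) e \<phi>)) (pr (cd \<phi> d) (env d e))) u"
    "E (pr (sgn (sat E (=) e \<psi>)) (pr (cd \<psi> d) (env d e))) u"
    using s(2) s'(2) unfolding sub_def by blast+
  then have "\<exists>s t. Just s t \<and>
      E (pr (sgn (sat E (=) e \<phi> \<longrightarrow> sat E (=) e \<psi>)) (pr (fI (cd \<phi> d) (cd \<psi> d)) (env d e))) s"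
    by (rule Just_Imp[OF u(1)])
  then show ?case by (simp only: cd.simps sat.simps)
next
  case (5 \<phi> y)
  have fv: "fv \<phi> \<subseteq> {..<Suc d}" "y < d" using 5(3) unfolding fv_Forall_bound by auto
  have IH: "\<exists>s t. Just s t \<and> E (pr (sgn (sat E (=) (case_nat z e) \<phi>))
      (pr (cd \<phi> (Suc d)) (adj (env d e) (pr (V d) z)))) s" for z
    using 5(2)[OF fv(1), of "case_nat z e"] by (simp only: env.simps nat.case)
  let ?p = "\<forall>z. E z (e y) \<longrightarrow> sat E (=) (case_nat z e) \<phi>"
  have y: "E (pr (V (d - Suc y)) (e y)) (env d e)" using lookup_env[OF fv(2)] by blast
  have "\<exists>s t. Just s t \<and> E (pr (sgn ?p) (pr (fA (V d) (fI (fM (V d) (V (d - Suc y))) (cd \<phi> (Suc d))))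
      (env d e))) s"
  proof (cases ?p)
    case True
    then have "\<exists>s t. Just s t \<and> E (pr (V 1) (pr (cd \<phi> (Suc d)) (adj (env d e) (pr (V d) z)))) s"
      if "E z (e y)" for z
      using IH[of z] that by auto
    then obtain s t where "Just s t"
      "\<And>z. E z (e y) \<Longrightarrow> E (pr (V 1) (pr (cd \<phi> (Suc d)) (adj (env d e) (pr (V d) z)))) s"
      using Just_collect[of "e y"] by blast
    then show ?thesis by (intro Just_BForall[OF _ nd_env y]) (use True in auto)
  next
    case False
    then obtain z where z: "E z (e y)" "\<not> sat E (=) (case_nat z e) \<phi>" by blast
    then obtain s t where "Just s t"
      "E (pr (V 2) (pr (cd \<phi> (Suc d)) (adj (env d e) (pr (V d) z)))) s"
      using IH[of z] by auto
    then show ?thesis by (intro Just_BForall[OF _ nd_env y]) (use False z in auto)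
  qed
  then show ?case by simp
qed

text \<open>The sets \<open>s\<close> and \<open>t\<close> may be nonstandard, and justifications in
  them may be circular. The induction therefore runs on the rank of the standard code
  \<open>f\<close>, whose components determine what the clauses refer to.\<close>

lemma Just_sound:
  assumes "Just s t"
  shows "std f \<Longrightarrow> E (pr g (pr f e)) s \<Longrightarrow> compat \<sigma> e \<Longrightarrow>
    g = V 1 \<and> tr f \<sigma> \<or> g = V 2 \<and> \<not> tr f \<sigma>"
proof (induction "rk f" arbitrary: f g e \<sigma> rule: less_induct)
  case less
  have "just (pr g (pr f e)) s t" using assms less.prems(2) by (simp add: Just_def)
  then consider "jF (pr g (pr f e)) t" | "jA (pr g (pr f e)) t" | "jI (pr g (pr f e)) s t"
    | "jQ (pr g (pr f e)) s t"
    unfolding just_def by blast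
  then show ?case
  proof cases
    case 1
    then show ?thesis by (auto simp: jF_def tr_simps)
  next
    case 2
    then obtain x y w z where xy: "E (pr x w) e" "E (pr y z) e" and
      c: "g = V 1 \<and> f = fE x y \<and> w = z \<or> g = V 2 \<and> f = fE x y \<and> w \<noteq> z \<or>
       g = V 1 \<and> f = fM x y \<and> E w z \<or> g = V 2 \<and> f = fM x y \<and> \<not> E w z"
      unfolding jA_def pr_inject by blast
    have "\<sigma> x = w" "\<sigma> y = z" using xy less.prems(3) by (auto simp: compat_def)
    then show ?thesis using c less.prems(1) by (auto simp: tr_simps)
  next
    case 3
    then obtain a b where f: "f = fI a b" and
      c: "g = V 1 \<and> (E (pr (V 2) (pr a e)) s \<or> E (pr (V 1) (pr b e)) s) \<or>
      g = V 2 \<and> E (pr (V 1) (pr a e)) s \<and> E (pr (V 2) (pr b e)) s"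
      unfolding jI_def pr_inject by blast
    have std: "std a" "std b" using less.prems(1) f by simp_all
    have rk: "rk a < rk f" "rk b < rk f" using less.prems(1) unfolding f by (rule rk_code)+
    have a: "E (pr h (pr a e)) s \<Longrightarrow> h = V 1 \<and> tr a \<sigma> \<or> h = V 2 \<and> \<not> tr a \<sigma>" for h
      by (rule less.hyps[OF rk(1) std(1) _ less.prems(3)])
    have b: "E (pr h (pr b e)) s \<Longrightarrow> h = V 1 \<and> tr b \<sigma> \<or> h = V 2 \<and> \<not> tr b \<sigma>" for h
      by (rule less.hyps[OF rk(2) std(2) _ less.prems(3)])
    have t: "tr f \<sigma> \<longleftrightarrow> (tr a \<sigma> \<longrightarrow> tr b \<sigma>)" using less.prems(1) unfolding f by (rule tr_simps)
    have ne: "V 1 \<noteq> V 2" "V 2 \<noteq> V 1" by simp_all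
    show ?thesis using ne c a[of "V 1"] a[of "V 2"] b[of "V 1"] b[of "V 2"] unfolding t by blast
  next
    case 4
    then obtain x y b w where f: "f = fA x (fI (fM x y) b)" and nd: "nd x e" "E (pr y w) e" and
      c: "g = V 1 \<and> (\<forall>z. E z w \<longrightarrow> E (pr (V 1) (pr b (adj e (pr x z)))) s) \<or>
      g = V 2 \<and> (\<exists>z. E z w \<and> E (pr (V 2) (pr b (adj e (pr x z)))) s)"
      unfolding jQ_def pr_inject by blast
    have std: "std b" "std (fI (fM x y) b)" "std (fM x y)" using less.prems(1) f by simp_all
    have "rk (fI (fM x y) b) < rk f" using less.prems(1) unfolding f by (rule rk_code)
    then have rk: "rk b < rk f" using rk_code(2)[OF std(2)] by simp
    have b: "E (pr h (pr b (adj e (pr x z)))) s \<Longrightarrow>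
      h = V 1 \<and> tr b (\<sigma>(x := z)) \<or> h = V 2 \<and> \<not> tr b (\<sigma>(x := z))" for h z
      by (rule less.hyps[OF rk std(1) _ compat_adj[OF less.prems(3) nd(1)]])
    \<comment> \<open>The name \<open>y\<close> has a value in \<open>e\<close> whereas
      \<open>x\<close> has none. Updating \<open>x\<close> therefore leaves the bound
      \<open>w\<close> of the quantifier unchanged.\<close>
    have "x \<noteq> y" "\<sigma> y = w" using nd less.prems(3) by (auto simp: nd_def compat_def)
    then have t: "tr f \<sigma> \<longleftrightarrow> (\<forall>z. E z w \<longrightarrow> tr b (\<sigma>(x := z)))"
      using less.prems(1) std unfolding f by (simp add: tr_simps)
    have ne: "V 1 \<noteq> V 2" "V 2 \<noteq> V 1" by simp_all
    show ?thesis using ne c b[of "V 1"] b[of "V 2"] unfolding t by blast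
  qed
qed

end

section \<open>Truth of Levy formulas\<close>

context kp
begin

text \<open>
  \<open>Ver j True\<close> verifies and \<open>Ver j False\<close> refutes closures. Both are sound for all standard
  formulas, but they decide only the formulas in \<open>U j\<close>. A refutation of a block of universal
  quantifiers is a set containing a path of instances down to a refuted matrix.
\<close>

primrec Ver :: "nat \<Rightarrow> bool \<Rightarrow> 'm \<Rightarrow> 'm \<Rightarrow> bool" where
  "Ver 0 b f e = (\<exists>s. \<exists>t. Just s t \<and> E (pr (sgn b) (pr f e)) s)"
| "Ver (Suc j) b f e = (if b
     then \<forall>s. E (pr f e) s \<and>
       (\<forall>x. \<forall>a. \<forall>e. E (pr (fA x a) e) s \<and> nd x e \<longrightarrow> (\<exists>z. E (pr a (adj e (pr x z))) s)) \<longrightarrow>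
       (\<exists>a. \<exists>e. E (pr (fI a emp) e) s \<and> Ver j False a e)
     else \<exists>s. E (pr f e) s \<and>
       (\<forall>f. \<forall>e. E (pr f e) s \<longrightarrow>
         (\<exists>x. \<exists>a. \<exists>z. f = fA x a \<and> nd x e \<and> E (pr a (adj e (pr x z))) s) \<or>
         (\<exists>a. f = fI a emp \<and> Ver j True a e)))"

lemma Def_nd: "Deft s \<Longrightarrow> Deft t \<Longrightarrow> Def (\<lambda>e. nd (s e) (t e))"
  by (rule Def_subst2[where R = nd]) (unfold nd_def, intro Def_intros)

lemma Def_Ver: "Deft s \<Longrightarrow> Deft t \<Longrightarrow> Def (\<lambda>e. Ver j b (s e) (t e))"
proof (rule Def_subst2[where R = "Ver j b"])
  show "Def (\<lambda>e. Ver j b (e 0) (e 1))"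
  proof (induction j arbitrary: b)
    case 0
    show ?case by (unfold Ver.simps, intro Def_intros Def_D0[OF D0_Just] std_sgn)
  next
    case (Suc j)
    note IH = Def_subst2[where R = "Ver j b" for b, OF Suc.IH]
    have "Def (\<lambda>e. Ver (Suc j) True (e 0) (e 1))"
      by (unfold Ver.simps if_True, intro Def_intros Def_nd IH)
    moreover have "Def (\<lambda>e. Ver (Suc j) False (e 0) (e 1))"
      by (unfold Ver.simps if_False, intro Def_intros Def_nd IH)
    ultimately show ?case by (cases b) (simp_all only:)
  qed
qed

text \<open>All standard codes have to be covered and not only those from \<open>U j\<close>,
  because \<open>Mod\<close> at a standard stage speaks about every code occurring there.\<close>

lemma Ver_sound:
  "std f \<Longrightarrow> compat \<sigma> e \<Longrightarrow> Ver j b f e \<Longrightarrow> tr f \<sigma> = b"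
proof (induction j arbitrary: b f e \<sigma>)
  case 0
  then obtain s t where "Just s t" "E (pr (sgn b) (pr f e)) s" by auto
  from Just_sound[OF this(1) 0(1) this(2) 0(2)] show ?case by (cases b) auto
next
  case (Suc j)
  show ?case
  proof (cases b)
    case False
    with Suc.prems(3) obtain s where fe: "E (pr f e) s" and
      s: "\<And>f e. E (pr f e) s \<Longrightarrow>
         (\<exists>x a z. f = fA x a \<and> nd x e \<and> E (pr a (adj e (pr x z))) s) \<or>
         (\<exists>a. f = fI a emp \<and> Ver j True a e)"
      by auto
    have "E (pr f e) s \<Longrightarrow> std f \<Longrightarrow> compat \<sigma> e \<Longrightarrow> \<not> tr f \<sigma>" for f e \<sigma>
    proof (induction "rk f" arbitrary: f e \<sigma> rule: less_induct)
      case less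
      from s[OF less.prems(1)] show ?case
      proof (elim disjE exE conjE)
        fix x a z assume f: "f = fA x a" and "nd x e" and a: "E (pr a (adj e (pr x z))) s"
        have std: "std (fA x a)" "std a" using less.prems(2) f by simp_all
        have "rk a < rk f" using less.prems(2) unfolding f by (rule rk_code)
        then have "\<not> tr a (\<sigma>(x := z))"
          using a std(2) compat_adj[OF less.prems(3) \<open>nd x e\<close>] by (rule less.hyps)
        then show ?thesis unfolding f tr_simps(5)[OF std(1)] by blast
      next
        fix a assume f: "f = fI a emp" and a: "Ver j True a e"
        have std: "std (fI a emp)" "std a" using less.prems(2) f by simp_all
        show ?thesis
          using Suc.IH[OF std(2) less.prems(3) a] unfolding f tr_simps(4)[OF std(1)]
          by (simp add: tr_simps)
      qed
    qed
    from this[OF fe Suc.prems(1,2)] False show ?thesis by simp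
  next
    case True
    \<comment> \<open>If \<open>f\<close> were false, choosing counterexamples down the block of
      quantifiers would give a set that meets the premise of the verification clause while all its
      members are false under compatible assignments. The refuted \<open>a\<close> which the clause
      finds in it would make the member \<open>fI a emp\<close> true.\<close>
    have path: "std f \<Longrightarrow> compat \<sigma> e \<Longrightarrow> \<not> tr f \<sigma> \<Longrightarrow>
      \<exists>s. E (pr f e) s \<and>
        (\<forall>x a e. E (pr (fA x a) e) s \<and> nd x e \<longrightarrow> (\<exists>z. E (pr a (adj e (pr x z))) s)) \<and>
        (\<forall>f e. E (pr f e) s \<longrightarrow> std f \<and> (\<exists>\<sigma>. compat \<sigma> e \<and> \<not> tr f \<sigma>))" for f e \<sigma>
    proof (induction "rk f" arbitrary: f e \<sigma> rule: less_induct)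
      case less
      show ?case
      proof (cases "\<exists>x a. f = fA x a \<and> nd x e")
        case True
        then obtain x a where f: "f = fA x a" and nd: "nd x e" by blast
        have std: "std (fA x a)" "std a" using less.prems(1) f by simp_all
        have rk: "rk a < rk f" using less.prems(1) unfolding f by (rule rk_code)
        obtain z where "\<not> tr a (\<sigma>(x := z))"
          using less.prems(3) unfolding f tr_simps(5)[OF std(1)] by blast
        from less.hyps[OF rk std(2) compat_adj[OF less.prems(2) nd] this]
        obtain s where s: "E (pr a (adj e (pr x z))) s"
          "\<And>x a e. E (pr (fA x a) e) s \<and> nd x e \<Longrightarrow> \<exists>z. E (pr a (adj e (pr x z))) s"
          "\<And>f e. E (pr f e) s \<Longrightarrow> std f \<and> (\<exists>\<sigma>. compat \<sigma> e \<and> \<not> tr f \<sigma>)"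
          by blast
        show ?thesis
        proof (rule exI[of _ "adj s (pr f e)"], intro conjI allI impI)
          show "E (pr f e) (adj s (pr f e))" by simp
        next
          fix x' a' e' assume "E (pr (fA x' a') e') (adj s (pr f e)) \<and> nd x' e'"
          then show "\<exists>z. E (pr a' (adj e' (pr x' z))) (adj s (pr f e))"
            using s(1) s(2)[of x' a' e'] f by auto
        next
          fix f' e' assume "E (pr f' e') (adj s (pr f e))"
          then have "E (pr f' e') s \<or> f' = f \<and> e' = e" by simp
          then show "std f'" "\<exists>\<sigma>. compat \<sigma> e' \<and> \<not> tr f' \<sigma>"
            using s(3) less.prems by blast+
        qed
      next
        case False
        then show ?thesis using less.prems
          by (intro exI[of _ "adj emp (pr f e)"]) auto
      qed
    qed
    have "tr f \<sigma>"
    proof (rule ccontr)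
      assume "\<not> tr f \<sigma>"
      from path[OF Suc.prems(1,2) this] obtain s where s: "E (pr f e) s"
        "\<forall>x a e. E (pr (fA x a) e) s \<and> nd x e \<longrightarrow> (\<exists>z. E (pr a (adj e (pr x z))) s)"
        "\<And>f e. E (pr f e) s \<Longrightarrow> std f \<and> (\<exists>\<sigma>. compat \<sigma> e \<and> \<not> tr f \<sigma>)"
        by blast
      then obtain a e' where a: "E (pr (fI a emp) e') s" "Ver j False a e'"
        using Suc.prems(3) \<open>b\<close> by auto
      from s(3)[OF a(1)] obtain \<tau> where t: "std (fI a emp)" "compat \<tau> e'" "\<not> tr (fI a emp) \<tau>" by blast
      then have "std a" by simp
      from Suc.IH[OF this t(2) a(2)] show False
        using t(3) unfolding tr_simps(4)[OF t(1)] by simp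
    qed
    with \<open>b\<close> show ?thesis by simp
  qed
qed

lemma U_induct [consumes 1, case_names Neg Forall]:
  assumes "\<phi> \<in> U (Suc j)" and "\<And>\<psi>. \<psi> \<in> U j \<Longrightarrow> P (Neg \<psi>)"
    and "\<And>\<phi>. \<phi> \<in> U (Suc j) \<Longrightarrow> P \<phi> \<Longrightarrow> P (Forall \<phi>)"
  shows "P \<phi>"
proof -
  obtain k \<psi> where \<psi>: "\<phi> = (Forall ^^ k) (Neg \<psi>)" "\<psi> \<in> U j" using assms(1) by auto
  have "P ((Forall ^^ k) (Neg \<psi>))"
  proof (induction k)
    case 0
    then show ?case using assms(2) \<psi>(2) by simp
  next
    case (Suc k)
    moreover have "(Forall ^^ k) (Neg \<psi>) \<in> U (Suc j)" using \<psi>(2) by auto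
    ultimately show ?case using assms(3) by simp
  qed
  then show ?thesis using \<psi>(1) by simp
qed

lemma Ver_complete:
  "\<phi> \<in> U j \<Longrightarrow> fv \<phi> \<subseteq> {..<d} \<Longrightarrow> Ver j (sat E (=) e \<phi>) (cd \<phi> d) (env d e)"
proof (induction j arbitrary: \<phi> d e)
  case 0
  then show ?case using Just_complete[of \<phi> d e] by (simp only: Ver.simps U.simps)
next
  case (Suc j)
  have env_Suc: "adj (env d e) (pr (V d) z) = env (Suc d) (case_nat z e)" for d e z
    by simp
  show ?case
  proof (cases "sat E (=) e \<phi>")
    case True
    have "\<exists>a e. E (pr (fI a emp) e) s \<and> Ver j False a e"
      if "E (pr (cd \<phi> d) (env d e)) s" and
        s: "\<And>x a e. E (pr (fA x a) e) s \<and> nd x e \<Longrightarrow> \<exists>z. E (pr a (adj e (pr x z))) s" for s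
      using Suc.prems True that(1)
    proof (induction \<phi> arbitrary: d e rule: U_induct)
      case (Neg \<psi>)
      have "Ver j False (cd \<psi> d) (env d e)"
        using Suc.IH[OF Neg(1), of d e] Neg(2,3) by simp
      moreover have "E (pr (fI (cd \<psi> d) emp) (env d e)) s" using Neg(4) by simp
      ultimately show ?case by blast
    next
      case (Forall \<phi>)
      have "E (pr (fA (V d) (cd \<phi> (Suc d))) (env d e)) s" using Forall.prems(3) by simp
      then obtain z where "E (pr (cd \<phi> (Suc d)) (env (Suc d) (case_nat z e))) s"
        using s nd_env unfolding env_Suc[symmetric] by blast
      moreover have "fv \<phi> \<subseteq> {..<Suc d}" using Forall.prems(1) by (simp only: fv_Forall_bound)
      moreover have "sat E (=) (case_nat z e) \<phi>" using Forall.prems(2) by simp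
      ultimately show ?case by (intro Forall.IH)
    qed
    then show ?thesis using True by simp
  next
    case False
    have "\<exists>s. E (pr (cd \<phi> d) (env d e)) s \<and>
       (\<forall>f e. E (pr f e) s \<longrightarrow>
         (\<exists>x a z. f = fA x a \<and> nd x e \<and> E (pr a (adj e (pr x z))) s) \<or>
         (\<exists>a. f = fI a emp \<and> Ver j True a e))"
      using Suc.prems False
    proof (induction \<phi> arbitrary: d e rule: U_induct)
      case (Neg \<psi>)
      have "Ver j True (cd \<psi> d) (env d e)"
        using Suc.IH[OF Neg(1), of d e] Neg(2,3) by simp
      then show ?case by (intro exI[of _ "adj emp (pr (cd (Neg \<psi>) d) (env d e))"]) simp
    next
      case (Forall \<phi>)
      obtain z where z: "\<not> sat E (=) (case_nat z e) \<phi>" using Forall.prems(2) by auto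
      have fv: "fv \<phi> \<subseteq> {..<Suc d}" using Forall.prems(1) by (simp only: fv_Forall_bound)
      from Forall.IH[OF fv z] obtain s where
        s: "E (pr (cd \<phi> (Suc d)) (adj (env d e) (pr (V d) z))) s"
        "\<And>f e. E (pr f e) s \<Longrightarrow> (\<exists>x a z. f = fA x a \<and> nd x e \<and> E (pr a (adj e (pr x z))) s) \<or>
         (\<exists>a. f = fI a emp \<and> Ver j True a e)"
        unfolding env_Suc by blast
      show ?case
      proof (rule exI[of _ "adj s (pr (cd (Forall \<phi>) d) (env d e))"], intro conjI allI impI)
        fix f e' assume "E (pr f e') (adj s (pr (cd (Forall \<phi>) d) (env d e)))"
        then consider "E (pr f e') s" | "f = fA (V d) (cd \<phi> (Suc d))" "e' = env d e" by auto
        then show "(\<exists>x a z. f = fA x a \<and> nd x e' \<and>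
            E (pr a (adj e' (pr x z))) (adj s (pr (cd (Forall \<phi>) d) (env d e)))) \<or>
          (\<exists>a. f = fI a emp \<and> Ver j True a e')"
        proof cases
          case 1
          then show ?thesis using s(2)[OF 1] unfolding E_adj by blast
        next
          case 2
          then show ?thesis using s(1) nd_env[of d e] unfolding E_adj by blast
        qed
      qed simp
    qed
    then show ?thesis using False by simp
  qed
qed

end

section \<open>Stages and Hintikka sets\<close>

context kp
begin

text \<open>The set \<open>h\<close> is a history of the construction of \<open>W\<close>: each
  member is empty or the full power set of another member. It may be nonstandard and even
  ill-founded.\<close>

definition Stage :: "'m \<Rightarrow> bool" where
  "Stage W \<longleftrightarrow> (\<exists>h. E W h \<and> (\<forall>x. E x h \<longrightarrow> x = emp \<or>
     (\<exists>y. E y h \<and> (\<forall>z. E z x \<longleftrightarrow> (\<forall>w. E w z \<longrightarrow> E w y)))))"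

lemma Def_Stage: "Deft s \<Longrightarrow> Def (\<lambda>e. Stage (s e))"
  by (rule Def_subst1[where R = Stage]) (unfold Stage_def, intro Def_intros)

lemma Stage_V: "Stage (V k)"
proof -
  obtain h where h: "elems h = V ` {..k}" using finite_set_exists[of "V ` {..k}"] by blast
  have E_h: "E x h \<longleftrightarrow> (\<exists>i\<le>k. x = V i)" for x
    unfolding in_elems[symmetric, of x] h by auto
  show ?thesis unfolding Stage_def
  proof (intro exI[of _ h] conjI allI impI)
    show "E (V k) h" using E_h by blast
    fix x assume "E x h"
    then obtain i where i: "i \<le> k" "x = V i" using E_h by blast
    show "x = emp \<or> (\<exists>y. E y h \<and> (\<forall>z. E z x \<longleftrightarrow> (\<forall>w. E w z \<longrightarrow> E w y)))"
    proof (cases i)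
      case (Suc j)
      then have "E (V j) h" using i E_h by auto
      moreover have "\<forall>z. E z x \<longleftrightarrow> (\<forall>w. E w z \<longrightarrow> E w (V j))" using i Suc E_V_Suc by simp
      ultimately show ?thesis by blast
    qed (use i in simp)
  qed
qed

text \<open>Comparison with the standard levels, by induction on \<open>k\<close> along the history,
  takes the place of a well-ordering of the stages.\<close>

lemma Stage_cases:
  assumes "Stage W"
  shows "(\<exists>j\<le>k. W = V j) \<or> E (V k) W"
proof -
  obtain h where h: "E W h" "\<And>x. E x h \<Longrightarrow> x \<noteq> emp \<Longrightarrow>
     \<exists>y. E y h \<and> (\<forall>z. E z x \<longleftrightarrow> (\<forall>w. E w z \<longrightarrow> E w y))"
    using assms unfolding Stage_def by blast
  have "E x h \<Longrightarrow> (\<exists>j\<le>k. x = V j) \<or> E (V k) x" for x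
  proof (induction k arbitrary: x)
    case 0
    show ?case
    proof (cases "x = emp")
      case False
      then obtain y where "\<forall>z. E z x \<longleftrightarrow> (\<forall>w. E w z \<longrightarrow> E w y)" using h(2)[OF 0] by blast
      then show ?thesis by simp
    qed simp
  next
    case (Suc k)
    show ?case
    proof (cases "x = emp")
      case True
      then show ?thesis by (intro disjI1 exI[of _ 0]) simp
    next
      case False
      then obtain y where y: "E y h" "\<And>z. E z x \<longleftrightarrow> (\<forall>w. E w z \<longrightarrow> E w y)"
        using h(2)[OF Suc.prems] by blast
      from Suc.IH[OF y(1)] show ?thesis
      proof (elim disjE exE conjE)
        fix j assume j: "j \<le> k" "y = V j"
        then have "x = V (Suc j)" unfolding ext_iff[of x] y(2) E_V_Suc by simp
        then show ?thesis using j by (intro disjI1 exI[of _ "Suc j"]) simp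
      next
        \<comment> \<open>Here \<open>y\<close> is itself the power set of some \<open>y'\<close>.
          From \<open>V k\<close> in \<open>y\<close> it follows that \<open>V k\<close> is a subset
          of \<open>y'\<close>, so all subsets of \<open>V k\<close> belong to \<open>y\<close>;
          hence \<open>V (Suc k)\<close> is a subset of \<open>y\<close> and an element of
          \<open>x\<close>.\<close>
        assume Vk: "E (V k) y"
        then have "y \<noteq> emp" by auto
        then obtain y' where y': "\<And>z. E z y \<longleftrightarrow> (\<forall>w. E w z \<longrightarrow> E w y')" using h(2)[OF y(1)] by blast
        have "E w y" if "E w (V (Suc k))" for w
          using that Vk unfolding y' E_V_Suc by blast
        then show ?thesis using y(2) by blast
      qed
    qed
  qed
  with h(1) show ?thesis by blast
qed

lemma Stage_mem_V:
  assumes "Stage W" "E W (V k)"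
  obtains j where "W = V j"
  using Stage_cases[OF assms(1), of k] V_transitive[OF assms(2), of "V k"] V_not_mem_self by blast

text \<open>
  \<open>Hint W v\<close> states that \<open>v\<close> is a Hintikka set of closures as far as the closures belong to \<open>W\<close>.
  The closure \<open>pr (fA x a) e\<close> itself serves as the Henkin constant for a counterexample to it.
\<close>

definition val :: "'m \<Rightarrow> 'm \<Rightarrow> 'm \<Rightarrow> bool" where
  "val e x w \<longleftrightarrow> (\<forall>u. E (pr x u) e \<longleftrightarrow> u = w)"

abbreviation e2 :: "'m \<Rightarrow> 'm \<Rightarrow> 'm" where
  "e2 w w' \<equiv> adj (adj emp (pr emp w)) (pr (V 1) w')"

text \<open>The canonical atom about the constants \<open>w\<close> and \<open>w'\<close>, an
  equation for k = 1 and a membership for k = 2. The names \<open>emp\<close>, which is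
  \<open>V 0\<close>, and \<open>V 1\<close> are the first two levels. \<open>atom_clause\<close>
  reduces atoms in other environments to this one, so that truth depends on the constants
  alone.\<close>

abbreviation qm :: "nat \<Rightarrow> 'm \<Rightarrow> 'm \<Rightarrow> 'm" where
  "qm k w w' \<equiv> pr (pr (V k) (pr emp (V 1))) (e2 w w')"

definition atom_clause :: "nat \<Rightarrow> 'm \<Rightarrow> 'm \<Rightarrow> bool" where
  "atom_clause k W v \<longleftrightarrow> (\<forall>x. \<forall>y. \<forall>e. \<forall>w. \<forall>w'. val e x w \<and> val e y w' \<and>
     E (pr (pr (V k) (pr x y)) e) W \<and> E (qm k w w') W \<longrightarrow>
     (E (pr (pr (V k) (pr x y)) e) v \<longleftrightarrow> E (qm k w w') v))"

definition congruence_clause :: "nat \<Rightarrow> 'm \<Rightarrow> 'm \<Rightarrow> bool" where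
  "congruence_clause k W v \<longleftrightarrow> (\<forall>w. \<forall>w'. \<forall>u. \<forall>u'. E (qm 1 w u) v \<and> E (qm 1 w' u') v \<and>
     E (qm k w w') v \<and> E (qm k u u') W \<longrightarrow> E (qm k u u') v)"

definition Hint :: "'m \<Rightarrow> 'm \<Rightarrow> bool" where
  "Hint W v \<longleftrightarrow>
     (\<forall>e. \<not> E (pr emp e) v) \<and>
     (\<forall>a. \<forall>b. \<forall>e. E (pr (fI a b) e) W \<and> E (pr a e) W \<and> E (pr b e) W \<longrightarrow>
       (E (pr (fI a b) e) v \<longleftrightarrow> (E (pr a e) v \<longrightarrow> E (pr b e) v))) \<and>
     (\<forall>x. \<forall>a. \<forall>e. \<forall>z. E (pr (fA x a) e) W \<and> E (pr a (adj e (pr x z))) W \<and> nd x e \<and>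
       E (pr (fA x a) e) v \<longrightarrow> E (pr a (adj e (pr x z))) v) \<and>
     (\<forall>x. \<forall>a. \<forall>e. E (pr (fA x a) e) W \<and> E (pr a (adj e (pr x (pr (fA x a) e)))) W \<and> nd x e \<and>
       E (pr a (adj e (pr x (pr (fA x a) e)))) v \<longrightarrow> E (pr (fA x a) e) v) \<and>
     (\<forall>w. E (qm 1 w w) W \<longrightarrow> E (qm 1 w w) v) \<and>
     atom_clause 1 W v \<and> atom_clause 2 W v \<and>
     congruence_clause 1 W v \<and> congruence_clause 2 W v"

abbreviation ea :: "'m \<Rightarrow> 'm" where
  "ea a \<equiv> adj emp (pr emp a)"

text \<open>
  \<open>Mod n b W f a\<close>: at stage \<open>W\<close> nothing contradicts a model that satisfies the \<open>\<Sigma>\<^sub>n\<close>-type of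
  \<open>a\<close> at the constant \<open>emp\<close> and gives \<open>f\<close> the truth value \<open>b\<close> there.
\<close>

definition Mod :: "nat \<Rightarrow> bool \<Rightarrow> 'm \<Rightarrow> 'm \<Rightarrow> 'm \<Rightarrow> bool" where
  "Mod n b W f a \<longleftrightarrow> (\<exists>v. Hint W v \<and>
     (\<forall>g. E (pr g (ea emp)) W \<longrightarrow> (Ver n True g (ea a) \<longrightarrow> E (pr g (ea emp)) v) \<and>
        (Ver n False g (ea a) \<longrightarrow> \<not> E (pr g (ea emp)) v)) \<and>
     (E (pr f (ea emp)) W \<longrightarrow> (if b then E (pr f (ea emp)) v else \<not> E (pr f (ea emp)) v)))"

lemma Def_Mod: "Deft s \<Longrightarrow> Deft t \<Longrightarrow> Deft u \<Longrightarrow> Def (\<lambda>e. Mod n b (s e) (t e) (u e))"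
proof (rule Def_subst3[where R = "Mod n b"])
  have Def_val: "Deft s \<Longrightarrow> Deft t \<Longrightarrow> Deft u \<Longrightarrow> Def (\<lambda>e. val (s e) (t e) (u e))" for s t u
    by (rule Def_subst3[where R = val]) (unfold val_def, intro Def_intros)
  have Def_atom: "Deft s \<Longrightarrow> Deft t \<Longrightarrow> Def (\<lambda>e. atom_clause k (s e) (t e))" for k s t
    by (rule Def_subst2[where R = "atom_clause k"]) (unfold atom_clause_def, intro Def_intros Def_val)
  have Def_congruence: "Deft s \<Longrightarrow> Deft t \<Longrightarrow> Def (\<lambda>e. congruence_clause k (s e) (t e))" for k s t
    by (rule Def_subst2[where R = "congruence_clause k"])
      (unfold congruence_clause_def, intro Def_intros)
  have Def_Hint: "Deft s \<Longrightarrow> Deft t \<Longrightarrow> Def (\<lambda>e. Hint (s e) (t e))" for s t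
    by (rule Def_subst2[where R = Hint]) (unfold Hint_def, intro Def_intros Def_nd Def_atom Def_congruence)
  have "Def (\<lambda>e. Mod n True (e 0) (e 1) (e 2))"
    unfolding Mod_def if_True by (intro Def_intros Def_Hint Def_Ver)
  moreover have "Def (\<lambda>e. Mod n False (e 0) (e 1) (e 2))"
    unfolding Mod_def if_False by (intro Def_intros Def_Hint Def_Ver)
  ultimately show "Def (\<lambda>e. Mod n b (e 0) (e 1) (e 2))" by (cases b) (simp_all only:)
qed

text \<open>Environments of Hintikka sets store constants. This reads them through the denotations
  \<open>I\<close>, with a default that makes the assignment total.\<close>

definition asg :: "('m \<Rightarrow> 'm) \<Rightarrow> 'm \<Rightarrow> 'm \<Rightarrow> 'm \<Rightarrow> 'm" where
  "asg I a e x = (if \<exists>!w. E (pr x w) e then I (THE w. E (pr x w) e) else a)"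

lemma asg_val: "val e x w \<Longrightarrow> asg I a e x = I w"
proof -
  assume "val e x w"
  then have "E (pr x u) e \<longleftrightarrow> u = w" for u by (simp add: val_def)
  then show ?thesis by (simp add: asg_def)
qed

lemma asg_adj:
  assumes "nd x e"
  shows "asg I a (adj e (pr x z)) = (asg I a e)(x := I z)"
proof
  fix y
  show "asg I a (adj e (pr x z)) y = ((asg I a e)(x := I z)) y"
  proof (cases "y = x")
    case True
    have "val (adj e (pr x z)) x z" using assms by (simp add: val_def nd_def)
    then show ?thesis using True asg_val by simp
  next
    case False
    then have "E (pr y w) (adj e (pr x z)) \<longleftrightarrow> E (pr y w) e" for w by simp
    then show ?thesis using False by (simp add: asg_def)
  qed
qed

text \<open>The denotation of \<open>pr (fA x b) e\<close> depends on those of the constants stored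
  in \<open>e\<close>, which have smaller rank. Recursion along \<open>rk\<close> can therefore
  choose a counterexample whenever there is one.\<close>

lemma henkin_constants:
  obtains I where "I emp = a" and
    "\<And>x b e z. std (pr (fA x b) e) \<Longrightarrow> \<not> tr b ((asg I a e)(x := z)) \<Longrightarrow>
      \<not> tr b ((asg I a e)(x := I (pr (fA x b) e)))"
proof -
  define F where "F J c = (if c = emp then a else SOME z. \<forall>x b e. c = pr (fA x b) e \<longrightarrow>
      (\<exists>z. \<not> tr b ((asg J a e)(x := z))) \<longrightarrow> \<not> tr b ((asg J a e)(x := z)))" for J c
  define I where "I = wfrec (measure rk) F"
  have I: "I c = F (cut I (measure rk) c) c" for c
    unfolding I_def by (rule wfrec[OF wf_measure])
  have "I emp = a" by (subst I) (simp add: F_def)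
  moreover have "\<not> tr b ((asg I a e)(x := I (pr (fA x b) e)))"
    if std: "std (pr (fA x b) e)" and z: "\<not> tr b ((asg I a e)(x := z))" for x b e z
  proof -
    let ?c = "pr (fA x b) e"
    have cut: "asg (cut I (measure rk) ?c) a e = asg I a e"
    proof
      fix y
      show "asg (cut I (measure rk) ?c) a e y = asg I a e y"
      proof (cases "\<exists>!w. E (pr y w) e")
        case True
        then have w: "E (pr y (THE w. E (pr y w) e)) e" by (rule theI')
        have "std e" using std by simp
        then have "std (pr y (THE w. E (pr y w) e))" using w by (rule std_mem)
        then have "rk (THE w. E (pr y w) e) < rk (pr y (THE w. E (pr y w) e))"
          by (intro rk_pr) simp_all
        also have "\<dots> < rk e" using \<open>std e\<close> w by (rule rk_less)
        also have "\<dots> < rk ?c" using std by (intro rk_pr) simp_all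
        finally show ?thesis using True by (simp add: asg_def cut_apply)
      qed (simp add: asg_def)
    qed
    let ?P = "\<lambda>z. \<not> tr b ((asg I a e)(x := z))"
    have "I ?c = (SOME z. (\<exists>z. ?P z) \<longrightarrow> ?P z)"
      by (subst I) (simp add: F_def cut)
    also have "\<dots> = (SOME z. ?P z)" using z by (intro arg_cong[where f = Eps]) auto
    finally show ?thesis using someI[of ?P, OF z] by (simp only: not_False_eq_True)
  qed
  ultimately show ?thesis by (rule that)
qed

lemma val_e2: "val (e2 w w') emp w" "val (e2 w w') (V 1) w'"
proof -
  have "emp \<noteq> V 1" using V_inject[of 0 1] by simp
  then show "val (e2 w w') emp w" "val (e2 w w') (V 1) w'" by (auto simp: val_def)
qed

text \<open>Actual truth restricted to the closures in \<open>V k\<close> is a Hintikka set. It is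
  finite and hence a set of the model.\<close>

lemma Mod_true:
  assumes "fv \<theta> \<subseteq> {..<1}"
  shows "Mod n (sat E (=) (\<lambda>_. a) \<theta>) (V k) (cd \<theta> 1) a"
proof -
  obtain I where I: "I emp = a" "\<And>x b e z. std (pr (fA x b) e) \<Longrightarrow> \<not> tr b ((asg I a e)(x := z)) \<Longrightarrow>
      \<not> tr b ((asg I a e)(x := I (pr (fA x b) e)))"
    using henkin_constants by blast
  let ?A = "asg I a"
  have "finite {c. E c (V k) \<and> (\<exists>f e. c = pr f e \<and> tr f (?A e))}"
    by (rule finite_subset[OF _ finite_V[of k]]) auto
  then obtain v where v: "elems v = {c. E c (V k) \<and> (\<exists>f e. c = pr f e \<and> tr f (?A e))}"
    using finite_set_exists by blast
  have Ev: "E (pr f e) v \<longleftrightarrow> E (pr f e) (V k) \<and> tr f (?A e)" for f e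
    unfolding in_elems[symmetric, of _ v] v by simp
  have std: "std f" "std e" if "E (pr f e) (V k)" for f e
  proof -
    have "std (pr f e)" using that by (auto simp: std_def)
    then show "std f" "std e" by simp_all
  qed
  have qm: "E (qm 1 w w') v \<longleftrightarrow> E (qm 1 w w') (V k) \<and> I w = I w'"
    "E (qm 2 w w') v \<longleftrightarrow> E (qm 2 w w') (V k) \<and> E (I w) (I w')" for w w'
    unfolding Ev by (simp_all add: tr_simps asg_val[OF val_e2(1)] asg_val[OF val_e2(2)])
  have "Hint (V k) v" unfolding Hint_def
  proof (intro conjI allI impI; (elim conjE)?)
    show "\<not> E (pr emp e) v" for e by (simp add: Ev tr_simps)
  next
    fix c b e assume "E (pr (fI c b) e) (V k)" "E (pr c e) (V k)" "E (pr b e) (V k)"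
    then show "E (pr (fI c b) e) v \<longleftrightarrow> (E (pr c e) v \<longrightarrow> E (pr b e) v)"
      using tr_simps(4)[OF std(1)] by (simp add: Ev)
  next
    fix x b e z assume *: "E (pr (fA x b) e) (V k)" "E (pr b (adj e (pr x z))) (V k)" "nd x e"
      "E (pr (fA x b) e) v"
    then show "E (pr b (adj e (pr x z))) v"
      using tr_simps(5)[OF std(1)[OF *(1)]] by (simp add: Ev asg_adj)
  next
    fix x b e assume *: "E (pr (fA x b) e) (V k)" "E (pr b (adj e (pr x (pr (fA x b) e)))) (V k)" "nd x e"
      "E (pr b (adj e (pr x (pr (fA x b) e)))) v"
    have s: "std (pr (fA x b) e)" using *(1) by (auto simp: std_def)
    have "tr b ((?A e)(x := I (pr (fA x b) e)))" using *(4) unfolding Ev asg_adj[OF *(3)] by blast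
    then have "tr (fA x b) (?A e)" using I(2)[OF s] tr_simps(5)[OF std(1)[OF *(1)]] by blast
    then show "E (pr (fA x b) e) v" unfolding Ev using *(1) by blast
  next
    show "E (qm 1 w w) v" if "E (qm 1 w w) (V k)" for w using that unfolding qm by simp
  next
    show "atom_clause 1 (V k) v" unfolding atom_clause_def qm unfolding Ev
      using tr_simps(2)[OF std(1)] asg_val by auto
    show "atom_clause 2 (V k) v" unfolding atom_clause_def qm unfolding Ev
      using tr_simps(3)[OF std(1)] asg_val by auto
    show "congruence_clause 1 (V k) v" unfolding congruence_clause_def qm by auto
    show "congruence_clause 2 (V k) v" unfolding congruence_clause_def qm by auto
  qed
  moreover have e0: "?A (ea emp) emp = a"
    using I(1) asg_val[of "ea emp" emp emp] by (simp add: val_def)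
  then have "compat (?A (ea emp)) (ea a)" by (auto simp: compat_def)
  then have "Ver n True f (ea a) \<Longrightarrow> E (pr f (ea emp)) v" "Ver n False f (ea a) \<Longrightarrow> \<not> E (pr f (ea emp)) v"
    if "E (pr f (ea emp)) (V k)" for f
    using Ver_sound[OF std(1)[OF that]] that unfolding Ev by blast+
  moreover have "tr (cd \<theta> 1) (?A (ea emp)) = sat E (=) (\<lambda>_. a) \<theta>"
    unfolding tr_cd[OF assms] using assms e0 by (intro sat_cong_fv) auto
  then have "if sat E (=) (\<lambda>_. a) \<theta> then E (pr (cd \<theta> 1) (ea emp)) v else \<not> E (pr (cd \<theta> 1) (ea emp)) v"
    if "E (pr (cd \<theta> 1) (ea emp)) (V k)"
    using that by (simp add: Ev)
  ultimately show ?thesis unfolding Mod_def by blast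
qed

end

section \<open>The Rosser truth definition\<close>

text \<open>Sequential compactness of the Cantor space of subsets of \<open>C\<close>, by
  diagonalization.\<close>

lemma convergent_subsequence:
  fixes S :: "nat \<Rightarrow> 'a set"
  assumes "countable C"
  obtains r where "strict_mono (r :: nat \<Rightarrow> nat)"
    "\<forall>c\<in>C. (\<forall>\<^sub>F k in sequentially. c \<in> S (r k)) \<or> (\<forall>\<^sub>F k in sequentially. c \<notin> S (r k))"
proof -
  define P where "P n s \<longleftrightarrow> (\<forall>i. from_nat_into C n \<in> S (s i)) \<or> (\<forall>i. from_nat_into C n \<notin> S (s i))"
    for n :: nat and s :: "nat \<Rightarrow> nat"
  have sub: "\<exists>r :: nat \<Rightarrow> nat. strict_mono r \<and> (\<forall>i. r i \<in> A)" if "infinite A" for A :: "nat set"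
    by (rule exI[of _ "enumerate A"]) (use that in \<open>simp add: strict_mono_enumerate enumerate_in_set\<close>)
  interpret subseqs P
  proof
    fix n and s :: "nat \<Rightarrow> nat"
    let ?A = "{i. from_nat_into C n \<in> S (s i)}"
    have "infinite ?A \<or> infinite (- ?A)" by (metis finite_Un Compl_partition infinite_UNIV_nat)
    then obtain r :: "nat \<Rightarrow> nat" where "strict_mono r" "(\<forall>i. r i \<in> ?A) \<or> (\<forall>i. r i \<in> - ?A)"
      using sub[of ?A] sub[of "- ?A"] by blast
    then show "\<exists>r. strict_mono r \<and> P n (s \<circ> r)"
      unfolding P_def by (intro exI[of _ r]) simp
  qed
  have stable: "P n (s \<circ> r)" if "P n s" for n s r
    using that unfolding P_def by auto
  have "(\<forall>\<^sub>F k in sequentially. c \<in> S (diagseq k)) \<or> (\<forall>\<^sub>F k in sequentially. c \<notin> S (diagseq k))"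
    if "c \<in> C" for c
  proof -
    obtain n where n: "from_nat_into C n = c" using from_nat_into_surj[OF assms \<open>c \<in> C\<close>] by blast
    have "P n (diagseq \<circ> ((+) (Suc n)))" by (rule diagseq_holds) (rule stable)
    then have *: "(\<forall>i. c \<in> S (diagseq (Suc n + i))) \<or> (\<forall>i. c \<notin> S (diagseq (Suc n + i)))"
      unfolding P_def n by simp
    have "\<exists>i. k = Suc n + i" if "Suc n \<le> k" for k using that by (rule le_Suc_ex)
    then show ?thesis using * unfolding eventually_sequentially by metis
  qed
  then show ?thesis by (intro that[OF subseq_diagseq] ballI)
qed

context kp
begin

section \<open>Compactness: from the standard stages to a term model\<close>

lemma countable_std: "countable {c. std c}"
proof -
  have "{c. std c} = (\<Union>k. elems (V k))" by (auto simp: std_def)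
  then show ?thesis by (simp only:) (intro countable_UN countable_finite finite_V countableI_type)
qed

lemma std_adj_iff: "std (adj x y) \<longleftrightarrow> std x \<and> std y"
proof
  assume s: "std (adj x y)"
  have "finite (elems x)" using finite_elems_std[OF s] by simp
  moreover have "std z" if "E z x" for z using std_mem[OF s] that by simp
  ultimately show "std x \<and> std y" using std_if_finite std_mem[OF s, of y] by simp
qed simp

lemma HintD:
  assumes "Hint W v"
  shows "\<not> E (pr emp e) v"
    and "E (pr (fI a b) e) W \<Longrightarrow> E (pr a e) W \<Longrightarrow> E (pr b e) W \<Longrightarrow>
      E (pr (fI a b) e) v \<longleftrightarrow> (E (pr a e) v \<longrightarrow> E (pr b e) v)"
    and "E (pr (fA x a) e) W \<Longrightarrow> E (pr a (adj e (pr x z))) W \<Longrightarrow> nd x e \<Longrightarrow>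
      E (pr (fA x a) e) v \<Longrightarrow> E (pr a (adj e (pr x z))) v"
    and "E (pr (fA x a) e) W \<Longrightarrow> E (pr a (adj e (pr x (pr (fA x a) e)))) W \<Longrightarrow> nd x e \<Longrightarrow>
      E (pr a (adj e (pr x (pr (fA x a) e)))) v \<Longrightarrow> E (pr (fA x a) e) v"
    and "E (qm 1 w w) W \<Longrightarrow> E (qm 1 w w) v"
    and "k \<in> {1, 2} \<Longrightarrow> atom_clause k W v" and "k \<in> {1, 2} \<Longrightarrow> congruence_clause k W v"
proof -
  note h = assms[unfolded Hint_def]
  show "\<not> E (pr emp e) v"
    using h[THEN conjunct1] by blast
  show "E (pr (fI a b) e) W \<Longrightarrow> E (pr a e) W \<Longrightarrow> E (pr b e) W \<Longrightarrow>
      E (pr (fI a b) e) v \<longleftrightarrow> (E (pr a e) v \<longrightarrow> E (pr b e) v)"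
    using h[THEN conjunct2, THEN conjunct1] by blast
  show "E (pr (fA x a) e) W \<Longrightarrow> E (pr a (adj e (pr x z))) W \<Longrightarrow> nd x e \<Longrightarrow>
      E (pr (fA x a) e) v \<Longrightarrow> E (pr a (adj e (pr x z))) v"
    using h[THEN conjunct2, THEN conjunct2, THEN conjunct1] by blast
  show "E (pr (fA x a) e) W \<Longrightarrow> E (pr a (adj e (pr x (pr (fA x a) e)))) W \<Longrightarrow> nd x e \<Longrightarrow>
      E (pr a (adj e (pr x (pr (fA x a) e)))) v \<Longrightarrow> E (pr (fA x a) e) v"
    using h[THEN conjunct2, THEN conjunct2, THEN conjunct2, THEN conjunct1] by blast
  show "E (qm 1 w w) W \<Longrightarrow> E (qm 1 w w) v"
    using h[THEN conjunct2, THEN conjunct2, THEN conjunct2, THEN conjunct2, THEN conjunct1] by blast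
  show "k \<in> {1, 2} \<Longrightarrow> atom_clause k W v" "k \<in> {1, 2} \<Longrightarrow> congruence_clause k W v"
    using h by auto
qed

text \<open>\<open>L\<close> is a pointwise limit of Hintikka sets for the standard stages. Each
  clause concerns finitely many closures and so is inherited from one late stage that contains them
  all; the restriction to a stage disappears in the limit.\<close>

lemma compactness:
  assumes "\<And>k. Mod n b (V k) f a" and f: "std f"
  obtains L where "L \<subseteq> {c. std c}"
    and "\<And>e. pr emp e \<notin> L"
    and "\<And>c d e. std (pr (fI c d) e) \<Longrightarrow> pr (fI c d) e \<in> L \<longleftrightarrow> (pr c e \<in> L \<longrightarrow> pr d e \<in> L)"
    and "\<And>x c e z. pr (fA x c) e \<in> L \<Longrightarrow> nd x e \<Longrightarrow> std z \<Longrightarrow> pr c (adj e (pr x z)) \<in> L"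
    and "\<And>x c e. std (pr (fA x c) e) \<Longrightarrow> nd x e \<Longrightarrow> pr c (adj e (pr x (pr (fA x c) e))) \<in> L \<Longrightarrow>
      pr (fA x c) e \<in> L"
    and "\<And>w. std w \<Longrightarrow> qm 1 w w \<in> L"
    and "\<And>k x y e w w'. k \<in> {1, 2} \<Longrightarrow> val e x w \<Longrightarrow> val e y w' \<Longrightarrow> std (pr (pr x y) e) \<Longrightarrow>
      std w \<Longrightarrow> std w' \<Longrightarrow> pr (pr (V k) (pr x y)) e \<in> L \<longleftrightarrow> qm k w w' \<in> L"
    and "\<And>k w w' u u'. k \<in> {1, 2} \<Longrightarrow> qm 1 w u \<in> L \<Longrightarrow> qm 1 w' u' \<in> L \<Longrightarrow> qm k w w' \<in> L \<Longrightarrow>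
      qm k u u' \<in> L"
    and "\<And>g. std g \<Longrightarrow> Ver n True g (ea a) \<Longrightarrow> pr g (ea emp) \<in> L"
    and "\<And>g. std g \<Longrightarrow> Ver n False g (ea a) \<Longrightarrow> pr g (ea emp) \<notin> L"
    and "pr f (ea emp) \<in> L \<longleftrightarrow> b"
proof -
  define Q where "Q k v \<longleftrightarrow> Hint (V k) v \<and>
     (\<forall>g. E (pr g (ea emp)) (V k) \<longrightarrow> (Ver n True g (ea a) \<longrightarrow> E (pr g (ea emp)) v) \<and>
        (Ver n False g (ea a) \<longrightarrow> \<not> E (pr g (ea emp)) v)) \<and>
     (E (pr f (ea emp)) (V k) \<longrightarrow> (if b then E (pr f (ea emp)) v else \<not> E (pr f (ea emp)) v))" for k v
  have "\<forall>k. \<exists>v. Q k v" using assms(1) unfolding Mod_def Q_def by (intro allI)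
  then obtain v where v: "\<And>k. Q k (v k)" by (blast dest: choice)
  have H: "Hint (V k) (v k)" for k using v[of k] unfolding Q_def by blast
  have V: "(Ver n True g (ea a) \<longrightarrow> E (pr g (ea emp)) (v k)) \<and>
      (Ver n False g (ea a) \<longrightarrow> \<not> E (pr g (ea emp)) (v k))" if "E (pr g (ea emp)) (V k)" for k g
    using v[of k] that unfolding Q_def by blast
  have vf: "if b then E (pr f (ea emp)) (v k) else \<not> E (pr f (ea emp)) (v k)"
    if "E (pr f (ea emp)) (V k)" for k
    using v[of k] that unfolding Q_def by blast
  obtain r where r: "strict_mono r" "\<forall>c\<in>{c. std c}. (\<forall>\<^sub>F k in sequentially. c \<in> elems (v (r k))) \<or>
      (\<forall>\<^sub>F k in sequentially. c \<notin> elems (v (r k)))"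
    by (rule convergent_subsequence[OF countable_std, of "\<lambda>k. elems (v k)"])
  define L where "L = {c. std c \<and> (\<forall>\<^sub>F k in sequentially. E c (v (r k)))}"
  have ev: "\<forall>\<^sub>F k in sequentially. (E c (v (r k)) \<longleftrightarrow> c \<in> L) \<and> E c (V (r k))" if "std c" for c
  proof -
    obtain m where "E c (V m)" using \<open>std c\<close> unfolding std_def by blast
    then have "\<forall>\<^sub>F k in sequentially. E c (V (r k))"
      using V_mono[of m _ c] seq_suble[OF r(1)] unfolding eventually_sequentially
      by (meson le_trans)
    moreover have "\<forall>\<^sub>F k in sequentially. E c (v (r k)) \<longleftrightarrow> c \<in> L"
    proof (cases "c \<in> L")
      case True
      then show ?thesis by (auto simp: L_def elim: eventually_mono)
    next
      case False
      then have "\<not> (\<forall>\<^sub>F k in sequentially. c \<in> elems (v (r k)))" using that by (simp add: L_def)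
      then have "\<forall>\<^sub>F k in sequentially. c \<notin> elems (v (r k))" using r(2) that by blast
      then show ?thesis by (rule eventually_mono) (simp add: False)
    qed
    ultimately show ?thesis by (simp add: eventually_conj_iff)
  qed
  have pick: "\<exists>k. \<forall>c\<in>C. (E c (v (r k)) \<longleftrightarrow> c \<in> L) \<and> E c (V (r k))"
    if "finite C" "\<And>c. c \<in> C \<Longrightarrow> std c" for C
  proof -
    have "\<forall>\<^sub>F k in sequentially. \<forall>c\<in>C. (E c (v (r k)) \<longleftrightarrow> c \<in> L) \<and> E c (V (r k))"
      by (rule eventually_ball_finite[OF that(1)]) (use ev that(2) in blast)
    then show ?thesis using eventually_happens' trivial_limit_sequentially by blast
  qed
  have L_std: "std c" if "c \<in> L" for c using that by (simp add: L_def)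
  show ?thesis
  proof (rule that[of L])
    show "L \<subseteq> {c. std c}" using L_std by blast
  next
    fix e show "pr emp e \<notin> L"
    proof
      assume "pr emp e \<in> L"
      moreover from this obtain k where "E (pr emp e) (v (r k)) \<longleftrightarrow> pr emp e \<in> L"
        using pick[of "{pr emp e}"] L_std by blast
      ultimately show False using HintD(1)[OF H] by blast
    qed
  next
    fix c d e assume s: "std (pr (fI c d) e)"
    then have s': "std (pr c e)" "std (pr d e)" by simp_all
    obtain k where "\<forall>x\<in>{pr (fI c d) e, pr c e, pr d e}. (E x (v (r k)) \<longleftrightarrow> x \<in> L) \<and> E x (V (r k))"
      using pick[of "{pr (fI c d) e, pr c e, pr d e}"] s s' by blast
    then show "pr (fI c d) e \<in> L \<longleftrightarrow> (pr c e \<in> L \<longrightarrow> pr d e \<in> L)"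
      using HintD(2)[OF H[of "r k"], of c d e] by blast
  next
    fix x c e z assume m: "pr (fA x c) e \<in> L" and nd: "nd x e" and z: "std z"
    have s: "std (pr (fA x c) e)" using m by (rule L_std)
    then have s': "std (pr c (adj e (pr x z)))" using z by simp
    obtain k where "\<forall>y\<in>{pr (fA x c) e, pr c (adj e (pr x z))}. (E y (v (r k)) \<longleftrightarrow> y \<in> L) \<and> E y (V (r k))"
      using pick[of "{pr (fA x c) e, pr c (adj e (pr x z))}"] s s' by blast
    then show "pr c (adj e (pr x z)) \<in> L"
      using HintD(3)[OF H[of "r k"], of x c e z] m nd by blast
  next
    fix x c e assume s: "std (pr (fA x c) e)" and nd: "nd x e"
      and m: "pr c (adj e (pr x (pr (fA x c) e))) \<in> L"
    obtain k where "\<forall>y\<in>{pr (fA x c) e, pr c (adj e (pr x (pr (fA x c) e)))}.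
        (E y (v (r k)) \<longleftrightarrow> y \<in> L) \<and> E y (V (r k))"
      using pick[of "{pr (fA x c) e, pr c (adj e (pr x (pr (fA x c) e)))}"] s L_std[OF m] by blast
    then show "pr (fA x c) e \<in> L"
      using HintD(4)[OF H[of "r k"], of x c e] m nd by blast
  next
    fix w assume "std w"
    then have "std (qm 1 w w)" by simp
    then obtain k where "\<forall>y\<in>{qm 1 w w}. (E y (v (r k)) \<longleftrightarrow> y \<in> L) \<and> E y (V (r k))"
      using pick[of "{qm 1 w w}"] by blast
    then show "qm 1 w w \<in> L"
      using HintD(5)[OF H[of "r k"], of w] by blast
  next
    fix k :: nat and x y e w w'
    assume k: "k \<in> {1, 2}" and val: "val e x w" "val e y w'" and s: "std (pr (pr x y) e)" "std w" "std w'"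
    let ?p = "pr (pr (V k) (pr x y)) e"
    have "std ?p" "std (qm k w w')" using s by simp_all
    then obtain m where m: "\<forall>y\<in>{?p, qm k w w'}. (E y (v (r m)) \<longleftrightarrow> y \<in> L) \<and> E y (V (r m))"
      using pick[of "{?p, qm k w w'}"] by blast
    have "atom_clause k (V (r m)) (v (r m))" using k by (rule HintD(6)[OF H])
    then have "E ?p (v (r m)) \<longleftrightarrow> E (qm k w w') (v (r m))"
      using m val unfolding atom_clause_def by blast
    then show "?p \<in> L \<longleftrightarrow> qm k w w' \<in> L" using m by blast
  next
    fix k :: nat and w w' u u'
    assume k: "k \<in> {1, 2}" and m: "qm 1 w u \<in> L" "qm 1 w' u' \<in> L" "qm k w w' \<in> L"
    have "std (qm k u u')" using m(1,2)[THEN L_std] by (simp add: std_adj_iff)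
    then obtain j where j: "\<forall>y\<in>{qm 1 w u, qm 1 w' u', qm k w w', qm k u u'}.
        (E y (v (r j)) \<longleftrightarrow> y \<in> L) \<and> E y (V (r j))"
      using pick[of "{qm 1 w u, qm 1 w' u', qm k w w', qm k u u'}"] m[THEN L_std] by blast
    have "congruence_clause k (V (r j)) (v (r j))" using k by (rule HintD(7)[OF H])
    then have "E (qm k u u') (v (r j))"
      using j m unfolding congruence_clause_def by blast
    then show "qm k u u' \<in> L" using j by blast
  next
    fix g assume "std g"
    then have "std (pr g (ea emp))" by simp
    then obtain k where k: "\<forall>y\<in>{pr g (ea emp)}. (E y (v (r k)) \<longleftrightarrow> y \<in> L) \<and> E y (V (r k))"
      using pick[of "{pr g (ea emp)}"] by blast
    show "Ver n True g (ea a) \<Longrightarrow> pr g (ea emp) \<in> L" "Ver n False g (ea a) \<Longrightarrow> pr g (ea emp) \<notin> L"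
      using k V[of g "r k"] by blast+
  next
    have "std (pr f (ea emp))" using f by simp
    then obtain k where k: "\<forall>y\<in>{pr f (ea emp)}. (E y (v (r k)) \<longleftrightarrow> y \<in> L) \<and> E y (V (r k))"
      using pick[of "{pr f (ea emp)}"] by blast
    then show "pr f (ea emp) \<in> L \<longleftrightarrow> b" using vf[of "r k"] by (cases b) auto
  qed
qed


text \<open>The semantic form of completeness over a Sigma_n-axiomatization. The competing
  structures live on the type \<open>'m\<close>, since a definition cannot quantify over types; the
  term model in \<open>Mod_false\<close> is built to fit.\<close>

definition determined :: "nat \<Rightarrow> bool" where
  "determined n \<longleftrightarrow> (\<forall>a E' Q' (c :: 'm) \<theta>. std a \<longrightarrow> congruence E' Q' \<longrightarrow>
     (\<forall>\<phi>\<in>Levy_Sigma n. fv \<phi> \<subseteq> {..<1} \<longrightarrow> sat E (=) (\<lambda>_. a) \<phi> \<longrightarrow> sat E' Q' (\<lambda>_. c) \<phi>) \<longrightarrow>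
     fv \<theta> \<subseteq> {..<1} \<longrightarrow> sat E (=) (\<lambda>_. a) \<theta> \<longrightarrow> sat E' Q' (\<lambda>_. c) \<theta>)"

lemma Mod_false:
  assumes "determined n" and a: "std a" and \<theta>: "fv \<theta> \<subseteq> {..<1}"
  shows "\<exists>k. \<not> Mod n (\<not> sat E (=) (\<lambda>_. a) \<theta>) (V k) (cd \<theta> 1) a"
proof (rule ccontr)
  assume "\<not> ?thesis"
  then have "Mod n (\<not> sat E (=) (\<lambda>_. a) \<theta>) (V k) (cd \<theta> 1) a" for k by blast
  then obtain L where L: "L \<subseteq> {c. std c}"
    "\<And>e. pr emp e \<notin> L"
    "\<And>c d e. std (pr (fI c d) e) \<Longrightarrow> pr (fI c d) e \<in> L \<longleftrightarrow> (pr c e \<in> L \<longrightarrow> pr d e \<in> L)"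
    "\<And>x c e z. pr (fA x c) e \<in> L \<Longrightarrow> nd x e \<Longrightarrow> std z \<Longrightarrow> pr c (adj e (pr x z)) \<in> L"
    "\<And>x c e. std (pr (fA x c) e) \<Longrightarrow> nd x e \<Longrightarrow> pr c (adj e (pr x (pr (fA x c) e))) \<in> L \<Longrightarrow>
      pr (fA x c) e \<in> L"
    "\<And>w. std w \<Longrightarrow> qm 1 w w \<in> L"
    "\<And>k x y e w w'. k \<in> {1, 2} \<Longrightarrow> val e x w \<Longrightarrow> val e y w' \<Longrightarrow> std (pr (pr x y) e) \<Longrightarrow>
      std w \<Longrightarrow> std w' \<Longrightarrow> pr (pr (V k) (pr x y)) e \<in> L \<longleftrightarrow> qm k w w' \<in> L"
    "\<And>k w w' u u'. k \<in> {1, 2} \<Longrightarrow> qm 1 w u \<in> L \<Longrightarrow> qm 1 w' u' \<in> L \<Longrightarrow> qm k w w' \<in> L \<Longrightarrow>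
      qm k u u' \<in> L"
    "\<And>g. std g \<Longrightarrow> Ver n True g (ea a) \<Longrightarrow> pr g (ea emp) \<in> L"
    "\<And>g. std g \<Longrightarrow> Ver n False g (ea a) \<Longrightarrow> pr g (ea emp) \<notin> L"
    "pr (cd \<theta> 1) (ea emp) \<in> L \<longleftrightarrow> \<not> sat E (=) (\<lambda>_. a) \<theta>"
    by (rule compactness[OF _ std_cd]) (rule that)
  \<comment> \<open>Only standard sets are constants of the term model. Folding all other sets onto
    \<open>emp\<close> lets its carrier be the whole type, as \<open>determined\<close>
    demands.\<close>
  define g where "g x = (if std x then x else emp)" for x
  have std_g: "std (g x)" for x by (simp add: g_def)
  define N where "N k x y \<longleftrightarrow> qm k (g x) (g y) \<in> L" for k x y
  have cong: "congruence (N 2) (N 1)"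
    unfolding congruence_def
  proof (intro conjI allI impI)
    show "N 1 x x" for x unfolding N_def by (rule L(6)) (rule std_g)
    show "N 1 x u \<Longrightarrow> N 1 y v \<Longrightarrow> N 1 x y \<Longrightarrow> N 1 u v" for x y u v
      unfolding N_def by (rule L(8)[of 1]) simp
    show "N 1 x u \<Longrightarrow> N 1 y v \<Longrightarrow> N 2 x y \<Longrightarrow> N 2 u v" for x y u v
      unfolding N_def by (rule L(8)[of 2]) simp
  qed
  have atom: "pr (pr (V k) (pr (V (d - Suc i)) (V (d - Suc j)))) (env d (\<lambda>i. g (e i))) \<in> L \<longleftrightarrow>
      N k (e i) (e j)" if "k \<in> {1, 2}" "i < d" "j < d" for k i j d e
    unfolding N_def
    by (rule L(7)[OF that(1)]) (simp_all add: val_def lookup_env that std_env std_g)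
  have truth: "pr (cd \<phi> d) (env d (\<lambda>i. g (e i))) \<in> L \<longleftrightarrow> sat (N 2) (N 1) e \<phi>"
    if "fv \<phi> \<subseteq> {..<d}" for \<phi> d e
    using that
  proof (induction \<phi> arbitrary: d e)
    case Falsum
    then show ?case using L(2) by simp
  next
    case (Equal i j)
    then show ?case using atom[of 1 i d j e] by simp
  next
    case (Mem i j)
    then show ?case using atom[of 2 i d j e] by simp
  next
    case (Imp \<phi> \<psi>)
    have "std (pr (fI (cd \<phi> d) (cd \<psi> d)) (env d (\<lambda>i. g (e i))))" by (simp add: std_env std_g)
    then show ?case using Imp L(3) by simp
  next
    case (Forall \<phi>)
    let ?e = "env d (\<lambda>i. g (e i))" and ?f = "fA (V d) (cd \<phi> (Suc d))"
    have "fv \<phi> \<subseteq> {..<Suc d}" using Forall.prems by (simp only: fv_Forall_bound)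
    then have IH: "pr (cd \<phi> (Suc d)) (adj ?e (pr (V d) (g z))) \<in> L \<longleftrightarrow> sat (N 2) (N 1) (case_nat z e) \<phi>" for z
      using Forall.IH[of "Suc d" "case_nat z e"] by simp
    have std: "std (pr ?f ?e)" by (simp add: std_env std_g)
    then have "g (pr ?f ?e) = pr ?f ?e" by (simp add: g_def)
    then have "pr ?f ?e \<in> L" if "\<forall>z. sat (N 2) (N 1) (case_nat z e) \<phi>"
      using L(5)[OF std nd_env] IH[of "pr ?f ?e"] that by simp
    moreover have "sat (N 2) (N 1) (case_nat z e) \<phi>" if "pr ?f ?e \<in> L" for z
      using L(4)[OF that nd_env std_g] IH by blast
    ultimately show ?case by auto
  qed
  have ea: "env 1 (\<lambda>_. x) = ea x" for x by (simp add: One_nat_def)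
  have truth0: "pr (cd \<phi> 1) (ea emp) \<in> L \<longleftrightarrow> sat (N 2) (N 1) (\<lambda>_. emp) \<phi>" if "fv \<phi> \<subseteq> {..<1}" for \<phi>
    using truth[OF that, of "\<lambda>_. emp"] ea[of emp] by (simp add: g_def)
  have Sigma: "\<forall>\<phi>\<in>Levy_Sigma n. fv \<phi> \<subseteq> {..<1} \<longrightarrow> sat E (=) (\<lambda>_. a) \<phi> \<longrightarrow> sat (N 2) (N 1) (\<lambda>_. emp) \<phi>"
  proof (intro ballI impI)
    fix \<phi> assume \<phi>: "\<phi> \<in> Levy_Sigma n" "fv \<phi> \<subseteq> {..<1}" "sat E (=) (\<lambda>_. a) \<phi>"
    obtain \<chi> where \<chi>: "\<chi> \<in> U n" "fv \<chi> \<subseteq> fv \<phi>"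
      "\<And>E Q (e :: nat \<Rightarrow> 'm). sat E Q e \<chi> = (\<not> sat E Q e \<phi>)"
      using Levy_U[of \<phi> n] \<phi>(1) by blast
    have fv: "fv \<chi> \<subseteq> {..<1}" using \<chi>(2) \<phi>(2) by blast
    have "Ver n False (cd \<chi> 1) (ea a)"
      using Ver_complete[OF \<chi>(1) fv, of "\<lambda>_. a"] \<phi>(3) unfolding \<chi>(3) ea by simp
    then have "pr (cd \<chi> 1) (ea emp) \<notin> L" by (rule L(10)[OF std_cd])
    then show "sat (N 2) (N 1) (\<lambda>_. emp) \<phi>" unfolding truth0[OF fv] \<chi>(3) by simp
  qed
  have N: "sat (N 2) (N 1) (\<lambda>_. emp) \<theta>'" if "fv \<theta>' \<subseteq> {..<1}" "sat E (=) (\<lambda>_. a) \<theta>'" for \<theta>'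
    using assms(1) a cong Sigma that unfolding determined_def by blast
  \<comment> \<open>\<open>N\<close> applies to whichever of \<theta> and its negation holds at
    \<open>a\<close>, whereas \<open>L\<close> gives \<theta> the opposite value.\<close>
  show False
    using N[of \<theta>] N[of "Neg \<theta>"] \<theta> L(11) truth0[OF \<theta>] by auto
qed

text \<open>
  A Rosser-style truth definition: \<open>f\<close> is refuted to be false at a stage before which it is not
  refuted to be true. All standard formulas are decided at a standard stage.
\<close>

definition Tru :: "nat \<Rightarrow> 'm \<Rightarrow> 'm \<Rightarrow> bool" where
  "Tru n f a \<longleftrightarrow> (\<exists>W. Stage W \<and> \<not> Mod n False W f a \<and> (\<forall>W'. E W' W \<and> Stage W' \<longrightarrow> Mod n True W' f a))"

lemma Tru_iff:
  assumes "determined n" "std a" "fv \<theta> \<subseteq> {..<1}"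
  shows "Tru n (cd \<theta> 1) a \<longleftrightarrow> sat E (=) (\<lambda>_. a) \<theta>"
proof
  assume t: "sat E (=) (\<lambda>_. a) \<theta>"
  obtain k where k: "\<not> Mod n False (V k) (cd \<theta> 1) a" using Mod_false[OF assms] t by auto
  have "Mod n True W (cd \<theta> 1) a" if W: "E W (V k)" "Stage W" for W
  proof -
    obtain j where "W = V j" by (rule Stage_mem_V[OF W(2,1)])
    then show ?thesis using Mod_true[OF assms(3), of n a j] t by simp
  qed
  with k show "Tru n (cd \<theta> 1) a" unfolding Tru_def using Stage_V by blast
next
  assume "Tru n (cd \<theta> 1) a"
  then obtain W where W: "Stage W" "\<not> Mod n False W (cd \<theta> 1) a"
    "\<And>W'. E W' W \<Longrightarrow> Stage W' \<Longrightarrow> Mod n True W' (cd \<theta> 1) a"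
    unfolding Tru_def by blast
  show "sat E (=) (\<lambda>_. a) \<theta>"
  proof (rule ccontr)
    assume f: "\<not> ?thesis"
    obtain k where k: "\<not> Mod n True (V k) (cd \<theta> 1) a" using Mod_false[OF assms] f by auto
    \<comment> \<open>By \<open>Mod_true\<close> no standard stage refutes the falsity of \<theta>.
      Hence \<open>W\<close> is nonstandard and lies above the standard stage that refutes its
      truth.\<close>
    have "W \<noteq> V j" for j using Mod_true[OF assms(3), of n a j] f W(2) by auto
    then have "E (V k) W" using Stage_cases[OF W(1), of k] by blast
    then show False using W(3)[OF _ Stage_V] k by blast
  qed
qed

text \<open>Tarski's diagonal argument; the code of the formula serves as its own parameter, so no
  fixed-point lemma enters.\<close>

theorem not_determined: "\<not> determined n"
proof
  assume d: "determined n"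
  have "Def (\<lambda>e. \<not> Tru n (e 0) (e 0))"
    unfolding Tru_def by (intro Def_intros Def_Stage Def_Mod)
  then obtain \<phi> where \<phi>: "\<And>e. sat E (=) e \<phi> \<longleftrightarrow> \<not> Tru n (e 0) (e 0)" unfolding Def_def by blast
  \<comment> \<open>The defining formula may have further free variables, on which its truth does
    not depend. Renaming them all to 0 makes depth 1 adequate for its code.\<close>
  let ?\<theta> = "rename (\<lambda>_. 0) \<phi>"
  have "fv ?\<theta> \<subseteq> {..<1}" by (auto simp: fv_rename)
  then have "Tru n (cd ?\<theta> 1) (cd ?\<theta> 1) \<longleftrightarrow> sat E (=) (\<lambda>_. cd ?\<theta> 1) ?\<theta>" by (rule Tru_iff[OF d std_cd])
  then show False unfolding sat_rename \<phi> by simp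
qed

end

section \<open>Incompleteness\<close>

lemma (in kp) std_definable:
  assumes "std a"
  obtains \<delta> where "\<delta> \<in> Delta0" "fv \<delta> \<subseteq> {..<1}" "\<And>e. sat E (=) e \<delta> \<longleftrightarrow> e 0 = a"
proof -
  obtain \<phi> where \<phi>: "\<phi> \<in> Delta0" "\<And>e. sat E (=) e \<phi> \<longleftrightarrow> e 0 = a"
    using D0_eq_std[OF assms, of 0] unfolding D0_def by blast
  show ?thesis
    by (rule that[of "rename (\<lambda>_. 0) \<phi>"])
      (auto simp: Delta0_rename[OF \<phi>(1)] fv_rename sat_rename \<phi>(2))
qed

theorem theoremC:
  fixes n :: nat and T A :: "fm set"
  assumes "\<forall>\<phi>\<in>T. sentence \<phi>"
    and "consistent T"
    and "extends T KP"
    and "\<forall>\<phi>\<in>A. sentence \<phi> \<and> \<phi> \<in> Levy_Sigma n"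
    and "axiomatized_by T A"
  shows "incomplete T"
proof (rule ccontr)
  assume complete: "\<not> incomplete T"
  obtain E\<^sub>0 Q\<^sub>0 :: "nat \<Rightarrow> nat \<Rightarrow> bool" where
    M0: "congruence E\<^sub>0 Q\<^sub>0" "\<And>\<phi> e. \<phi> \<in> T \<Longrightarrow> sat E\<^sub>0 Q\<^sub>0 e \<phi>"
    using model_existence[OF assms(1,2)] by blast
  have "sat E\<^sub>0 Q\<^sub>0 e \<phi>" if "\<phi> \<in> KP" for \<phi> e
    using soundness[OF M0(1) _ M0(2)] assms(3) that unfolding extends_def by blast
  then have inf: "\<exists>y. \<forall>x\<in>F. \<not> Q\<^sub>0 x y" if "finite F" for F
    using infinitely_many_classes[OF M0(1) _ that] by blast
  obtain E :: "nat \<Rightarrow> nat \<Rightarrow> bool" where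
    E: "\<And>\<phi> e. (\<And>e. sat E\<^sub>0 Q\<^sub>0 e \<phi>) \<Longrightarrow> sat E (=) e \<phi>"
    using true_equality_model[OF M0(1) inf] by blast
  have T: "sat E (=) e \<phi>" if "T \<turnstile> \<phi>" for \<phi> e
    using soundness[OF congruence_eq that E[OF M0(2)]] .
  interpret kp E
    by (rule kp_if_sat_KP, rule T) (use assms(3) in \<open>simp add: extends_def\<close>)
  have T_iff: "T \<turnstile> \<phi>" if "sentence \<phi>" "sat E (=) e \<phi>" for \<phi> e
  proof -
    have "T \<turnstile> \<phi> \<or> T \<turnstile> Neg \<phi>" using complete that(1) by (auto simp: incomplete_def)
    then show ?thesis using T[of "Neg \<phi>" e] that(2) by auto
  qed
  have "determined n"
    unfolding determined_def
  proof (intro allI impI)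
    fix a E' Q' and c :: nat and \<theta>
    assume a: "std a" and cong: "congruence E' Q'"
      and Sigma: "\<forall>\<phi>\<in>Levy_Sigma n. fv \<phi> \<subseteq> {..<1} \<longrightarrow> sat E (=) (\<lambda>_. a) \<phi> \<longrightarrow> sat E' Q' (\<lambda>_. c) \<phi>"
      and \<theta>: "fv \<theta> \<subseteq> {..<1}" "sat E (=) (\<lambda>_. a) \<theta>"
    obtain \<delta> where \<delta>: "\<delta> \<in> Delta0" "fv \<delta> \<subseteq> {..<1}" "\<And>e. sat E (=) e \<delta> \<longleftrightarrow> e 0 = a"
      using std_definable[OF a] by blast
    \<comment> \<open>The sentences in \<open>A\<close> are true in the model and Sigma_n, so they
      belong to the type that \<open>c\<close> realizes.\<close>
    have A: "sat E' Q' e \<phi>" if "\<phi> \<in> A" for \<phi> e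
    proof -
      have \<phi>: "sentence \<phi>" "\<phi> \<in> Levy_Sigma n" using assms(4) that by auto
      then have "T \<turnstile> \<phi>" using assms(5) proves.Axiom[OF that] unfolding axiomatized_by_def by blast
      then have "sat E (=) (\<lambda>_. a) \<phi>" by (rule T)
      then have "sat E' Q' (\<lambda>_. c) \<phi>" using Sigma \<phi> by (simp add: sentence_def)
      then show ?thesis using sat_sentence[OF \<phi>(1)] by blast
    qed
    \<comment> \<open>Completeness decides only sentences, so the parameter \<open>a\<close> is
      replaced by its definition \<delta>.\<close>
    let ?\<psi> = "Forall (Imp \<delta> \<theta>)"
    have s: "sentence ?\<psi>" using \<delta>(2) \<theta>(1) by (auto simp: sentence_def)
    have "sat E (=) (\<lambda>_. a) ?\<psi>"
    proof (simp add: \<delta>(3))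
      have "sat E (=) (case_nat a (\<lambda>_. a)) \<theta> = sat E (=) (\<lambda>_. a) \<theta>"
        by (rule sat_cong_fv) (auto split: nat.splits)
      then show "sat E (=) (case_nat a (\<lambda>_. a)) \<theta>" using \<theta>(2) by simp
    qed
    then have "T \<turnstile> ?\<psi>" by (rule T_iff[OF s])
    then have "A \<turnstile> ?\<psi>" using assms(5) s unfolding axiomatized_by_def by blast
    then have "sat E' Q' (\<lambda>_. c) ?\<psi>" by (rule soundness[OF cong _ A])
    then have "sat E' Q' (case_nat c (\<lambda>_. c)) \<delta> \<longrightarrow> sat E' Q' (case_nat c (\<lambda>_. c)) \<theta>" by simp
    moreover have "case_nat c (\<lambda>_. c) = (\<lambda>_. c)" by (auto split: nat.splits)
    \<comment> \<open>As \<delta> is Delta0, it lies in \<open>Levy_Sigma n\<close> for every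
      \<open>n\<close>, including 0, and so passes from \<open>a\<close> to
      \<open>c\<close>.\<close>
    moreover have "sat E' Q' (\<lambda>_. c) \<delta>"
      using Sigma Delta0_Levy[of n] \<delta> by auto
    ultimately show "sat E' Q' (\<lambda>_. c) \<theta>" by simp
  qed
  then show False using not_determined by blast
qed

end
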